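(* For any $w\in\mathcal{J}$, there exists some subset $\Lambda_w\subset X^*(T)$ independent of $q$ and some coefficients $r_\lambda\in\mathbb{Z}$ such that $$M_w=\sum_{\lambda\in\Lambda_w}r_\lambda\,V_{(q-1)\varpi_{I(w)}+\lambda}.$$
   Context: Setting. $p$ is a prime, $q$ a power of $p$; $G$ is an almost simple simply connected algebraic group over $\overline{\mathbb{F}}_p$, split over $\mathbb{F}_q$ ($p$ sufficiently large, i.e. good for $G$), with split maximal torus $T$, character group $X^*(T)$, Weyl group $W$, simple roots $\Pi$, length $\ell$, longest element $w_0$, fundamental weights $\varpi_i$, $\rho=\sum_i\varpi_i$. $\mathbb{Z}[T]$ is the group ring of $X^*(T)$, with basis $\exp(\lambda)$. For a dominant weight $\lambda$, $V_\lambda$ is the character of the Weyl module corresponding to $\lambda$, given by the Weyl character formula. Basis. For $I\subseteq\Pi$, $\overline{I}=\Pi\setminus I$, $\varpi_I=\sum_{i\in I}\varpi_i$, $W_I=\langle s_i:i\in I\rangle$; $I(w)=\{i:\ell(ws_i)<\ell(w)\}$; $C'_w=\sum_{y\le w}P_{y,w}(1)y\in\mathbb{Z}[W]$ ($P_{y,w}$ the Kazhdan-Lusztig polynomials); $f_w=\frac1{|W_{I(w)}|}C_w'(\exp(\varpi_{\overline{I(w)}}))$, which form a basis of $\mathbb{Z}[T]$ over $\mathbb{Z}[T]^W$. $\langle f,g\rangle=\frac1\delta\sum_{y\in W}\mathrm{sgn}(y)\,y(fg)$ with $\delta=\sum_{y\in W}\mathrm{sgn}(y)\exp(y\rho)$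 the Weyl denominator; $\{f^*_w\}$ is the dual basis, $\langle f_w,f_v^*\rangle=\delta_{w,v}$. $[q]^*\exp(\lambda)=\exp(q\lambda)$. Cells. Left cells are the Kazhdan-Lusztig left cells of $W$, i.e. the equivalence classes of the preorder generated by: $x\le_Ly$ if $C_x'$ occurs in $C_s'C_y'$ for some simple reflection $s$. $\mathcal{J}$ is the set of $w\in W$ such that $w$ and $w^{-1}$ lie in the same left cell. The Duflo involution of a left cell is its unique element minimizing $\ell(w)-2\deg P_{1,w}$. For $w\in\mathcal{J}$, $M_w=\langle[q]^*f_{w_0d},f_{w_0w}^*\rangle$, with $d$ the unique Duflo involution in the left cell of $w$. *)

theory Defs
  imports
    "HOL-Analysis.Analysis"
    "HOL-Library.Poly_Mapping"
    "HOL-Computational_Algebra.Polynomial"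
    "HOL-Computational_Algebra.Primes"
begin

section \<open>Root data\<close>

text \<open>
  The pair \<open>(G, T)\<close> enters only through its root datum with a base. Both \<open>X\<^sup>*(T)\<close> and \<open>X\<^sub>*(T)\<close> are
  \<open>\<int>\<^sup>n\<close> (type \<open>int ^ 'n\<close>), in perfect duality via the standard pairing; no relation between the
  coordinates and the simple roots is presupposed.
\<close>

record 'n based_root_datum =
  roots :: "(int ^ 'n) set"
  coroot :: "int ^ 'n \<Rightarrow> int ^ 'n"
  simples :: "(int ^ 'n) set"

definition pairing :: "int ^ 'n \<Rightarrow> int ^ 'n \<Rightarrow> int" where
  "pairing \<mu> \<kappa> = (\<Sum>i\<in>UNIV. \<mu> $ i * \<kappa> $ i)"

definition reflection :: "'n::finite based_root_datum \<Rightarrow> int ^ 'n \<Rightarrow> int ^ 'n \<Rightarrow> int ^ 'n" where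
  "reflection R \<alpha> \<mu> = \<mu> - pairing \<mu> (coroot R \<alpha>) *s \<alpha>"

definition coreflection :: "'n::finite based_root_datum \<Rightarrow> int ^ 'n \<Rightarrow> int ^ 'n \<Rightarrow> int ^ 'n" where
  "coreflection R \<alpha> \<kappa> = \<kappa> - pairing \<alpha> \<kappa> *s coroot R \<alpha>"

definition is_root_datum :: "'n::finite based_root_datum \<Rightarrow> bool" where
  "is_root_datum R \<longleftrightarrow>
     finite (roots R) \<and> inj_on (coroot R) (roots R) \<and>
     (\<forall>\<alpha>\<in>roots R. pairing \<alpha> (coroot R \<alpha>) = 2 \<and>
        reflection R \<alpha> ` roots R \<subseteq> roots R \<and>
        coreflection R \<alpha> ` coroot R ` roots R \<subseteq> coroot R ` roots R)"

definition is_reduced :: "'n::finite based_root_datum \<Rightarrow> bool" where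
  "is_reduced R \<longleftrightarrow> (\<forall>\<alpha>\<in>roots R. 2 *s \<alpha> \<notin> roots R)"

definition is_irreducible :: "'n::finite based_root_datum \<Rightarrow> bool" where
  "is_irreducible R \<longleftrightarrow> roots R \<noteq> {} \<and>
     \<not> (\<exists>A B. A \<noteq> {} \<and> B \<noteq> {} \<and> A \<inter> B = {} \<and> A \<union> B = roots R \<and>
          (\<forall>\<alpha>\<in>A. \<forall>\<beta>\<in>B. pairing \<alpha> (coroot R \<beta>) = 0))"

definition is_base :: "'n::finite based_root_datum \<Rightarrow> bool" where
  "is_base R \<longleftrightarrow> simples R \<subseteq> roots R \<and>
     (\<forall>c. (\<Sum>\<alpha>\<in>simples R. c \<alpha> *s \<alpha>) = 0 \<longrightarrow> (\<forall>\<alpha>\<in>simples R. c \<alpha> = 0)) \<and>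
     (\<forall>\<beta>\<in>roots R. \<exists>c. \<beta> = (\<Sum>\<alpha>\<in>simples R. c \<alpha> *s \<alpha>) \<and>
        ((\<forall>\<alpha>\<in>simples R. c \<alpha> \<ge> 0) \<or> (\<forall>\<alpha>\<in>simples R. c \<alpha> \<le> 0)))"

text \<open>Simple connectedness: the coroots generate \<open>X\<^sub>*(T)\<close>; in particular \<open>G\<close> is semisimple.\<close>

definition is_simply_connected :: "'n::finite based_root_datum \<Rightarrow> bool" where
  "is_simply_connected R \<longleftrightarrow> (\<forall>\<kappa>. \<exists>c. \<kappa> = (\<Sum>\<alpha>\<in>roots R. c \<alpha> *s coroot R \<alpha>))"

definition almost_simple_simply_connected :: "'n::finite based_root_datum \<Rightarrow> bool" where
  "almost_simple_simply_connected R \<longleftrightarrow>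
     is_root_datum R \<and> is_reduced R \<and> is_irreducible R \<and> is_base R \<and> is_simply_connected R"

definition highest_root :: "'n::finite based_root_datum \<Rightarrow> int ^ 'n \<Rightarrow> bool" where
  "highest_root R \<theta> \<longleftrightarrow> \<theta> \<in> roots R \<and>
     (\<forall>\<beta>\<in>roots R. \<exists>c. (\<forall>\<alpha>\<in>simples R. c \<alpha> \<ge> 0) \<and> \<theta> - \<beta> = (\<Sum>\<alpha>\<in>simples R. c \<alpha> *s \<alpha>))"

definition good_prime :: "'n::finite based_root_datum \<Rightarrow> nat \<Rightarrow> bool" where
  "good_prime R p \<longleftrightarrow> prime p \<and>
     (\<forall>\<theta> c. highest_root R \<theta> \<and> \<theta> = (\<Sum>\<alpha>\<in>simples R. c \<alpha> *s \<alpha>) \<longrightarrow>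
        (\<forall>\<alpha>\<in>simples R. \<not> int p dvd c \<alpha>))"


section \<open>Weyl group and weights\<close>

text \<open>Elements of \<open>W\<close> are the transformations of \<open>X\<^sup>*(T)\<close> they induce; subsets \<open>I\<close> are sets of simple roots.\<close>

type_synonym 'n weyl_elt = "int ^ 'n \<Rightarrow> int ^ 'n"

definition refl_word :: "'n::finite based_root_datum \<Rightarrow> (int ^ 'n) list \<Rightarrow> 'n weyl_elt" where
  "refl_word R as = foldr (\<lambda>\<alpha> w. reflection R \<alpha> \<circ> w) as id"

definition parabolic :: "'n::finite based_root_datum \<Rightarrow> (int ^ 'n) set \<Rightarrow> 'n weyl_elt set" where
  "parabolic R I = {refl_word R as | as. set as \<subseteq> I}"

definition weyl :: "'n::finite based_root_datum \<Rightarrow> 'n weyl_elt set" where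
  "weyl R = parabolic R (simples R)"

definition len :: "'n::finite based_root_datum \<Rightarrow> 'n weyl_elt \<Rightarrow> nat" where
  "len R w = (LEAST k. \<exists>as. set as \<subseteq> simples R \<and> length as = k \<and> refl_word R as = w)"

definition sgn_W :: "'n::finite based_root_datum \<Rightarrow> 'n weyl_elt \<Rightarrow> int" where
  "sgn_W R w = (- 1) ^ len R w"

definition longest :: "'n::finite based_root_datum \<Rightarrow> 'n weyl_elt" where
  "longest R = (THE w. w \<in> weyl R \<and> (\<forall>x\<in>weyl R. len R x \<le> len R w))"

definition descents :: "'n::finite based_root_datum \<Rightarrow> 'n weyl_elt \<Rightarrow> (int ^ 'n) set" where
  "descents R w = {\<alpha> \<in> simples R. len R (w \<circ> reflection R \<alpha>) < len R w}"

definition bruhat_le :: "'n::finite based_root_datum \<Rightarrow> 'n weyl_elt \<Rightarrow> 'n weyl_elt \<Rightarrow> bool" where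
  "bruhat_le R x y \<longleftrightarrow> x \<in> weyl R \<and>
     (\<lambda>u v. \<exists>\<beta>\<in>roots R. v = u \<circ> reflection R \<beta> \<and> len R u < len R v)\<^sup>*\<^sup>* x y"

definition fund_weight :: "'n::finite based_root_datum \<Rightarrow> int ^ 'n \<Rightarrow> int ^ 'n" where
  "fund_weight R \<alpha> =
     (THE \<mu>. \<forall>\<beta>\<in>simples R. pairing \<mu> (coroot R \<beta>) = (if \<beta> = \<alpha> then 1 else 0))"

definition fund_sum :: "'n::finite based_root_datum \<Rightarrow> (int ^ 'n) set \<Rightarrow> int ^ 'n" where
  "fund_sum R I = (\<Sum>\<alpha>\<in>I. fund_weight R \<alpha>)"

definition rho :: "'n::finite based_root_datum \<Rightarrow> int ^ 'n" where
  "rho R = fund_sum R (simples R)"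

definition dominant :: "'n::finite based_root_datum \<Rightarrow> int ^ 'n \<Rightarrow> bool" where
  "dominant R \<mu> \<longleftrightarrow> (\<forall>\<alpha>\<in>simples R. pairing \<mu> (coroot R \<alpha>) \<ge> 0)"


section \<open>The group ring of the weight lattice\<close>

text \<open>
  \<open>\<int>[T]\<close> is the ring of finitely supported functions \<open>X\<^sup>*(T) \<rightarrow> \<int>\<close> under convolution. It is a torsion-free
  integral domain, so an exact quotient is unique when it exists.
\<close>

type_synonym 'n torus_ring = "(int ^ 'n) \<Rightarrow>\<^sub>0 int"

definition expw :: "int ^ 'n \<Rightarrow> 'n torus_ring" where
  "expw \<mu> = Poly_Mapping.single \<mu> 1"

definition exact_div :: "'n::finite torus_ring \<Rightarrow> 'n torus_ring \<Rightarrow> 'n torus_ring" where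
  "exact_div f g = (THE h. g * h = f)"

text \<open>The additive extension of \<open>exp(\<mu>) \<mapsto> exp(\<phi>(\<mu>))\<close>.\<close>

definition push :: "(int ^ 'n \<Rightarrow> int ^ 'n) \<Rightarrow> 'n torus_ring \<Rightarrow> 'n torus_ring" where
  "push \<phi> f = (\<Sum>\<mu>\<in>Poly_Mapping.keys f. Poly_Mapping.single (\<phi> \<mu>) (Poly_Mapping.lookup f \<mu>))"

definition frob_pull :: "nat \<Rightarrow> 'n::finite torus_ring \<Rightarrow> 'n torus_ring" where
  "frob_pull q = push (\<lambda>\<mu>. int q *s \<mu>)"

definition antisym :: "'n::finite based_root_datum \<Rightarrow> 'n torus_ring \<Rightarrow> 'n torus_ring" where
  "antisym R f = (\<Sum>y\<in>weyl R. of_int (sgn_W R y) * push y f)"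

definition weyl_denom :: "'n::finite based_root_datum \<Rightarrow> 'n torus_ring" where
  "weyl_denom R = antisym R (expw (rho R))"

definition form :: "'n::finite based_root_datum \<Rightarrow> 'n torus_ring \<Rightarrow> 'n torus_ring \<Rightarrow> 'n torus_ring" where
  "form R f g = exact_div (antisym R (f * g)) (weyl_denom R)"

text \<open>
  Weyl's formula. It is the character of the Weyl module for dominant \<open>\<mu>\<close>; for other \<open>\<mu>\<close> it gives
  zero or, up to sign, the character of another Weyl module.
\<close>

definition weyl_char :: "'n::finite based_root_datum \<Rightarrow> int ^ 'n \<Rightarrow> 'n torus_ring" where
  "weyl_char R \<mu> = exact_div (antisym R (expw (\<mu> + rho R))) (weyl_denom R)"


section \<open>Kazhdan-Lusztig polynomials\<close>

text \<open>
  Hecke algebra over \<open>\<int>[v, v\<^sup>-\<^sup>1]\<close>, \<open>v = q\<^sup>1\<^sup>/\<^sup>2\<close> for the Hecke parameter \<open>q\<close>, in the standard basis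
  \<open>T\<^sub>w\<close>: \<open>T\<^sub>s T\<^sub>w = T\<^sub>s\<^sub>w\<close> if \<open>sw > w\<close> and \<open>T\<^sub>s T\<^sub>w = (q - 1) T\<^sub>w + q T\<^sub>s\<^sub>w\<close> if \<open>sw < w\<close>. An element is
  the function sending \<open>w\<close> to the coefficient of \<open>T\<^sub>w\<close>.
\<close>

type_synonym laurent = "int \<Rightarrow>\<^sub>0 int"

type_synonym 'n hecke = "'n weyl_elt \<Rightarrow> laurent"

definition vpow :: "int \<Rightarrow> laurent" where
  "vpow k = Poly_Mapping.single k 1"

definition laurent_bar :: "laurent \<Rightarrow> laurent" where
  "laurent_bar f = (\<Sum>k\<in>Poly_Mapping.keys f. Poly_Mapping.single (- k) (Poly_Mapping.lookup f k))"

definition hecke_T :: "'n::finite weyl_elt \<Rightarrow> 'n hecke" where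
  "hecke_T w = (\<lambda>x. if x = w then 1 else 0)"

text \<open>Left multiplication by \<open>T\<^sub>s\<close> and by \<open>T\<^sub>s\<^sup>-\<^sup>1 = q\<^sup>-\<^sup>1 T\<^sub>s + (q\<^sup>-\<^sup>1 - 1)\<close>, for \<open>s = s\<^sub>\<alpha>\<close>, read off on coefficients.\<close>

definition hecke_T_mult :: "'n::finite based_root_datum \<Rightarrow> int ^ 'n \<Rightarrow> 'n hecke \<Rightarrow> 'n hecke" where
  "hecke_T_mult R \<alpha> h = (\<lambda>x. let sx = reflection R \<alpha> \<circ> x in
     if len R sx < len R x then h sx + (vpow 2 - 1) * h x else vpow 2 * h sx)"

definition hecke_Tinv_mult :: "'n::finite based_root_datum \<Rightarrow> int ^ 'n \<Rightarrow> 'n hecke \<Rightarrow> 'n hecke" where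
  "hecke_Tinv_mult R \<alpha> h = (\<lambda>x. vpow (- 2) * hecke_T_mult R \<alpha> h x + (vpow (- 2) - 1) * h x)"

text \<open>
  The bar involution is semilinear for \<open>v \<mapsto> v\<^sup>-\<^sup>1\<close> and sends \<open>T\<^sub>w\<close> to \<open>(T\<^bsub>w\<^sup>-\<^sup>1\<^esub>)\<^sup>-\<^sup>1\<close>, which is the product
  \<open>T\<^sub>1\<^sup>-\<^sup>1 \<dots> T\<^sub>k\<^sup>-\<^sup>1\<close> along any reduced word \<open>w = s\<^sub>1 \<dots> s\<^sub>k\<close>.
\<close>

definition reduced_word :: "'n::finite based_root_datum \<Rightarrow> 'n weyl_elt \<Rightarrow> (int ^ 'n) list" where
  "reduced_word R w =
     (SOME as. set as \<subseteq> simples R \<and> refl_word R as = w \<and> length as = len R w)"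

definition hecke_bar_T :: "'n::finite based_root_datum \<Rightarrow> 'n weyl_elt \<Rightarrow> 'n hecke" where
  "hecke_bar_T R w = foldr (hecke_Tinv_mult R) (reduced_word R w) (hecke_T id)"

definition hecke_bar :: "'n::finite based_root_datum \<Rightarrow> 'n hecke \<Rightarrow> 'n hecke" where
  "hecke_bar R h = (\<lambda>x. \<Sum>w\<in>weyl R. laurent_bar (h w) * hecke_bar_T R w x)"

text \<open>\<open>v\<^bsup>-\<ell>(w)\<^esup> \<Sum> P\<^sub>y(q) T\<^sub>y\<close>, with \<open>P\<^sub>y \<in> \<int>[q]\<close> and \<open>q = v\<^sup>2\<close>.\<close>

definition kl_element ::
  "'n::finite based_root_datum \<Rightarrow> 'n weyl_elt \<Rightarrow> ('n weyl_elt \<Rightarrow> int poly) \<Rightarrow> 'n hecke" where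
  "kl_element R w P = (\<lambda>y. vpow (- int (len R w)) * poly (map_poly of_int (P y)) (vpow 2))"

definition is_kl_family ::
  "'n::finite based_root_datum \<Rightarrow> 'n weyl_elt \<Rightarrow> ('n weyl_elt \<Rightarrow> int poly) \<Rightarrow> bool" where
  "is_kl_family R w P \<longleftrightarrow>
     P w = 1 \<and>
     (\<forall>y. \<not> bruhat_le R y w \<longrightarrow> P y = 0) \<and>
     (\<forall>y. bruhat_le R y w \<and> y \<noteq> w \<longrightarrow> 2 * degree (P y) + 1 + len R y \<le> len R w) \<and>
     hecke_bar R (kl_element R w P) = kl_element R w P"

definition kl_poly :: "'n::finite based_root_datum \<Rightarrow> 'n weyl_elt \<Rightarrow> 'n weyl_elt \<Rightarrow> int poly" where
  "kl_poly R y w = (THE P. is_kl_family R w P) y"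


section \<open>The Kazhdan-Lusztig basis of the group ring of the Weyl group, and left cells\<close>

type_synonym 'n weyl_ring = "'n weyl_elt \<Rightarrow> int"

definition weyl_ring_mult ::
  "'n::finite based_root_datum \<Rightarrow> 'n weyl_ring \<Rightarrow> 'n weyl_ring \<Rightarrow> 'n weyl_ring" where
  "weyl_ring_mult R a b =
     (\<lambda>x. \<Sum>y\<in>weyl R. \<Sum>z\<in>weyl R. if y \<circ> z = x then a y * b z else 0)"

definition weyl_ring_act ::
  "'n::finite based_root_datum \<Rightarrow> 'n weyl_ring \<Rightarrow> 'n torus_ring \<Rightarrow> 'n torus_ring" where
  "weyl_ring_act R a f = (\<Sum>y\<in>weyl R. of_int (a y) * push y f)"

definition kl_basis :: "'n::finite based_root_datum \<Rightarrow> 'n weyl_elt \<Rightarrow> 'n weyl_ring" where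
  "kl_basis R w = (\<lambda>y. if bruhat_le R y w then poly (kl_poly R y w) 1 else 0)"

definition occurs_in :: "'n::finite based_root_datum \<Rightarrow> 'n weyl_elt \<Rightarrow> 'n weyl_ring \<Rightarrow> bool" where
  "occurs_in R x a \<longleftrightarrow>
     (\<exists>c. (\<forall>u. a u = (\<Sum>z\<in>weyl R. c z * kl_basis R z u)) \<and> c x \<noteq> 0)"

definition left_le :: "'n::finite based_root_datum \<Rightarrow> 'n weyl_elt \<Rightarrow> 'n weyl_elt \<Rightarrow> bool" where
  "left_le R = (\<lambda>x y. x \<in> weyl R \<and> y \<in> weyl R \<and>
     (\<exists>\<alpha>\<in>simples R. occurs_in R x (weyl_ring_mult R (kl_basis R (reflection R \<alpha>)) (kl_basis R y))))\<^sup>*\<^sup>*"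

definition left_cell :: "'n::finite based_root_datum \<Rightarrow> 'n weyl_elt \<Rightarrow> 'n weyl_elt set" where
  "left_cell R w = {x \<in> weyl R. left_le R x w \<and> left_le R w x}"

definition cell_J :: "'n::finite based_root_datum \<Rightarrow> 'n weyl_elt set" where
  "cell_J R = {w \<in> weyl R. inv w \<in> left_cell R w}"

text \<open>By a theorem of Lusztig the minimum is attained exactly once, so no choice is involved.\<close>

definition duflo :: "'n::finite based_root_datum \<Rightarrow> 'n weyl_elt \<Rightarrow> 'n weyl_elt" where
  "duflo R w =
     arg_min_on (\<lambda>x. int (len R x) - 2 * int (degree (kl_poly R id x))) (left_cell R w)"


section \<open>The basis, the dual basis and the matrix coefficients\<close>

definition fbasis :: "'n::finite based_root_datum \<Rightarrow> 'n weyl_elt \<Rightarrow> 'n torus_ring" where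
  "fbasis R w = exact_div
     (weyl_ring_act R (kl_basis R w) (expw (fund_sum R (simples R - descents R w))))
     (of_nat (card (parabolic R (descents R w))))"

definition fdual :: "'n::finite based_root_datum \<Rightarrow> 'n weyl_elt \<Rightarrow> 'n torus_ring" where
  "fdual R v = (THE g. \<forall>w\<in>weyl R. form R (fbasis R w) g = (if w = v then 1 else 0))"

definition M_coeff :: "'n::finite based_root_datum \<Rightarrow> nat \<Rightarrow> 'n weyl_elt \<Rightarrow> 'n torus_ring" where
  "M_coeff R q w =
     form R (frob_pull q (fbasis R (longest R \<circ> duflo R w))) (fdual R (longest R \<circ> w))"

end

theory Submission
  imports Defs
begin

text \<open>
  Put \<open>I = I(w)\<close>. Right descent sets are constant on left cells, so \<open>\<Pi> - I(w\<^sub>0 d) = I(d) = I\<close> and \<open>f\<^bsub>w\<^sub>0 d\<^esub>\<close> is an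
  integral combination of \<open>exp(y \<varpi>\<^sub>I)\<close>, \<open>y \<in> W\<close>; integrality holds because \<open>P\<^bsub>ys,w\<^esub> = P\<^bsub>y,w\<^esub>\<close> for \<open>ws < w\<close>. Expand the
  dual basis element in the \<open>exp(\<nu>)\<close>. Antisymmetrizing \<open>exp(q y \<varpi>\<^sub>I + \<nu>)\<close> gives, up to sign, the
  antisymmetrization of \<open>exp(q \<varpi>\<^sub>I + y\<^sup>-\<^sup>1 \<nu>)\<close>, that is, \<open>\<delta>\<close> times \<open>V\<close> at \<open>(q - 1) \<varpi>\<^sub>I + \<lambda>\<close> with
  \<open>\<lambda> = \<varpi>\<^sub>I + y\<^sup>-\<^sup>1 \<nu> - \<rho>\<close>. The stabilizer of \<open>\<varpi>\<^sub>I\<close> generated by the \<open>s\<^sub>\<alpha>\<close>, \<open>\<alpha> \<notin> I\<close>, can be used to make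
  \<open>\<lambda>\<close> dominant in the directions outside \<open>I\<close>, or else the term vanishes; in the directions of \<open>I\<close> the
  weight becomes dominant for large \<open>q\<close>. Of the dual basis only its independence of \<open>q\<close> matters.
\<close>

section \<open>Pairings and reflections\<close>

text \<open>The objects of the statement are given by descriptions: \<open>kl_poly\<close>,
  \<open>longest\<close>, \<open>fund_weight\<close> and \<open>exact_div\<close> by THE, reduced
  words by SOME. Existence and uniqueness must be settled before any of them can be computed with,
  and this shapes most of the development. The symmetry of Kazhdan-Lusztig polynomials under right
  descents, which serves both the integrality of \<open>fbasis\<close> and the constancy of descents
  on left cells, is obtained together with existence: an element built by right multiplication with
  1 + T_s is symmetric under s by construction, and uniqueness transfers this to the one family of
  polynomials for every descent s. The Hecke algebra appears only through left and right
  multiplication operators on coefficient functions; that these commute does the work of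
  associativity and of the braid relations. Divisibility by \<delta> is shown for arbitrary weights,
  because those met at a given q need not be dominant. Exponentials are straightened for all integer
  multipliers m at once, so \<Lambda> and r are fixed before q is chosen.\<close>

lemma pairing_add_left: "pairing (x + y) \<kappa> = pairing x \<kappa> + pairing y \<kappa>"
  by (simp add: pairing_def algebra_simps sum.distrib)

lemma pairing_diff_left: "pairing (x - y) \<kappa> = pairing x \<kappa> - pairing y \<kappa>"
  by (simp add: pairing_def algebra_simps sum_subtractf)

lemma pairing_smult_left: "pairing (c *s x) \<kappa> = c * pairing x \<kappa>"
  by (simp add: pairing_def algebra_simps sum_distrib_left)

lemma pairing_uminus_left: "pairing (- x) \<kappa> = - pairing x \<kappa>"
  by (simp add: pairing_def sum_negf)

lemma pairing_zero_left: "pairing 0 \<kappa> = 0"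
  by (simp add: pairing_def)

lemma pairing_commute: "pairing x \<kappa> = pairing \<kappa> x"
  by (simp add: pairing_def mult.commute)

lemma pairing_sum_left: "pairing (\<Sum>i\<in>A. f i) \<kappa> = (\<Sum>i\<in>A. pairing (f i) \<kappa>)"
  by (induction A rule: infinite_finite_induct) (simp_all add: pairing_add_left pairing_zero_left)

lemma pairing_add_right: "pairing x (\<kappa> + \<eta>) = pairing x \<kappa> + pairing x \<eta>"
  by (metis pairing_add_left pairing_commute)

lemma pairing_diff_right: "pairing x (\<kappa> - \<eta>) = pairing x \<kappa> - pairing x \<eta>"
  by (metis pairing_diff_left pairing_commute)

lemma pairing_smult_right: "pairing x (c *s \<kappa>) = c * pairing x \<kappa>"
  by (metis pairing_smult_left pairing_commute)

lemma pairing_uminus_right: "pairing x (- \<kappa>) = - pairing x \<kappa>"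
  by (metis pairing_uminus_left pairing_commute)

lemma pairing_zero_right: "pairing x 0 = 0"
  by (simp add: pairing_def)

lemma pairing_sum_right: "pairing x (\<Sum>i\<in>A. f i) = (\<Sum>i\<in>A. pairing x (f i))"
  by (simp add: pairing_commute[of x] pairing_sum_left)

lemmas pairing_simps =
  pairing_add_left pairing_diff_left pairing_smult_left pairing_uminus_left pairing_zero_left
  pairing_add_right pairing_diff_right pairing_smult_right pairing_uminus_right pairing_zero_right

lemma pairing_axis: "pairing x (axis i 1) = x $ i"
  by (simp add: pairing_def axis_def if_distrib cong: if_cong)

lemma pairing_eq_zeroI: "(\<And>\<kappa>. pairing x \<kappa> = 0) \<Longrightarrow> x = 0"
  by (metis pairing_axis vec_eq_iff zero_index)

lemma smult_cancel_int: "c *s (x :: int ^ 'n) = 0 \<longleftrightarrow> c = 0 \<or> x = 0"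
  by (auto simp: vec_eq_iff)

text \<open>The finiteness input of \<open>coroot_reflection\<close>: iterating a unipotent map
  inside the finite root set would otherwise produce infinitely many roots.\<close>

lemma finite_arith_progression:
  fixes x v :: "int ^ 'n"
  assumes "finite A" "\<And>n::nat. x + int n *s v \<in> A"
  shows "v = 0"
proof (rule ccontr)
  assume "v \<noteq> 0"
  then obtain i where i: "v $ i \<noteq> 0" by (auto simp: vec_eq_iff)
  have "inj (\<lambda>n::nat. x + int n *s v)"
  proof (rule injI)
    fix m n :: nat
    assume "x + int m *s v = x + int n *s v"
    then have "(x + int m *s v) $ i = (x + int n *s v) $ i" by (rule arg_cong)
    with i show "m = n" by simp
  qed
  moreover have "range (\<lambda>n::nat. x + int n *s v) \<subseteq> A" using assms(2) by auto
  ultimately show False using assms(1) finite_subset infinite_UNIV_nat finite_imageD by blast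
qed

lemma reflection_add: "reflection R \<alpha> (x + y) = reflection R \<alpha> x + reflection R \<alpha> y"
  by (simp add: reflection_def pairing_simps vec_eq_iff algebra_simps)

lemma reflection_diff: "reflection R \<alpha> (x - y) = reflection R \<alpha> x - reflection R \<alpha> y"
  by (simp add: reflection_def pairing_simps vec_eq_iff algebra_simps)

lemma reflection_smult: "reflection R \<alpha> (c *s x) = c *s reflection R \<alpha> x"
  by (simp add: reflection_def pairing_simps vec_eq_iff algebra_simps)

lemma pairing_reflection: "pairing (reflection R \<alpha> x) \<kappa> = pairing x (coreflection R \<alpha> \<kappa>)"
  by (simp add: reflection_def coreflection_def pairing_simps)

section \<open>Words in reflections and the groups they generate\<close>

lemma refl_word_Nil [simp]: "refl_word R [] = id"
  and refl_word_Cons [simp]: "refl_word R (a # as) = reflection R a \<circ> refl_word R as"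
  by (simp_all add: refl_word_def)

lemma refl_word_append: "refl_word R (as @ bs) = refl_word R as \<circ> refl_word R bs"
  by (induction as) (simp_all add: comp_assoc)

lemma refl_word_add: "refl_word R as (x + y) = refl_word R as x + refl_word R as y"
  by (induction as) (simp_all add: reflection_add)

lemma refl_word_smult: "refl_word R as (c *s x) = c *s refl_word R as x"
  by (induction as) (simp_all add: reflection_smult)

lemma parabolic_id [simp]: "id \<in> parabolic R J"
  unfolding parabolic_def by (auto intro!: exI[of _ "[]"])

lemma parabolic_comp: "u \<in> parabolic R J \<Longrightarrow> v \<in> parabolic R J \<Longrightarrow> u \<circ> v \<in> parabolic R J"
  unfolding parabolic_def
proof safe
  fix as bs assume "set as \<subseteq> J" "set bs \<subseteq> J"
  then show "\<exists>cs. refl_word R as \<circ> refl_word R bs = refl_word R cs \<and> set cs \<subseteq> J"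
    by (intro exI[of _ "as @ bs"]) (simp add: refl_word_append)
qed

lemma parabolic_reflection: "\<alpha> \<in> J \<Longrightarrow> reflection R \<alpha> \<in> parabolic R J"
  unfolding parabolic_def by (auto intro!: exI[of _ "[\<alpha>]"])

lemma parabolic_mono: "J \<subseteq> K \<Longrightarrow> parabolic R J \<subseteq> parabolic R K"
  unfolding parabolic_def by auto

lemma weyl_word: "w \<in> weyl R \<longleftrightarrow> (\<exists>as. set as \<subseteq> simples R \<and> w = refl_word R as)"
  by (auto simp: weyl_def parabolic_def)

lemma weyl_add: "w \<in> weyl R \<Longrightarrow> w (x + y) = w x + w y"
  by (auto simp: weyl_word refl_word_add)

lemma weyl_smult: "w \<in> weyl R \<Longrightarrow> w (c *s x) = c *s w x"
  by (auto simp: weyl_word refl_word_smult)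

lemma weyl_zero: "w \<in> weyl R \<Longrightarrow> w 0 = 0"
  using weyl_smult[of w R 0 0] by simp

lemma weyl_uminus: "w \<in> weyl R \<Longrightarrow> w (- x) = - w x"
  using weyl_smult[of w R "-1" x] by (simp add: vector_sneg_minus1[symmetric])

lemma weyl_diff: "w \<in> weyl R \<Longrightarrow> w (x - y) = w x - w y"
  using weyl_add[of w R x "-y"] by (simp add: weyl_uminus)

lemma weyl_sum: "w \<in> weyl R \<Longrightarrow> w (\<Sum>i\<in>A. f i) = (\<Sum>i\<in>A. w (f i))"
  by (induction A rule: infinite_finite_induct) (simp_all add: weyl_add weyl_zero)

section \<open>Root systems and the length function\<close>

locale simply_connected_datum =
  fixes R :: "'n::finite based_root_datum"
  assumes root_datum: "is_root_datum R"
    and reduced: "is_reduced R"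
    and base: "is_base R"
    and simply_connected: "is_simply_connected R"
begin

abbreviation \<sigma> where "\<sigma> \<equiv> reflection R"
abbreviation W where "W \<equiv> weyl R"
abbreviation \<Phi> where "\<Phi> \<equiv> roots R"
abbreviation \<Delta> where "\<Delta> \<equiv> simples R"
abbreviation \<l> where "\<l> \<equiv> len R"

lemma finite_roots [simp]: "finite \<Phi>"
  using root_datum by (simp add: is_root_datum_def)

lemma simple_root: "\<alpha> \<in> \<Delta> \<Longrightarrow> \<alpha> \<in> \<Phi>"
  using base by (auto simp: is_base_def)

lemma finite_simples [simp]: "finite \<Delta>"
  using finite_subset[of \<Delta> \<Phi>] simple_root by auto

lemma pairing_coroot: "\<alpha> \<in> \<Phi> \<Longrightarrow> pairing \<alpha> (coroot R \<alpha>) = 2"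
  using root_datum by (simp add: is_root_datum_def)

lemma root_nonzero: "\<alpha> \<in> \<Phi> \<Longrightarrow> \<alpha> \<noteq> 0"
  using pairing_coroot by (force simp: pairing_zero_left)

lemma reflection_root: "\<alpha> \<in> \<Phi> \<Longrightarrow> \<beta> \<in> \<Phi> \<Longrightarrow> \<sigma> \<alpha> \<beta> \<in> \<Phi>"
  using root_datum by (auto simp: is_root_datum_def)

lemma coreflection_coroot:
  "\<alpha> \<in> \<Phi> \<Longrightarrow> \<beta> \<in> \<Phi> \<Longrightarrow> coreflection R \<alpha> (coroot R \<beta>) \<in> coroot R ` \<Phi>"
  using root_datum by (simp add: is_root_datum_def) blast

lemma reflection_self: "\<alpha> \<in> \<Phi> \<Longrightarrow> \<sigma> \<alpha> \<alpha> = - \<alpha>"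
  by (simp add: reflection_def pairing_coroot vec_eq_iff)

lemma reflection_reflection [simp]: "\<alpha> \<in> \<Phi> \<Longrightarrow> \<sigma> \<alpha> (\<sigma> \<alpha> x) = x"
  by (simp add: reflection_def pairing_simps pairing_coroot vec_eq_iff algebra_simps)

lemma reflection_comp_self [simp]: "\<alpha> \<in> \<Phi> \<Longrightarrow> \<sigma> \<alpha> \<circ> \<sigma> \<alpha> = id"
  by (simp add: fun_eq_iff)

lemma coreflection_coreflection: "\<alpha> \<in> \<Phi> \<Longrightarrow> coreflection R \<alpha> (coreflection R \<alpha> \<kappa>) = \<kappa>"
  by (simp add: coreflection_def pairing_simps pairing_coroot vec_eq_iff algebra_simps)

lemma root_uminus: "\<alpha> \<in> \<Phi> \<Longrightarrow> - \<alpha> \<in> \<Phi>"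
  using reflection_root[of \<alpha> \<alpha>] by (simp add: reflection_self)

text \<open>
  The two maps \<open>s\<^sub>\<alpha> s\<^sub>\<beta> s\<^sub>\<alpha>\<close> and \<open>s\<^sub>\<gamma>\<close>, \<open>\<gamma> = s\<^sub>\<alpha>(\<beta>)\<close>, differ by a unipotent map preserving the finite set of
  roots; the same holds for \<open>s\<^sub>\<gamma> s\<^sub>\<delta>\<close> if the coroots of \<open>\<gamma>\<close> and \<open>\<delta>\<close> take the same values on the roots.
\<close>

lemma coroot_reflection:
  assumes \<alpha>: "\<alpha> \<in> \<Phi>" and \<beta>: "\<beta> \<in> \<Phi>"
  shows "coroot R (\<sigma> \<alpha> \<beta>) = coreflection R \<alpha> (coroot R \<beta>)"
proof -
  define \<gamma> where "\<gamma> = \<sigma> \<alpha> \<beta>"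
  define \<gamma>' where "\<gamma>' = coreflection R \<alpha> (coroot R \<beta>)"
  have \<gamma>: "\<gamma> \<in> \<Phi>" using assms by (simp add: \<gamma>_def reflection_root)
  obtain \<delta> where \<delta>: "\<delta> \<in> \<Phi>" "coroot R \<delta> = \<gamma>'"
    using coreflection_coroot[OF assms] by (auto simp: \<gamma>'_def)
  have g2: "pairing \<gamma> \<gamma>' = 2"
    using pairing_reflection[of R \<alpha> \<gamma> "coroot R \<beta>"] assms by (simp add: \<gamma>_def \<gamma>'_def pairing_coroot)
  have \<tau>: "\<sigma> \<alpha> (\<sigma> \<beta> (\<sigma> \<alpha> x)) = x - pairing x \<gamma>' *s \<gamma>" for x
  proof -
    have "\<sigma> \<beta> (\<sigma> \<alpha> x) = \<sigma> \<alpha> x - pairing x \<gamma>' *s \<beta>"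
      unfolding reflection_def[of R \<beta>] by (simp add: pairing_reflection \<gamma>'_def)
    then show ?thesis using \<alpha> by (simp add: reflection_diff reflection_smult \<gamma>_def)
  qed
  have eq: "pairing x (coroot R \<gamma>) = pairing x \<gamma>'" if x: "x \<in> \<Phi>" for x
  proof -
    define c where "c = pairing x (coroot R \<gamma>) - pairing x \<gamma>'"
    define u where "u = (\<lambda>y. \<sigma> \<alpha> (\<sigma> \<beta> (\<sigma> \<alpha> (\<sigma> \<gamma> y))))"
    have u: "u y = y + (pairing y (coroot R \<gamma>) - pairing y \<gamma>') *s \<gamma>" for y
      unfolding u_def \<tau> by (simp add: reflection_def pairing_simps g2 vec_eq_iff algebra_simps)
    have "x + int n *s (c *s \<gamma>) \<in> \<Phi>" for n
    proof (induction n)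
      case (Suc n)
      have "u (x + int n *s (c *s \<gamma>)) \<in> \<Phi>"
        unfolding u_def using Suc assms \<gamma> by (intro reflection_root)
      also have "u (x + int n *s (c *s \<gamma>)) = x + int (Suc n) *s (c *s \<gamma>)"
        using \<gamma> by (simp add: u pairing_simps g2 pairing_coroot c_def vec_eq_iff algebra_simps)
      finally show ?case .
    qed (use x in simp)
    then have "c *s \<gamma> = 0" using finite_arith_progression[OF finite_roots] by blast
    then have "c = 0" using root_nonzero[OF \<gamma>] by (simp add: smult_cancel_int)
    then show ?thesis by (simp add: c_def)
  qed
  \<comment> \<open>Since \<delta> is a root, \<open>eq\<close> applies to it and converts its
    pairing with \<gamma>' into one with the coroot of \<gamma>. With these values the product of
    the two reflections translates by 2 (\<gamma> - \<delta>) along the line through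
    \<gamma>.\<close>
  have gd: "pairing \<gamma> (coroot R \<delta>) = 2" "pairing \<delta> (coroot R \<gamma>) = 2"
    using g2 \<delta> eq[OF \<delta>(1)] pairing_coroot[OF \<delta>(1)] by simp_all
  have "\<gamma> + int n *s (2 *s (\<gamma> - \<delta>)) \<in> \<Phi>" for n
  proof (induction n)
    case 0 show ?case using \<gamma> by simp
  next
    case (Suc n)
    let ?x = "\<gamma> + int n *s (2 *s (\<gamma> - \<delta>))"
    have "\<sigma> \<gamma> (\<sigma> \<delta> ?x) = \<gamma> + int (Suc n) *s (2 *s (\<gamma> - \<delta>))"
      using gd pairing_coroot[OF \<gamma>] pairing_coroot[OF \<delta>(1)]
      by (simp add: reflection_def pairing_simps vec_eq_iff algebra_simps)
    moreover have "\<sigma> \<gamma> (\<sigma> \<delta> ?x) \<in> \<Phi>" using Suc \<gamma> \<delta> by (intro reflection_root)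
    ultimately show ?case by simp
  qed
  then have "2 *s (\<gamma> - \<delta>) = 0" using finite_arith_progression[OF finite_roots] by blast
  then have "\<gamma> - \<delta> = 0" unfolding smult_cancel_int by simp
  then have "\<gamma> = \<delta>" by simp
  with \<delta> show ?thesis by (simp add: \<gamma>_def \<gamma>'_def)
qed

lemma reflection_conj:
  assumes "\<alpha> \<in> \<Phi>" "\<beta> \<in> \<Phi>"
  shows "\<sigma> \<alpha> \<circ> \<sigma> \<beta> = \<sigma> (\<sigma> \<alpha> \<beta>) \<circ> \<sigma> \<alpha>"
proof
  fix x
  have "\<sigma> (\<sigma> \<alpha> \<beta>) (\<sigma> \<alpha> x) = \<sigma> \<alpha> x - pairing x (coroot R \<beta>) *s \<sigma> \<alpha> \<beta>"
    unfolding reflection_def[of R "\<sigma> \<alpha> \<beta>"] coroot_reflection[OF assms] pairing_reflection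
    by (simp add: coreflection_coreflection assms)
  also have "\<dots> = \<sigma> \<alpha> (\<sigma> \<beta> x)"
    unfolding reflection_def[of R \<beta>] by (simp add: reflection_diff reflection_smult)
  finally show "(\<sigma> \<alpha> \<circ> \<sigma> \<beta>) x = (\<sigma> (\<sigma> \<alpha> \<beta>) \<circ> \<sigma> \<alpha>) x" by simp
qed

lemma refl_word_root: "set as \<subseteq> \<Phi> \<Longrightarrow> \<beta> \<in> \<Phi> \<Longrightarrow> refl_word R as \<beta> \<in> \<Phi>"
  by (induction as) (simp_all add: reflection_root)

lemma weyl_root: "w \<in> W \<Longrightarrow> \<beta> \<in> \<Phi> \<Longrightarrow> w \<beta> \<in> \<Phi>"
  using simple_root by (auto simp: weyl_word intro!: refl_word_root)

lemma refl_word_conj: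
  "set as \<subseteq> \<Phi> \<Longrightarrow> \<beta> \<in> \<Phi> \<Longrightarrow> refl_word R as \<circ> \<sigma> \<beta> = \<sigma> (refl_word R as \<beta>) \<circ> refl_word R as"
proof (induction as)
  case (Cons a as)
  have "refl_word R (a # as) \<circ> \<sigma> \<beta> = \<sigma> a \<circ> (\<sigma> (refl_word R as \<beta>) \<circ> refl_word R as)"
    using Cons by (simp only: refl_word_Cons comp_assoc list.set insert_subset)
  also have "\<dots> = \<sigma> (\<sigma> a (refl_word R as \<beta>)) \<circ> \<sigma> a \<circ> refl_word R as"
    using Cons.prems reflection_conj[of a "refl_word R as \<beta>"]
    by (simp add: comp_assoc[symmetric] refl_word_root)
  finally show ?case
    by (simp only: comp_assoc refl_word_Cons comp_apply[of "\<sigma> a" "refl_word R as" \<beta>])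
qed simp

lemma weyl_conj: "w \<in> W \<Longrightarrow> \<beta> \<in> \<Phi> \<Longrightarrow> w \<circ> \<sigma> \<beta> = \<sigma> (w \<beta>) \<circ> w"
  using simple_root by (auto simp: weyl_word intro!: refl_word_conj)

lemma refl_word_rev:
  "set as \<subseteq> \<Phi> \<Longrightarrow> refl_word R (rev as) \<circ> refl_word R as = id"
proof (induction as)
  case (Cons a as)
  have "refl_word R (rev (a # as)) \<circ> refl_word R (a # as) =
      refl_word R (rev as) \<circ> (\<sigma> a \<circ> \<sigma> a) \<circ> refl_word R as"
    by (simp add: refl_word_append comp_assoc)
  also have "\<dots> = refl_word R (rev as) \<circ> refl_word R as"
    using Cons.prems by (simp only: reflection_comp_self list.set insert_subset comp_id)
  also have "\<dots> = id" using Cons by (simp only: list.set insert_subset)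
  finally show ?case .
qed simp

lemma refl_word_rev': "set as \<subseteq> \<Phi> \<Longrightarrow> refl_word R as \<circ> refl_word R (rev as) = id"
  using refl_word_rev[of "rev as"] by simp

lemma refl_word_bij: "set as \<subseteq> \<Phi> \<Longrightarrow> bij (refl_word R as)"
  using o_bij refl_word_rev refl_word_rev' by blast

lemma inv_refl_word: "set as \<subseteq> \<Phi> \<Longrightarrow> inv (refl_word R as) = refl_word R (rev as)"
  using inv_unique_comp refl_word_rev refl_word_rev' by blast

lemma parabolic_bij: "J \<subseteq> \<Delta> \<Longrightarrow> w \<in> parabolic R J \<Longrightarrow> bij w"
  using simple_root unfolding parabolic_def by (auto intro!: refl_word_bij)

lemma parabolic_inv: "J \<subseteq> \<Delta> \<Longrightarrow> w \<in> parabolic R J \<Longrightarrow> inv w \<in> parabolic R J"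
  using simple_root unfolding parabolic_def
  by (clarsimp, rename_tac as, rule_tac x = "rev as" in exI) (auto intro!: inv_refl_word)

lemma weyl_bij: "w \<in> W \<Longrightarrow> bij w"
  and weyl_inv: "w \<in> W \<Longrightarrow> inv w \<in> W"
  unfolding weyl_def using parabolic_bij parabolic_inv by auto

lemma weyl_comp: "u \<in> W \<Longrightarrow> v \<in> W \<Longrightarrow> u \<circ> v \<in> W"
  unfolding weyl_def by (rule parabolic_comp)

lemma weyl_id [simp]: "id \<in> W"
  unfolding weyl_def by simp

lemma weyl_simple: "\<alpha> \<in> \<Delta> \<Longrightarrow> \<sigma> \<alpha> \<in> W"
  unfolding weyl_def by (rule parabolic_reflection)

lemma parabolic_weyl: "J \<subseteq> \<Delta> \<Longrightarrow> w \<in> parabolic R J \<Longrightarrow> w \<in> W"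
  unfolding weyl_def using parabolic_mono by blast

lemma weyl_inv_apply: "w \<in> W \<Longrightarrow> inv w (w x) = x" "w \<in> W \<Longrightarrow> w (inv w x) = x"
  using weyl_bij by (auto simp: bij_is_inj bij_is_surj surj_f_inv_f)

lemma weyl_comp_inv [simp]: "w \<in> W \<Longrightarrow> inv w \<circ> w = id" "w \<in> W \<Longrightarrow> w \<circ> inv w = id"
  by (auto simp: fun_eq_iff weyl_inv_apply)

lemma comp_reflection_reflection [simp]: "\<alpha> \<in> \<Phi> \<Longrightarrow> w \<circ> \<sigma> \<alpha> \<circ> \<sigma> \<alpha> = w"
  by (simp add: comp_assoc)

lemma reflection_reflection_comp [simp]: "\<alpha> \<in> \<Phi> \<Longrightarrow> \<sigma> \<alpha> \<circ> (\<sigma> \<alpha> \<circ> w) = w"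
  by (simp add: comp_assoc[symmetric])

lemma weyl_comp_simple [simp]: "\<alpha> \<in> \<Delta> \<Longrightarrow> w \<circ> \<sigma> \<alpha> \<in> W \<longleftrightarrow> w \<in> W"
  by (metis comp_reflection_reflection simple_root weyl_comp weyl_simple)

lemma simple_comp_weyl [simp]: "\<alpha> \<in> \<Delta> \<Longrightarrow> \<sigma> \<alpha> \<circ> w \<in> W \<longleftrightarrow> w \<in> W"
  by (metis reflection_reflection_comp simple_root weyl_comp weyl_simple)

section \<open>Positive roots and simple reflections\<close>

definition pos :: "int ^ 'n \<Rightarrow> bool" where
  "pos \<beta> \<longleftrightarrow> \<beta> \<in> \<Phi> \<and> (\<exists>c. (\<forall>\<alpha>\<in>\<Delta>. c \<alpha> \<ge> 0) \<and> \<beta> = (\<Sum>\<alpha>\<in>\<Delta>. c \<alpha> *s \<alpha>))"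

lemma pos_root: "pos \<beta> \<Longrightarrow> \<beta> \<in> \<Phi>"
  by (simp add: pos_def)

lemma simples_independent: "(\<Sum>\<alpha>\<in>\<Delta>. c \<alpha> *s \<alpha>) = 0 \<Longrightarrow> \<alpha> \<in> \<Delta> \<Longrightarrow> c \<alpha> = 0"
  using base by (auto simp: is_base_def)

lemma simples_coeff_unique:
  assumes "(\<Sum>\<alpha>\<in>\<Delta>. c \<alpha> *s \<alpha>) = (\<Sum>\<alpha>\<in>\<Delta>. d \<alpha> *s \<alpha>)" "\<alpha> \<in> \<Delta>"
  shows "c \<alpha> = d \<alpha>"
proof -
  have "(\<Sum>\<alpha>\<in>\<Delta>. (c \<alpha> - d \<alpha>) *s \<alpha>) = (\<Sum>\<alpha>\<in>\<Delta>. c \<alpha> *s \<alpha>) - (\<Sum>\<alpha>\<in>\<Delta>. d \<alpha> *s \<alpha>)"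
    unfolding sum_subtractf[symmetric] by (rule sum.cong) (auto simp: vec_eq_iff algebra_simps)
  then show ?thesis using simples_independent[of "\<lambda>\<alpha>. c \<alpha> - d \<alpha>"] assms by simp
qed

lemma root_coeffs:
  assumes "\<beta> \<in> \<Phi>"
  obtains c where "\<beta> = (\<Sum>\<alpha>\<in>\<Delta>. c \<alpha> *s \<alpha>)" "(\<forall>\<alpha>\<in>\<Delta>. c \<alpha> \<ge> 0) \<or> (\<forall>\<alpha>\<in>\<Delta>. c \<alpha> \<le> 0)"
  using assms base unfolding is_base_def by blast

lemma pos_simple: "\<alpha> \<in> \<Delta> \<Longrightarrow> pos \<alpha>"
  unfolding pos_def
  by (auto simp: simple_root if_distrib[of "\<lambda>c. c *s _"] intro!: exI[of _ "\<lambda>x. if x = \<alpha> then 1 else 0"] cong: if_cong)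

lemma pos_uminus:
  assumes "\<beta> \<in> \<Phi>"
  shows "pos (- \<beta>) \<longleftrightarrow> \<not> pos \<beta>"
proof
  assume p: "pos (- \<beta>)"
  show "\<not> pos \<beta>"
  proof
    assume "pos \<beta>"
    with p obtain c d where c: "\<forall>\<alpha>\<in>\<Delta>. c \<alpha> \<ge> 0" "\<beta> = (\<Sum>\<alpha>\<in>\<Delta>. c \<alpha> *s \<alpha>)"
      and d: "\<forall>\<alpha>\<in>\<Delta>. d \<alpha> \<ge> 0" "- \<beta> = (\<Sum>\<alpha>\<in>\<Delta>. d \<alpha> *s \<alpha>)"
      unfolding pos_def by blast
    have "(\<Sum>\<alpha>\<in>\<Delta>. (c \<alpha> + d \<alpha>) *s \<alpha>) = (\<Sum>\<alpha>\<in>\<Delta>. c \<alpha> *s \<alpha>) + (\<Sum>\<alpha>\<in>\<Delta>. d \<alpha> *s \<alpha>)"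
      by (simp only: vector_sadd_rdistrib sum.distrib)
    also have "\<dots> = \<beta> + - \<beta>" by (simp only: c(2)[symmetric] d(2)[symmetric])
    finally have "c \<alpha> + d \<alpha> = 0" if "\<alpha> \<in> \<Delta>" for \<alpha>
      using simples_independent[of "\<lambda>\<alpha>. c \<alpha> + d \<alpha>"] that by simp
    then have "c \<alpha> = 0" if "\<alpha> \<in> \<Delta>" for \<alpha>
      using c(1) d(1) that by (metis add_nonneg_eq_0_iff)
    then have "\<beta> = 0" unfolding c(2) by simp
    with assms root_nonzero show False by blast
  qed
next
  assume n: "\<not> pos \<beta>"
  obtain c where c: "\<beta> = (\<Sum>\<alpha>\<in>\<Delta>. c \<alpha> *s \<alpha>)" "(\<forall>\<alpha>\<in>\<Delta>. c \<alpha> \<ge> 0) \<or> (\<forall>\<alpha>\<in>\<Delta>. c \<alpha> \<le> 0)"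
    using root_coeffs[OF assms] .
  with n assms have c0: "\<forall>\<alpha>\<in>\<Delta>. c \<alpha> \<le> 0" unfolding pos_def by blast
  have "- \<beta> = (\<Sum>\<alpha>\<in>\<Delta>. (- c \<alpha>) *s \<alpha>)"
    unfolding c(1) by (simp add: vec_eq_iff sum_negf)
  with c0 root_uminus[OF assms] show "pos (- \<beta>)"
    unfolding pos_def by (intro conjI exI[of _ "\<lambda>\<alpha>. - c \<alpha>"]) auto
qed

text \<open>Pairing with its coroot forces c to divide 2, and reducedness excludes c = 2.\<close>

lemma root_multiple_of_simple:
  assumes \<alpha>: "\<alpha> \<in> \<Delta>" and "c *s \<alpha> \<in> \<Phi>" "c \<ge> 0"
  shows "c = 1"
proof -
  have "c * pairing \<alpha> (coroot R (c *s \<alpha>)) = 2"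
    using pairing_coroot[OF assms(2)] by (simp add: pairing_simps)
  then have "c dvd 2" by (metis dvd_triv_left)
  then have "c \<le> 2" using zdvd_imp_le by simp
  moreover have "c \<noteq> 2" using reduced assms \<alpha> simple_root by (auto simp: is_reduced_def)
  moreover have "c \<noteq> 0" using assms root_nonzero by force
  ultimately show ?thesis using assms(3) by linarith
qed

text \<open>The reflection changes only the coefficient at \<alpha>. As \<beta> is not a multiple of
  \<alpha>, another coefficient is positive and survives, and one positive coefficient decides the
  sign of a root.\<close>

lemma pos_reflection:
  assumes \<alpha>: "\<alpha> \<in> \<Delta>" and \<beta>: "pos \<beta>" and ne: "\<beta> \<noteq> \<alpha>"
  shows "pos (\<sigma> \<alpha> \<beta>)"
proof -
  obtain c where c: "\<forall>\<alpha>\<in>\<Delta>. c \<alpha> \<ge> 0" "\<beta> = (\<Sum>\<alpha>\<in>\<Delta>. c \<alpha> *s \<alpha>)" "\<beta> \<in> \<Phi>"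
    using \<beta> unfolding pos_def by blast
  have "\<exists>\<gamma>\<in>\<Delta> - {\<alpha>}. c \<gamma> \<noteq> 0"
  proof (rule ccontr)
    assume "\<not> ?thesis"
    then have "\<beta> = c \<alpha> *s \<alpha>"
      unfolding c(2) using \<alpha> by (subst sum.remove[of _ \<alpha>]) auto
    with root_multiple_of_simple[OF \<alpha>, of "c \<alpha>"] c ne \<alpha> show False by simp
  qed
  then obtain \<gamma> where \<gamma>: "\<gamma> \<in> \<Delta>" "\<gamma> \<noteq> \<alpha>" "c \<gamma> > 0" using c(1) by force
  define c' where "c' = (\<lambda>x. c x - (if x = \<alpha> then pairing \<beta> (coroot R \<alpha>) else 0))"
  have "(\<Sum>x\<in>\<Delta>. c' x *s x) =
      (\<Sum>x\<in>\<Delta>. c x *s x - (if x = \<alpha> then pairing \<beta> (coroot R \<alpha>) *s \<alpha> else 0))"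
    unfolding c'_def by (rule sum.cong) (auto simp: vec_eq_iff algebra_simps)
  also have "\<dots> = \<sigma> \<alpha> \<beta>"
    using \<alpha> by (simp add: sum_subtractf reflection_def c(2)[symmetric])
  finally have c': "(\<Sum>x\<in>\<Delta>. c' x *s x) = \<sigma> \<alpha> \<beta>" .
  have r: "\<sigma> \<alpha> \<beta> \<in> \<Phi>" using \<alpha> c(3) simple_root reflection_root by blast
  obtain d where d: "\<sigma> \<alpha> \<beta> = (\<Sum>x\<in>\<Delta>. d x *s x)" "(\<forall>x\<in>\<Delta>. d x \<ge> 0) \<or> (\<forall>x\<in>\<Delta>. d x \<le> 0)"
    using root_coeffs[OF r] .
  have "d \<gamma> = c' \<gamma>" using simples_coeff_unique[of d c' \<gamma>] c' d \<gamma> by simp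
  also have "\<dots> > 0" using \<gamma> by (simp add: c'_def)
  finally have "\<forall>x\<in>\<Delta>. d x \<ge> 0" using d(2) \<gamma>(1) by force
  with d(1) r show ?thesis unfolding pos_def by blast
qed

lemma pos_reflection_iff:
  assumes "\<alpha> \<in> \<Delta>" "\<beta> \<in> \<Phi>" "\<beta> \<noteq> \<alpha>" "\<beta> \<noteq> - \<alpha>"
  shows "pos (\<sigma> \<alpha> \<beta>) \<longleftrightarrow> pos \<beta>"
proof -
  have "\<sigma> \<alpha> \<beta> \<noteq> \<alpha>"
    using assms simple_root by (metis reflection_reflection reflection_self)
  with assms show ?thesis
    by (metis pos_reflection reflection_reflection simple_root)
qed

text \<open>The strong exchange condition. Letting the word act on \<beta> from its right end, the
  image turns negative at some letter a. A simple reflection makes only its own root negative, so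
  the image just before is a itself, and conjugation turns the reflection in \<beta> into a second
  factor \<open>\<sigma> a\<close> that cancels the letter.\<close>

lemma exchange:
  assumes "set as \<subseteq> \<Delta>" "pos \<beta>" "\<not> pos (refl_word R as \<beta>)"
  obtains us a vs where "as = us @ a # vs" "refl_word R vs \<beta> = a"
    "refl_word R as \<circ> \<sigma> \<beta> = refl_word R (us @ vs)"
proof -
  have "\<exists>us a vs. as = us @ a # vs \<and> refl_word R vs \<beta> = a"
    using assms
  proof (induction as)
    case (Cons a as)
    show ?case
    proof (cases "pos (refl_word R as \<beta>)")
      case True
      then have "refl_word R as \<beta> = a"
        using Cons.prems pos_reflection[of a "refl_word R as \<beta>"] by auto
      then show ?thesis by (intro exI[of _ "[]"] exI[of _ a] exI[of _ as]) simp
    next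
      case False
      then obtain us b vs where "as = us @ b # vs \<and> refl_word R vs \<beta> = b"
        using Cons by auto
      then show ?thesis by (intro exI[of _ "a # us"] exI[of _ b] exI[of _ vs]) simp
    qed
  qed simp
  then obtain us a vs where *: "as = us @ a # vs" "refl_word R vs \<beta> = a" by blast
  have a: "a \<in> \<Phi>" "set vs \<subseteq> \<Phi>" using * assms(1) simple_root by auto
  have "refl_word R as \<circ> \<sigma> \<beta> = refl_word R us \<circ> \<sigma> a \<circ> (refl_word R vs \<circ> \<sigma> \<beta>)"
    by (simp add: * refl_word_append comp_assoc)
  also have "\<dots> = refl_word R us \<circ> (\<sigma> a \<circ> \<sigma> a) \<circ> refl_word R vs"
    using refl_word_conj[OF a(2) pos_root[OF assms(2)]] *(2) by (simp only: comp_assoc)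
  also have "\<dots> = refl_word R (us @ vs)" using a by (simp add: refl_word_append)
  finally show ?thesis using that * by blast
qed

section \<open>The length function\<close>

lemma len_word_le: "set as \<subseteq> \<Delta> \<Longrightarrow> \<l> (refl_word R as) \<le> length as"
  unfolding len_def by (rule Least_le) blast

lemma reduced_expression:
  assumes "w \<in> W"
  obtains as where "set as \<subseteq> \<Delta>" "refl_word R as = w" "length as = \<l> w"
proof -
  have "\<exists>k as. set as \<subseteq> \<Delta> \<and> length as = k \<and> refl_word R as = w"
    using assms by (auto simp: weyl_word)
  from LeastI_ex[OF this] show ?thesis using that unfolding len_def by blast
qed

lemma len_id [simp]: "\<l> id = 0"
  using len_word_le[of "[]"] by simp

text \<open>The group is generated by simple reflections, so for a general root \<beta> the
  membership is a genuine claim at this stage; the shortened word from \<open>exchange\<close>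
  proves it along with the inequality.\<close>

lemma len_comp_reflection_less:
  assumes w: "w \<in> W" and "pos \<beta>" "\<not> pos (w \<beta>)"
  shows "\<l> (w \<circ> \<sigma> \<beta>) < \<l> w" "w \<circ> \<sigma> \<beta> \<in> W"
proof -
  obtain as where as: "set as \<subseteq> \<Delta>" "refl_word R as = w" "length as = \<l> w"
    using reduced_expression[OF w] .
  obtain us a vs where *: "as = us @ a # vs" "refl_word R as \<circ> \<sigma> \<beta> = refl_word R (us @ vs)"
    using exchange[OF as(1) assms(2)] assms(3) as(2) by metis
  have "\<l> (w \<circ> \<sigma> \<beta>) \<le> length (us @ vs)"
    using len_word_le[of "us @ vs"] * as by auto
  then show "\<l> (w \<circ> \<sigma> \<beta>) < \<l> w" using * as by auto
  have "set (us @ vs) \<subseteq> \<Delta>" using * as by auto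
  with * as show "w \<circ> \<sigma> \<beta> \<in> W" unfolding weyl_word by metis
qed

lemma reflection_uminus:
  assumes "\<beta> \<in> \<Phi>"
  shows "\<sigma> \<beta> = \<sigma> (- \<beta>)"
proof -
  have "coroot R (- \<beta>) = - coroot R \<beta>"
    using coroot_reflection[OF assms assms] assms
    by (simp add: reflection_self coreflection_def pairing_coroot vec_eq_iff)
  then have "\<sigma> \<beta> x = \<sigma> (- \<beta>) x" for x
    unfolding reflection_def by (simp only: pairing_simps vector_smult_rneg vector_smult_lneg minus_minus)
  then show ?thesis by (rule ext)
qed


lemma pos_weyl_uminus: "w \<in> W \<Longrightarrow> \<beta> \<in> \<Phi> \<Longrightarrow> pos (w (- \<beta>)) \<longleftrightarrow> \<not> pos (w \<beta>)"
  by (simp add: weyl_uminus pos_uminus weyl_root)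

lemma len_comp_reflection_less_iff:
  assumes w: "w \<in> W" "w \<circ> \<sigma> \<beta> \<in> W" and \<beta>: "pos \<beta>"
  shows "\<l> (w \<circ> \<sigma> \<beta>) < \<l> w \<longleftrightarrow> \<not> pos (w \<beta>)" "\<l> w < \<l> (w \<circ> \<sigma> \<beta>) \<longleftrightarrow> pos (w \<beta>)"
proof -
  have r: "\<beta> \<in> \<Phi>" using \<beta> by (rule pos_root)
  have gt: "\<l> w < \<l> (w \<circ> \<sigma> \<beta>)" if "pos (w \<beta>)"
    using len_comp_reflection_less(1)[OF w(2) \<beta>] that r
    by (simp add: reflection_self pos_weyl_uminus w)
  show "\<l> (w \<circ> \<sigma> \<beta>) < \<l> w \<longleftrightarrow> \<not> pos (w \<beta>)" "\<l> w < \<l> (w \<circ> \<sigma> \<beta>) \<longleftrightarrow> pos (w \<beta>)"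
    using gt len_comp_reflection_less(1)[OF w(1) \<beta>] by (metis less_asym)+
qed

lemma len_simple_less_iff:
  assumes "w \<in> W" "\<alpha> \<in> \<Delta>"
  shows "\<l> (w \<circ> \<sigma> \<alpha>) < \<l> w \<longleftrightarrow> \<not> pos (w \<alpha>)" "\<l> w < \<l> (w \<circ> \<sigma> \<alpha>) \<longleftrightarrow> pos (w \<alpha>)"
  using len_comp_reflection_less_iff[of w \<alpha>] assms by (simp_all add: pos_simple)

lemma len_comp_simple_le: "w \<in> W \<Longrightarrow> \<alpha> \<in> \<Delta> \<Longrightarrow> \<l> (w \<circ> \<sigma> \<alpha>) \<le> Suc (\<l> w)"
proof -
  assume w: "w \<in> W" and a: "\<alpha> \<in> \<Delta>"
  obtain as where as: "set as \<subseteq> \<Delta>" "refl_word R as = w" "length as = \<l> w"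
    using reduced_expression[OF w] .
  then have "refl_word R (as @ [\<alpha>]) = w \<circ> \<sigma> \<alpha>" by (simp add: refl_word_append)
  with len_word_le[of "as @ [\<alpha>]"] as a show ?thesis by simp
qed

lemma len_comp_simple:
  assumes w: "w \<in> W" "\<alpha> \<in> \<Delta>"
  shows "\<l> (w \<circ> \<sigma> \<alpha>) = (if pos (w \<alpha>) then \<l> w + 1 else \<l> w - 1)" "pos (w \<alpha>) \<or> \<l> w > 0"
proof -
  have "\<l> (w \<circ> \<sigma> \<alpha>) \<le> Suc (\<l> w)" using len_comp_simple_le w by blast
  moreover have "\<l> w \<le> Suc (\<l> (w \<circ> \<sigma> \<alpha>))"
    using len_comp_simple_le[of "w \<circ> \<sigma> \<alpha>" \<alpha>] w simple_root by simp
  ultimately show "\<l> (w \<circ> \<sigma> \<alpha>) = (if pos (w \<alpha>) then \<l> w + 1 else \<l> w - 1)" "pos (w \<alpha>) \<or> \<l> w > 0"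
    using len_simple_less_iff[OF w] by (simp_all split: if_splits) linarith+
qed

lemma right_descent_exists:
  assumes "w \<in> W" "w \<noteq> id"
  obtains \<alpha> where "\<alpha> \<in> \<Delta>" "\<l> (w \<circ> \<sigma> \<alpha>) < \<l> w" "\<not> pos (w \<alpha>)"
proof -
  obtain as where as: "set as \<subseteq> \<Delta>" "refl_word R as = w" "length as = \<l> w"
    using reduced_expression[OF assms(1)] .
  with assms(2) obtain bs a where bs: "as = bs @ [a]" by (cases as rule: rev_cases) auto
  then have w: "w = refl_word R bs \<circ> \<sigma> a" using as by (simp add: refl_word_append)
  then have "w \<circ> \<sigma> a = refl_word R bs" using bs as simple_root by simp
  then have "\<l> (w \<circ> \<sigma> a) < \<l> w" using len_word_le[of bs] as bs by simp
  then show ?thesis using that[of a] bs as len_simple_less_iff[OF assms(1), of a] by simp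
qed

lemma weyl_eq_id:
  assumes "w \<in> W" "\<And>\<alpha>. \<alpha> \<in> \<Delta> \<Longrightarrow> pos (w \<alpha>)"
  shows "w = id"
  using right_descent_exists assms by blast

text \<open>W acts faithfully on the finite set of roots: if u and v agree there,
  \<open>inv u \<circ> v\<close> fixes every simple root, so it has no descent.\<close>

lemma finite_weyl [simp]: "finite W"
proof -
  have "inj_on (\<lambda>w. restrict w \<Phi>) W"
  proof (rule inj_onI)
    fix u v assume u: "u \<in> W" "v \<in> W" and eq: "restrict u \<Phi> = restrict v \<Phi>"
    have "u \<alpha> = v \<alpha>" if "\<alpha> \<in> \<Delta>" for \<alpha>
      using fun_cong[OF eq, of \<alpha>] simple_root[OF that] by simp
    then have "pos ((inv u \<circ> v) \<alpha>)" if "\<alpha> \<in> \<Delta>" for \<alpha>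
      using that u by (metis comp_apply pos_simple weyl_inv_apply(1))
    then have "inv u \<circ> v = id" using u by (intro weyl_eq_id weyl_comp weyl_inv)
    then have "u \<circ> (inv u \<circ> v) = u" by simp
    then show "u = v" using u by (simp add: comp_assoc[symmetric])
  qed
  moreover have "(\<lambda>w. restrict w \<Phi>) ` W \<subseteq> \<Phi> \<rightarrow>\<^sub>E \<Phi>"
    using weyl_root by auto
  ultimately show ?thesis
    by (meson finite_PiE finite_imageD finite_roots finite_subset)
qed

lemma pos_inverts_simples:
  assumes w: "w \<in> W" and neg: "\<And>\<alpha>. \<alpha> \<in> \<Delta> \<Longrightarrow> \<not> pos (w \<alpha>)" and \<beta>: "\<beta> \<in> \<Phi>"
  shows "pos (w \<beta>) \<longleftrightarrow> \<not> pos \<beta>"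
proof -
  have *: "\<not> pos (w \<beta>)" if "pos \<beta>" for \<beta>
  proof -
    obtain c where c: "\<forall>\<alpha>\<in>\<Delta>. c \<alpha> \<ge> 0" "\<beta> = (\<Sum>\<alpha>\<in>\<Delta>. c \<alpha> *s \<alpha>)"
      using \<open>pos \<beta>\<close> unfolding pos_def by blast
    have "\<forall>\<alpha>\<in>\<Delta>. \<exists>d. (\<forall>\<gamma>\<in>\<Delta>. d \<gamma> \<ge> 0) \<and> - w \<alpha> = (\<Sum>\<gamma>\<in>\<Delta>. d \<gamma> *s \<gamma>)"
      using neg pos_uminus[OF weyl_root[OF w simple_root]] unfolding pos_def by blast
    then obtain d where d: "\<And>\<alpha> \<gamma>. \<alpha> \<in> \<Delta> \<Longrightarrow> \<gamma> \<in> \<Delta> \<Longrightarrow> d \<alpha> \<gamma> \<ge> 0"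
      "\<And>\<alpha>. \<alpha> \<in> \<Delta> \<Longrightarrow> - w \<alpha> = (\<Sum>\<gamma>\<in>\<Delta>. d \<alpha> \<gamma> *s \<gamma>)" by (metis (no_types))
    have "- w \<beta> = (\<Sum>\<alpha>\<in>\<Delta>. c \<alpha> *s (- w \<alpha>))"
      unfolding c(2) by (simp add: weyl_sum[OF w] weyl_smult[OF w] vector_smult_rneg sum_negf)
    also have "\<dots> = (\<Sum>\<alpha>\<in>\<Delta>. \<Sum>\<gamma>\<in>\<Delta>. (c \<alpha> * d \<alpha> \<gamma>) *s \<gamma>)"
      by (intro sum.cong refl) (simp add: d(2) vec_eq_iff sum_distrib_left mult.assoc)
    also have "\<dots> = (\<Sum>\<gamma>\<in>\<Delta>. (\<Sum>\<alpha>\<in>\<Delta>. c \<alpha> * d \<alpha> \<gamma>) *s \<gamma>)"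
      by (subst sum.swap) (simp add: vec_eq_iff sum_distrib_right)
    finally have "- w \<beta> = (\<Sum>\<gamma>\<in>\<Delta>. (\<Sum>\<alpha>\<in>\<Delta>. c \<alpha> * d \<alpha> \<gamma>) *s \<gamma>)" .
    moreover have "\<forall>\<gamma>\<in>\<Delta>. (\<Sum>\<alpha>\<in>\<Delta>. c \<alpha> * d \<alpha> \<gamma>) \<ge> 0" using c d by (auto intro!: sum_nonneg)
    moreover have r: "w \<beta> \<in> \<Phi>" using that w pos_root weyl_root by blast
    ultimately have "pos (- w \<beta>)"
      unfolding pos_def using root_uminus[OF r]
      by (intro conjI exI[of _ "\<lambda>\<gamma>. \<Sum>\<alpha>\<in>\<Delta>. c \<alpha> * d \<alpha> \<gamma>"])
    with r show ?thesis by (simp add: pos_uminus)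
  qed
  show ?thesis
    using *[of \<beta>] *[of "- \<beta>"] \<beta> w by (auto simp: pos_uminus pos_weyl_uminus)
qed

text \<open>An element of maximal length makes every simple root negative. For two such elements w
  and w', \<open>inv w \<circ> w'\<close> keeps the simple roots positive and is therefore the
  identity; this justifies the THE in \<open>longest\<close>.\<close>

lemma longest_props: "longest R \<in> W" "\<beta> \<in> \<Phi> \<Longrightarrow> pos (longest R \<beta>) \<longleftrightarrow> \<not> pos \<beta>"
proof -
  let ?P = "\<lambda>w. w \<in> W \<and> (\<forall>x\<in>W. \<l> x \<le> \<l> w)"
  have neg: "\<not> pos (w \<alpha>)" if "?P w" "\<alpha> \<in> \<Delta>" for w \<alpha>
    using that len_simple_less_iff(2)[of w \<alpha>] by (metis leD weyl_comp_simple)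
  have "\<exists>w. ?P w"
  proof -
    have "Max (\<l> ` W) \<in> \<l> ` W" using weyl_id finite_weyl by (intro Max_in finite_imageI) blast+
    then obtain w where "w \<in> W" "\<l> w = Max (\<l> ` W)" by force
    then show ?thesis by (intro exI[of _ w]) simp
  qed
  moreover have "w = w'" if w: "?P w" and w': "?P w'" for w w'
  proof -
    have "pos ((inv w \<circ> w') \<alpha>)" if a: "\<alpha> \<in> \<Delta>" for \<alpha>
    proof -
      have r: "inv w (w' \<alpha>) \<in> \<Phi>" using w w' a by (simp add: weyl_inv weyl_root simple_root)
      have "\<not> pos (w (inv w (w' \<alpha>)))" using neg[OF w' a] w by (simp add: weyl_inv_apply)
      then show ?thesis using pos_inverts_simples[of w, OF _ neg[OF w] r] w by simp
    qed
    then have "inv w \<circ> w' = id" using w w' by (intro weyl_eq_id weyl_comp weyl_inv) auto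
    then have "w \<circ> (inv w \<circ> w') = w" by simp
    then show ?thesis using w by (simp add: comp_assoc[symmetric])
  qed
  ultimately have "\<exists>!w. ?P w" by blast
  from theI'[OF this] have "?P (longest R)" unfolding longest_def .
  then show "longest R \<in> W" "\<beta> \<in> \<Phi> \<Longrightarrow> pos (longest R \<beta>) \<longleftrightarrow> \<not> pos \<beta>"
    using pos_inverts_simples[of "longest R", OF _ neg[of "longest R"]] by blast+
qed

text \<open>A word for the longest element makes every positive root negative, so
  \<open>exchange\<close> finds a suffix of it that carries the root to a simple one.\<close>

lemma pos_conj_simple:
  assumes "\<beta> \<in> \<Phi>"
  obtains w \<alpha> where "w \<in> W" "\<alpha> \<in> \<Delta>" "w \<alpha> = \<beta>"
proof -
  have *: "\<exists>w \<alpha>. w \<in> W \<and> \<alpha> \<in> \<Delta> \<and> w \<alpha> = \<beta>" if "pos \<beta>" for \<beta>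
  proof -
    obtain as where as: "set as \<subseteq> \<Delta>" "refl_word R as = longest R"
      using longest_props(1) by (auto simp: weyl_word)
    have "\<not> pos (refl_word R as \<beta>)" using longest_props(2)[OF pos_root[OF that]] as that by simp
    then obtain us a vs where *: "as = us @ a # vs" "refl_word R vs \<beta> = a"
      using exchange[OF as(1) \<open>pos \<beta>\<close>] by metis
    have v: "refl_word R vs \<in> W" using * as by (auto simp: weyl_word)
    then have "inv (refl_word R vs) a = \<beta>" using * weyl_inv_apply(1) by blast
    with v show ?thesis using * as by (intro exI[of _ "inv (refl_word R vs)"] exI[of _ a]) (auto intro: weyl_inv)
  qed
  show ?thesis
  proof (cases "pos \<beta>")
    case True then show ?thesis using * that by blast
  next
    case False
    then obtain w \<alpha> where w: "w \<in> W" "\<alpha> \<in> \<Delta>" "w \<alpha> = - \<beta>" using * assms pos_uminus by blast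
    then have "(w \<circ> \<sigma> \<alpha>) \<alpha> = \<beta>" by (simp add: reflection_self simple_root weyl_uminus)
    with w show ?thesis using that by (metis weyl_comp_simple)
  qed
qed

lemma reflection_weyl:
  assumes "\<beta> \<in> \<Phi>"
  shows "\<sigma> \<beta> \<in> W"
proof -
  obtain w \<alpha> where w: "w \<in> W" "\<alpha> \<in> \<Delta>" "w \<alpha> = \<beta>" using pos_conj_simple[OF assms] .
  then have "w \<circ> \<sigma> \<alpha> \<circ> inv w = \<sigma> \<beta> \<circ> (w \<circ> inv w)"
    using weyl_conj[of w \<alpha>] simple_root by (simp add: comp_assoc)
  then have "\<sigma> \<beta> = w \<circ> \<sigma> \<alpha> \<circ> inv w" using w by simp
  then show ?thesis using w by (metis weyl_comp weyl_inv weyl_simple)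
qed

lemma len_inv: 
  assumes "w \<in> W"
  shows "\<l> (inv w) = \<l> w"
proof -
  have le: "\<l> (inv w) \<le> \<l> w" if "w \<in> W" for w
  proof -
    obtain as where as: "set as \<subseteq> \<Delta>" "refl_word R as = w" "length as = \<l> w"
      using reduced_expression[OF \<open>w \<in> W\<close>] .
    then have "inv w = refl_word R (rev as)" using inv_refl_word simple_root by blast
    with len_word_le[of "rev as"] as show ?thesis by simp
  qed
  have "inv (inv w) = w" using assms weyl_bij inv_inv_eq by blast
  with le[OF assms] le[OF weyl_inv[OF assms]] show ?thesis by simp
qed

lemma inv_simple_comp: "w \<in> W \<Longrightarrow> \<alpha> \<in> \<Delta> \<Longrightarrow> inv (\<sigma> \<alpha> \<circ> w) = inv w \<circ> \<sigma> \<alpha>"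
  using simple_root by (intro inv_unique_comp) (simp_all add: fun_eq_iff weyl_inv_apply)

lemma len_simple_comp:
  assumes "w \<in> W" "\<alpha> \<in> \<Delta>"
  shows "\<l> (\<sigma> \<alpha> \<circ> w) = (if pos (inv w \<alpha>) then \<l> w + 1 else \<l> w - 1)" "pos (inv w \<alpha>) \<or> \<l> w > 0"
proof -
  have "\<l> (\<sigma> \<alpha> \<circ> w) = \<l> (inv w \<circ> \<sigma> \<alpha>)"
    using len_inv[of "\<sigma> \<alpha> \<circ> w"] assms by (metis inv_simple_comp simple_comp_weyl)
  with len_comp_simple[OF weyl_inv[OF assms(1)] assms(2)] len_inv[OF assms(1)]
  show "\<l> (\<sigma> \<alpha> \<circ> w) = (if pos (inv w \<alpha>) then \<l> w + 1 else \<l> w - 1)" "pos (inv w \<alpha>) \<or> \<l> w > 0"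
    by (simp_all split: if_splits)
qed

lemma len_simple_comp_less_iff:
  assumes "w \<in> W" "\<alpha> \<in> \<Delta>"
  shows "\<l> (\<sigma> \<alpha> \<circ> w) < \<l> w \<longleftrightarrow> \<not> pos (inv w \<alpha>)" "\<l> w < \<l> (\<sigma> \<alpha> \<circ> w) \<longleftrightarrow> pos (inv w \<alpha>)"
  using len_simple_comp[OF assms] by auto

section \<open>The sign character and descent sets\<close>

lemma sgn_comp_simple: "w \<in> W \<Longrightarrow> \<alpha> \<in> \<Delta> \<Longrightarrow> sgn_W R (w \<circ> \<sigma> \<alpha>) = - sgn_W R w"
  using len_comp_simple[of w \<alpha>] by (cases "\<l> w") (auto simp: sgn_W_def split: if_splits)

lemma sgn_id [simp]: "sgn_W R id = 1"
  by (simp add: sgn_W_def)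

lemma sgn_comp_word:
  "u \<in> W \<Longrightarrow> set as \<subseteq> \<Delta> \<Longrightarrow> sgn_W R (u \<circ> refl_word R as) = sgn_W R u * (- 1) ^ length as"
proof (induction as arbitrary: u)
  case (Cons a as)
  have "sgn_W R (u \<circ> refl_word R (a # as)) = sgn_W R ((u \<circ> \<sigma> a) \<circ> refl_word R as)"
    by (simp add: comp_assoc)
  also have "\<dots> = sgn_W R (u \<circ> \<sigma> a) * (- 1) ^ length as" 
    using Cons.prems by (intro Cons.IH) (simp_all only: weyl_comp_simple list.set insert_subset)
  also have "\<dots> = sgn_W R u * (- 1) ^ length (a # as)" using Cons.prems by (simp add: sgn_comp_simple)
  finally show ?case .
qed simp

lemma sgn_comp: "u \<in> W \<Longrightarrow> v \<in> W \<Longrightarrow> sgn_W R (u \<circ> v) = sgn_W R u * sgn_W R v"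
  by (metis reduced_expression sgn_comp_word sgn_W_def)

lemma sgn_square [simp]: "sgn_W R w * sgn_W R w = 1"
  by (simp add: sgn_W_def flip: power_add)

lemma descents_iff: "w \<in> W \<Longrightarrow> \<alpha> \<in> descents R w \<longleftrightarrow> \<alpha> \<in> \<Delta> \<and> \<not> pos (w \<alpha>)"
  unfolding descents_def using len_simple_less_iff by auto

lemma descents_simples: "descents R w \<subseteq> \<Delta>"
  unfolding descents_def by auto

text \<open>Right descents of w are read off from the signs of the roots w \<alpha>, and left
  multiplication by the longest element reverses all of them.\<close>

lemma descents_longest_comp:
  assumes "w \<in> W"
  shows "descents R (longest R \<circ> w) = \<Delta> - descents R w"
  using assms longest_props
  by (auto simp: descents_iff weyl_comp weyl_root simple_root)

section \<open>The Bruhat order\<close>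

definition bruhat_step :: "'n weyl_elt \<Rightarrow> 'n weyl_elt \<Rightarrow> bool" where
  "bruhat_step u v \<longleftrightarrow> (\<exists>\<beta>\<in>\<Phi>. v = u \<circ> \<sigma> \<beta> \<and> \<l> u < \<l> v)"

lemma bruhat_le_iff: "bruhat_le R x y \<longleftrightarrow> x \<in> W \<and> bruhat_step\<^sup>*\<^sup>* x y"
proof -
  have "(\<lambda>u v. \<exists>\<beta>\<in>\<Phi>. v = u \<circ> \<sigma> \<beta> \<and> \<l> u < \<l> v) = bruhat_step"
    by (simp add: fun_eq_iff bruhat_step_def)
  then show ?thesis by (simp add: bruhat_le_def)
qed

lemma bruhat_step_weyl: "bruhat_step u v \<Longrightarrow> u \<in> W \<Longrightarrow> v \<in> W"
  using reflection_weyl weyl_comp by (auto simp: bruhat_step_def)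

lemma bruhat_refl: "x \<in> W \<Longrightarrow> bruhat_le R x x"
  by (simp add: bruhat_le_iff)

lemma bruhat_trans: "bruhat_le R x y \<Longrightarrow> bruhat_le R y z \<Longrightarrow> bruhat_le R x z"
  by (auto simp: bruhat_le_iff)

lemma bruhat_steps_weyl: "bruhat_step\<^sup>*\<^sup>* x y \<Longrightarrow> x \<in> W \<Longrightarrow> y \<in> W"
  by (induction rule: rtranclp_induct) (auto dest: bruhat_step_weyl)

lemma bruhat_weyl: "bruhat_le R x y \<Longrightarrow> x \<in> W" "bruhat_le R x y \<Longrightarrow> y \<in> W"
  using bruhat_steps_weyl by (auto simp: bruhat_le_iff)

lemma bruhat_len:
  assumes "bruhat_le R x y"
  shows "x = y \<or> \<l> x < \<l> y"
proof -
  have "bruhat_step\<^sup>*\<^sup>* x y" using assms by (simp add: bruhat_le_iff)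
  then show ?thesis
    by (induction rule: rtranclp_induct) (auto simp: bruhat_step_def)
qed

lemma bruhat_simple_up: "w \<in> W \<Longrightarrow> \<alpha> \<in> \<Delta> \<Longrightarrow> \<l> w < \<l> (w \<circ> \<sigma> \<alpha>) \<Longrightarrow> bruhat_le R w (w \<circ> \<sigma> \<alpha>)"
  unfolding bruhat_le_iff by (auto simp: bruhat_step_def intro!: r_into_rtranclp simple_root)

text \<open>The lifting property for a single edge from u to u s_\<beta>. Right multiplication by
  s_\<alpha> conjugates it to an edge for the root s_\<alpha>(\<beta>), which is positive unless
  \<beta> = \<alpha>; the direction is kept because both edges are governed by the sign of
  u(\<beta>).\<close>

lemma bruhat_lift_step:
  assumes u: "u \<in> W" and st: "bruhat_step u v" and \<alpha>: "\<alpha> \<in> \<Delta>"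
  shows "bruhat_le R (u \<circ> \<sigma> \<alpha>) v \<or> bruhat_le R (u \<circ> \<sigma> \<alpha>) (v \<circ> \<sigma> \<alpha>)"
proof -
  obtain \<beta>' where "\<beta>' \<in> \<Phi>" "v = u \<circ> \<sigma> \<beta>'" "\<l> u < \<l> v" using st by (auto simp: bruhat_step_def)
  then obtain \<beta> where \<beta>: "pos \<beta>" "v = u \<circ> \<sigma> \<beta>" "\<l> u < \<l> v"
    by (metis pos_uminus reflection_uminus)
  have rb: "\<beta> \<in> \<Phi>" "\<sigma> \<beta> \<in> W" using \<beta> pos_root reflection_weyl by auto
  have v: "v \<in> W" using u st bruhat_step_weyl by blast
  have ra: "\<alpha> \<in> \<Phi>" using \<alpha> simple_root by blast
  show ?thesis
  proof (cases "\<beta> = \<alpha>")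
    case True
    then have "u \<circ> \<sigma> \<alpha> = v" using \<beta> by simp
    then show ?thesis using bruhat_refl v by metis
  next
    case ne: False
    show ?thesis
    proof (cases "pos (u \<alpha>)")
      case False
      then have "\<l> (u \<circ> \<sigma> \<alpha>) < \<l> u" using len_simple_less_iff u \<alpha> by blast
      then have "bruhat_le R (u \<circ> \<sigma> \<alpha>) u"
        using bruhat_simple_up[of "u \<circ> \<sigma> \<alpha>" \<alpha>] u \<alpha> ra by simp
      moreover have "bruhat_le R u v" using u st by (auto simp: bruhat_le_iff)
      ultimately show ?thesis using bruhat_trans by blast
    next
      case True
      let ?\<gamma> = "\<sigma> \<alpha> \<beta>"
      have g: "pos ?\<gamma>" using pos_reflection[OF \<alpha> \<beta>(1) ne] .
      have "\<sigma> \<alpha> \<circ> \<sigma> ?\<gamma> = \<sigma> \<beta> \<circ> \<sigma> \<alpha>"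
        using reflection_conj[OF ra pos_root[OF g]] ra by simp
      then have vs: "v \<circ> \<sigma> \<alpha> = (u \<circ> \<sigma> \<alpha>) \<circ> \<sigma> ?\<gamma>"
        by (simp add: \<beta>(2) comp_assoc)
      have "pos (u \<beta>)"
        using len_comp_reflection_less_iff(2)[of u \<beta>] u v \<beta> by auto
      then have "pos ((u \<circ> \<sigma> \<alpha>) ?\<gamma>)" using ra by simp
      then have "\<l> (u \<circ> \<sigma> \<alpha>) < \<l> (v \<circ> \<sigma> \<alpha>)"
        using len_comp_reflection_less_iff(2)[of "u \<circ> \<sigma> \<alpha>" ?\<gamma>] u v \<alpha> g vs
        by (metis weyl_comp_simple)
      then have "bruhat_step (u \<circ> \<sigma> \<alpha>) (v \<circ> \<sigma> \<alpha>)"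
        using vs pos_root[OF g] by (auto simp: bruhat_step_def)
      then show ?thesis using u \<alpha> by (auto simp: bruhat_le_iff)
    qed
  qed
qed

lemma bruhat_lift:
  assumes "bruhat_le R u x" and \<alpha>: "\<alpha> \<in> \<Delta>"
  shows "bruhat_le R (u \<circ> \<sigma> \<alpha>) x \<or> bruhat_le R (u \<circ> \<sigma> \<alpha>) (x \<circ> \<sigma> \<alpha>)"
proof -
  have "bruhat_step\<^sup>*\<^sup>* u x" "u \<in> W" using assms by (simp_all add: bruhat_le_iff)
  then show ?thesis
  proof (induction rule: rtranclp_induct)
    case base then show ?case using \<alpha> bruhat_refl weyl_comp_simple by metis
  next
    case (step y z)
    have y: "y \<in> W" using step bruhat_steps_weyl by blast
    have yz: "bruhat_le R y z" using y step by (auto simp: bruhat_le_iff)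
    show ?case using step.IH[OF step.prems] bruhat_lift_step[OF y step.hyps(2) \<alpha>] yz bruhat_trans by blast
  qed
qed

text \<open>Controls supports in the Kazhdan-Lusztig construction: right multiplication by T_s of an
  element supported below x stays below xs when xs > x.\<close>

lemma bruhat_lift_up:
  assumes "bruhat_le R u x" "\<alpha> \<in> \<Delta>" "\<l> x < \<l> (x \<circ> \<sigma> \<alpha>)"
  shows "bruhat_le R (u \<circ> \<sigma> \<alpha>) (x \<circ> \<sigma> \<alpha>)"
  using bruhat_lift[OF assms(1,2)] bruhat_simple_up[OF _ assms(2,3)] bruhat_trans bruhat_weyl(2)[OF assms(1)]
  by blast

end

section \<open>Laurent polynomials\<close>

lemma vpow_zero [simp]: "vpow 0 = 1"
  by (simp add: vpow_def)

lemma vpow_mult: "vpow a * vpow b = vpow (a + b)"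
  by (simp add: vpow_def mult_single)

lemma vpow_mult_assoc: "vpow a * (vpow b * f) = vpow (a + b) * f"
  by (simp add: vpow_mult mult.assoc[symmetric])

lemma lookup_single_mult:
  fixes f :: "('a::group_add) \<Rightarrow>\<^sub>0 ('b::semiring_0)"
  shows "Poly_Mapping.lookup (Poly_Mapping.single k c * f) j = c * Poly_Mapping.lookup f (- k + j)"
proof -
  have eq: "Sum_any (\<lambda>q. Poly_Mapping.lookup f q when j = l + q) = Poly_Mapping.lookup f (- l + j)" for l
  proof -
    have *: "(\<lambda>q. Poly_Mapping.lookup f q when j = l + q) = (\<lambda>q. Poly_Mapping.lookup f q when - l + j = q)"
      by (auto simp: fun_eq_iff when_def)
    show ?thesis unfolding * by simp
  qed
  have "(\<lambda>l. Poly_Mapping.lookup (Poly_Mapping.single k c) l * Poly_Mapping.lookup f (- l + j)) =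
      (\<lambda>l. c * Poly_Mapping.lookup f (- k + j) when k = l)"
    by (auto simp: fun_eq_iff lookup_single when_def)
  then have "Sum_any (\<lambda>l. Poly_Mapping.lookup (Poly_Mapping.single k c) l * Poly_Mapping.lookup f (- l + j)) =
      c * Poly_Mapping.lookup f (- k + j)"
    by (simp only: Sum_any_when_equal')
  then show ?thesis by (simp add: lookup_mult eq)
qed

lemma lookup_vpow_mult: "Poly_Mapping.lookup (vpow k * f) j = Poly_Mapping.lookup f (j - k)"
  by (simp add: vpow_def lookup_single_mult)

lemma lookup_of_int_mult: "Poly_Mapping.lookup (of_int m * (f :: 'a::group_add \<Rightarrow>\<^sub>0 int)) j = m * Poly_Mapping.lookup f j"
proof -
  have "(of_int m :: 'a \<Rightarrow>\<^sub>0 int) = Poly_Mapping.single 0 m" by (metis of_int_eq_id id_apply single_of_int)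
  then show ?thesis by (simp add: lookup_single_mult)
qed

lemma lookup_laurent_bar: "Poly_Mapping.lookup (laurent_bar f) k = Poly_Mapping.lookup f (- k)"
proof -
  have "Poly_Mapping.lookup (laurent_bar f) k =
      (\<Sum>j\<in>Poly_Mapping.keys f. if j = - k then Poly_Mapping.lookup f (- k) else 0)"
    unfolding laurent_bar_def lookup_sum by (intro sum.cong refl) (auto simp: lookup_single when_def)
  then show ?thesis by (auto simp: in_keys_iff)
qed

lemma laurent_bar_zero [simp]: "laurent_bar 0 = 0"
  by (rule poly_mapping_eqI) (simp add: lookup_laurent_bar)

lemma laurent_bar_one [simp]: "laurent_bar 1 = 1"
  by (rule poly_mapping_eqI) (simp add: lookup_laurent_bar lookup_one)

lemma laurent_bar_add: "laurent_bar (f + g) = laurent_bar f + laurent_bar g"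
  by (rule poly_mapping_eqI) (simp add: lookup_laurent_bar lookup_add)

lemma laurent_bar_diff: "laurent_bar (f - g) = laurent_bar f - laurent_bar g"
  by (rule poly_mapping_eqI) (simp add: lookup_laurent_bar lookup_minus)

lemma laurent_bar_vpow_mult: "laurent_bar (vpow k * f) = vpow (- k) * laurent_bar f"
  by (rule poly_mapping_eqI) (simp add: lookup_laurent_bar lookup_vpow_mult add.commute)

lemma laurent_bar_of_int_mult: "laurent_bar (of_int m * f) = of_int m * laurent_bar f"
  by (rule poly_mapping_eqI) (simp add: lookup_laurent_bar lookup_of_int_mult)

lemma laurent_bar_sum: "laurent_bar (\<Sum>i\<in>A. f i) = (\<Sum>i\<in>A. laurent_bar (f i))"
  by (induction A rule: infinite_finite_induct) (simp_all add: laurent_bar_add)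

text \<open>The embedding of \<int>[q] into Laurent polynomials in v by q = v^2, as it occurs in
  \<open>kl_element\<close>.\<close>

definition eval_q :: "int poly \<Rightarrow> laurent" where
  "eval_q p = poly (map_poly of_int p) (vpow 2)"

lemma vpow_power: "vpow a ^ n = vpow (a * int n)"
  by (induction n) (simp_all add: vpow_mult algebra_simps)

lemma lookup_eval_q:
  "Poly_Mapping.lookup (eval_q p) j = (if j \<ge> 0 \<and> even j then coeff p (nat j div 2) else 0)"
proof -
  \<comment> \<open>Large enough both to contain all coefficients of p and to keep the index j/2
    inside the range of summation.\<close>
  define N where "N = degree p + nat j"
  have "degree (map_poly of_int p :: laurent poly) \<le> N"
    by (intro degree_le) (auto simp: N_def coeff_map_poly coeff_eq_0)
  then have "eval_q p = (\<Sum>i\<le>N. of_int (coeff p i) * vpow (2 * int i))"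
    unfolding eval_q_def poly_as_sum_of_monoms'[symmetric]
    by (subst poly_as_sum_of_monoms'[symmetric], assumption)
      (simp add: poly_sum poly_monom coeff_map_poly vpow_power)
  then have "Poly_Mapping.lookup (eval_q p) j = (\<Sum>i\<le>N. if j = 2 * int i then coeff p i else 0)"
    by (simp add: lookup_sum lookup_of_int_mult vpow_def lookup_single when_def if_distrib eq_commute cong: if_cong)
  also have "\<dots> = (if j \<ge> 0 \<and> even j then coeff p (nat j div 2) else 0)"
  proof (cases "j \<ge> 0 \<and> even j")
    case True
    then obtain i where i: "j = 2 * int i" by (metis evenE nonneg_int_cases zero_le_mult_iff zero_le_numeral not_numeral_le_zero)
    then have "(\<Sum>i\<le>N. if j = 2 * int i then coeff p i else 0) = (\<Sum>k\<le>N. if k = i then coeff p i else 0)"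
      by (intro sum.cong) auto
    then show ?thesis using i by (simp add: N_def nat_mult_distrib)
  qed (auto intro!: sum.neutral)
  finally show ?thesis .
qed

lemma eval_q_add: "eval_q (p + s) = eval_q p + eval_q s"
  by (rule poly_mapping_eqI) (simp add: lookup_eval_q lookup_add)

lemma eval_q_diff: "eval_q (p - s) = eval_q p - eval_q s"
  by (rule poly_mapping_eqI) (simp add: lookup_eval_q lookup_minus)

lemma eval_q_zero [simp]: "eval_q 0 = 0"
  by (simp add: eval_q_def)

lemma eval_q_one [simp]: "eval_q 1 = 1"
  by (simp add: eval_q_def)

lemma eval_q_smult: "eval_q (smult m p) = of_int m * eval_q p"
  by (rule poly_mapping_eqI) (simp add: lookup_eval_q lookup_of_int_mult)

lemma eval_q_sum: "eval_q (\<Sum>i\<in>A. f i) = (\<Sum>i\<in>A. eval_q (f i))"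
  by (induction A rule: infinite_finite_induct) (simp_all add: eval_q_add)

lemma eval_q_monom_mult: "eval_q (monom 1 k * p) = vpow (2 * int k) * eval_q p"
proof (rule poly_mapping_eqI)
  fix j
  have "nat (j - 2 * int k) div 2 = nat j div 2 - k" if "j \<ge> 2 * int k"
    using that by (auto simp: nat_diff_distrib nat_mult_distrib)
  then show "Poly_Mapping.lookup (eval_q (monom 1 k * p)) j = Poly_Mapping.lookup (vpow (2 * int k) * eval_q p) j"
    by (auto simp: lookup_eval_q lookup_vpow_mult coeff_monom_mult)
qed

section \<open>The Hecke algebra\<close>

context simply_connected_datum
begin

text \<open>Right multiplication by T_s on coefficients, the mirror image of
  \<open>hecke_T_mult\<close>. The definitions of the bar involution only involve left
  multiplication; the right operators serve as maps commuting with it.\<close>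

definition hecke_T_rmult :: "int ^ 'n \<Rightarrow> 'n hecke \<Rightarrow> 'n hecke" where
  "hecke_T_rmult \<alpha> h = (\<lambda>x. if \<l> (x \<circ> \<sigma> \<alpha>) < \<l> x
     then h (x \<circ> \<sigma> \<alpha>) + (vpow 2 - 1) * h x else vpow 2 * h (x \<circ> \<sigma> \<alpha>))"

definition hecke_Tinv_rmult :: "int ^ 'n \<Rightarrow> 'n hecke \<Rightarrow> 'n hecke" where
  "hecke_Tinv_rmult \<alpha> h = (\<lambda>x. vpow (- 2) * hecke_T_rmult \<alpha> h x + (vpow (- 2) - 1) * h x)"

text \<open>Coefficient functions live on all self-maps of the lattice, but the length comparisons
  behind the algebra relations make sense only on W.\<close>

definition hecke_supp :: "'n hecke \<Rightarrow> bool" where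
  "hecke_supp h \<longleftrightarrow> (\<forall>x. x \<notin> W \<longrightarrow> h x = 0)"

abbreviation lmul where "lmul \<equiv> hecke_T_mult R"
abbreviation lmul_inv where "lmul_inv \<equiv> hecke_Tinv_mult R"
abbreviation rmul where "rmul \<equiv> hecke_T_rmult"
abbreviation rmul_inv where "rmul_inv \<equiv> hecke_Tinv_rmult"

lemma lmul_apply: "lmul \<alpha> h x = (if \<l> (\<sigma> \<alpha> \<circ> x) < \<l> x
     then h (\<sigma> \<alpha> \<circ> x) + (vpow 2 - 1) * h x else vpow 2 * h (\<sigma> \<alpha> \<circ> x))"
  by (simp add: hecke_T_mult_def)

lemma rmul_apply: "rmul \<alpha> h x = (if \<l> (x \<circ> \<sigma> \<alpha>) < \<l> x
     then h (x \<circ> \<sigma> \<alpha>) + (vpow 2 - 1) * h x else vpow 2 * h (x \<circ> \<sigma> \<alpha>))"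
  by (simp add: hecke_T_rmult_def)

lemma lmul_inv_apply: "lmul_inv \<alpha> h x = vpow (- 2) * lmul \<alpha> h x + (vpow (- 2) - 1) * h x"
  by (simp add: hecke_Tinv_mult_def)

lemma rmul_inv_apply: "rmul_inv \<alpha> h x = vpow (- 2) * rmul \<alpha> h x + (vpow (- 2) - 1) * h x"
  by (simp add: hecke_Tinv_rmult_def)

lemma hecke_supp_lmul: "\<alpha> \<in> \<Delta> \<Longrightarrow> hecke_supp h \<Longrightarrow> hecke_supp (lmul \<alpha> h)"
  and hecke_supp_rmul: "\<alpha> \<in> \<Delta> \<Longrightarrow> hecke_supp h \<Longrightarrow> hecke_supp (rmul \<alpha> h)"
  by (simp_all add: hecke_supp_def lmul_apply rmul_apply)

lemma hecke_supp_lmul_inv: "\<alpha> \<in> \<Delta> \<Longrightarrow> hecke_supp h \<Longrightarrow> hecke_supp (lmul_inv \<alpha> h)"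
  and hecke_supp_rmul_inv: "\<alpha> \<in> \<Delta> \<Longrightarrow> hecke_supp h \<Longrightarrow> hecke_supp (rmul_inv \<alpha> h)"
  using hecke_supp_lmul[of \<alpha> h] hecke_supp_rmul[of \<alpha> h] by (simp_all add: hecke_supp_def lmul_inv_apply rmul_inv_apply)

lemma hecke_supp_T: "w \<in> W \<Longrightarrow> hecke_supp (hecke_T w)"
  by (auto simp: hecke_supp_def hecke_T_def)

lemma len_cases_simple:
  assumes "x \<in> W" "\<alpha> \<in> \<Delta>"
  shows "\<l> (x \<circ> \<sigma> \<alpha>) < \<l> x \<longleftrightarrow> \<not> \<l> x < \<l> (x \<circ> \<sigma> \<alpha>)"
    "\<l> (\<sigma> \<alpha> \<circ> x) < \<l> x \<longleftrightarrow> \<not> \<l> x < \<l> (\<sigma> \<alpha> \<circ> x)"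
  using len_simple_less_iff[OF assms] len_simple_comp_less_iff[OF assms] by auto

text \<open>Multiplying on one side affects the length comparison on the other side only if
  \<open>inv x \<alpha>\<close> is \<beta> or its negative, which is the excluded equality: a simple
  reflection preserves the sign of every root other than plus or minus its own.\<close>

lemma len_cross:
  assumes x: "x \<in> W" and a: "\<alpha> \<in> \<Delta>" and b: "\<beta> \<in> \<Delta>" and ne: "\<sigma> \<alpha> \<circ> x \<noteq> x \<circ> \<sigma> \<beta>"
  shows "\<l> (\<sigma> \<alpha> \<circ> (x \<circ> \<sigma> \<beta>)) < \<l> (x \<circ> \<sigma> \<beta>) \<longleftrightarrow> \<l> (\<sigma> \<alpha> \<circ> x) < \<l> x"
    "\<l> ((\<sigma> \<alpha> \<circ> x) \<circ> \<sigma> \<beta>) < \<l> (\<sigma> \<alpha> \<circ> x) \<longleftrightarrow> \<l> (x \<circ> \<sigma> \<beta>) < \<l> x"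
proof -
  have ra: "\<alpha> \<in> \<Phi>" "\<beta> \<in> \<Phi>" using a b simple_root by auto
  have xb: "x \<beta> \<in> \<Phi>" "inv x \<alpha> \<in> \<Phi>" using x ra weyl_root weyl_inv by auto
  have n1: "x \<beta> \<noteq> \<alpha>" "x \<beta> \<noteq> - \<alpha>"
    using ne weyl_conj[OF x ra(2)] reflection_uminus[OF ra(1)] by auto
  have n2: "inv x \<alpha> \<noteq> \<beta>" "inv x \<alpha> \<noteq> - \<beta>"
    using n1 weyl_inv_apply(2)[OF x, of \<alpha>] weyl_uminus[OF x, of \<beta>] by auto
  have "inv (x \<circ> \<sigma> \<beta>) = \<sigma> \<beta> \<circ> inv x"
    using x ra by (intro inv_unique_comp) (simp_all add: fun_eq_iff weyl_inv_apply)
  then have i: "inv (x \<circ> \<sigma> \<beta>) \<alpha> = \<sigma> \<beta> (inv x \<alpha>)" by simp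
  show "\<l> (\<sigma> \<alpha> \<circ> (x \<circ> \<sigma> \<beta>)) < \<l> (x \<circ> \<sigma> \<beta>) \<longleftrightarrow> \<l> (\<sigma> \<alpha> \<circ> x) < \<l> x"
    using len_simple_comp_less_iff(1)[of "x \<circ> \<sigma> \<beta>" \<alpha>] len_simple_comp_less_iff(1)[of x \<alpha>] x a b i
      pos_reflection_iff[OF b xb(2) n2] by simp
  show "\<l> ((\<sigma> \<alpha> \<circ> x) \<circ> \<sigma> \<beta>) < \<l> (\<sigma> \<alpha> \<circ> x) \<longleftrightarrow> \<l> (x \<circ> \<sigma> \<beta>) < \<l> x"
    using len_simple_less_iff(1)[of "\<sigma> \<alpha> \<circ> x" \<beta>] len_simple_less_iff(1)[of x \<beta>] x a b
      pos_reflection_iff[OF a xb(1) n1] by simp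
qed

text \<open>If the left and right neighbours of x coincide, both operators use the same two-element
  set and the same coefficients. Otherwise, by \<open>len_cross\<close>, each operator sees the same
  length comparison on both edges of a square, and the two products expand equally.\<close>

lemma lmul_rmul_commute_at:
  assumes x: "x \<in> W" and a: "\<alpha> \<in> \<Delta>" and b: "\<beta> \<in> \<Delta>"
  shows "lmul \<alpha> (rmul \<beta> h) x = rmul \<beta> (lmul \<alpha> h) x"
proof (cases "\<sigma> \<alpha> \<circ> x = x \<circ> \<sigma> \<beta>")
  case True
  have ra: "\<alpha> \<in> \<Phi>" "\<beta> \<in> \<Phi>" using a b simple_root by auto
  have e1: "\<sigma> \<alpha> \<circ> (x \<circ> \<sigma> \<beta>) = x" using ra True by (metis reflection_reflection_comp)
  have e2: "(x \<circ> \<sigma> \<beta>) \<circ> \<sigma> \<beta> = x" using ra by simp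
  have c: "\<l> (x \<circ> \<sigma> \<beta>) < \<l> x \<longleftrightarrow> \<not> \<l> x < \<l> (x \<circ> \<sigma> \<beta>)" using len_cases_simple x b by blast
  show ?thesis using c by (simp only: lmul_apply rmul_apply True e1 e2)
next
  case False
  note c = len_cross[OF x a b False]
  show ?thesis
    by (simp only: lmul_apply rmul_apply c) (simp add: comp_assoc algebra_simps)
qed

lemma lmul_rmul_commute:
  assumes "hecke_supp h" "\<alpha> \<in> \<Delta>" "\<beta> \<in> \<Delta>"
  shows "lmul \<alpha> (rmul \<beta> h) = rmul \<beta> (lmul \<alpha> h)"
proof
  fix x
  show "lmul \<alpha> (rmul \<beta> h) x = rmul \<beta> (lmul \<alpha> h) x"
    using lmul_rmul_commute_at[of x \<alpha> \<beta> h] assms hecke_supp_lmul[of \<alpha>] hecke_supp_rmul[of \<beta>]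
    by (cases "x \<in> W") (auto simp: hecke_supp_def)
qed

lemma lmul_comb: "lmul \<alpha> (\<lambda>x. c * g x + d * k x) x = c * lmul \<alpha> g x + d * lmul \<alpha> k x"
  and rmul_comb: "rmul \<alpha> (\<lambda>x. c * g x + d * k x) x = c * rmul \<alpha> g x + d * rmul \<alpha> k x"
  by (simp_all add: lmul_apply rmul_apply algebra_simps)

lemma lmul_sum: "lmul \<alpha> (\<lambda>x. \<Sum>w\<in>A. c w * g w x) x = (\<Sum>w\<in>A. c w * lmul \<alpha> (g w) x)"
  and rmul_sum: "rmul \<alpha> (\<lambda>x. \<Sum>w\<in>A. c w * g w x) x = (\<Sum>w\<in>A. c w * rmul \<alpha> (g w) x)"
  by (simp_all add: lmul_apply rmul_apply sum_distrib_left sum.distrib sum_subtractf algebra_simps)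

lemma lmul_rmul_inv_commute:
  assumes "hecke_supp h" "\<alpha> \<in> \<Delta>" "\<beta> \<in> \<Delta>"
  shows "lmul \<alpha> (rmul_inv \<beta> h) = rmul_inv \<beta> (lmul \<alpha> h)"
proof
  fix x
  have "rmul_inv \<beta> h = (\<lambda>x. vpow (- 2) * rmul \<beta> h x + (vpow (- 2) - 1) * h x)"
    by (simp add: fun_eq_iff rmul_inv_apply)
  then show "lmul \<alpha> (rmul_inv \<beta> h) x = rmul_inv \<beta> (lmul \<alpha> h) x"
    using lmul_rmul_commute[OF assms] by (simp add: lmul_comb rmul_inv_apply)
qed

lemma lmul_inv_rmul_inv_commute:
  assumes "hecke_supp h" "\<alpha> \<in> \<Delta>" "\<beta> \<in> \<Delta>"
  shows "lmul_inv \<alpha> (rmul_inv \<beta> h) = rmul_inv \<beta> (lmul_inv \<alpha> h)"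
proof
  fix x
  have e: "lmul_inv \<alpha> h = (\<lambda>x. vpow (- 2) * lmul \<alpha> h x + (vpow (- 2) - 1) * h x)"
    by (simp add: fun_eq_iff lmul_inv_apply)
  have "lmul_inv \<alpha> (rmul_inv \<beta> h) x = vpow (- 2) * rmul_inv \<beta> (lmul \<alpha> h) x + (vpow (- 2) - 1) * rmul_inv \<beta> h x"
    using lmul_rmul_inv_commute[OF assms] by (simp add: lmul_inv_apply)
  also have "\<dots> = rmul_inv \<beta> (lmul_inv \<alpha> h) x"
    unfolding rmul_inv_apply e rmul_comb by (simp add: algebra_simps)
  finally show "lmul_inv \<alpha> (rmul_inv \<beta> h) x = rmul_inv \<beta> (lmul_inv \<alpha> h) x" .
qed

lemma vpow_2_cancel [simp]: "vpow (- 2) * (vpow 2 * f) = f" "vpow 2 * (vpow (- 2) * f) = f"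
  by (simp_all add: vpow_mult_assoc)

text \<open>The relation T_s^2 = (q - 1) T_s + q read as a formula for the inverse: c = q, a = T_s
  h, b = h.\<close>

lemma quadratic_inverse:
  fixes c c' :: "'a::comm_ring_1"
  assumes "c' * c = 1"
  shows "c' * ((c - 1) * a + c * b) + (c' - 1) * a = b"
proof -
  have "c' * ((c - 1) * a + c * b) + (c' - 1) * a = (c' * c) * (a + b) - a"
    by (simp add: algebra_simps)
  then show ?thesis using assms by simp
qed

lemma vpow_2_inverse: "vpow (- 2) * vpow 2 = 1"
  by (simp add: vpow_mult)

lemma lmul_lmul:
  assumes "x \<in> W" "\<alpha> \<in> \<Delta>"
  shows "lmul \<alpha> (lmul \<alpha> h) x = (vpow 2 - 1) * lmul \<alpha> h x + vpow 2 * h x"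
  using len_cases_simple(2)[OF assms] assms simple_root
  by (simp add: lmul_apply[of \<alpha> "lmul \<alpha> h"]) (auto simp: lmul_apply algebra_simps)

lemma rmul_rmul:
  assumes "x \<in> W" "\<alpha> \<in> \<Delta>"
  shows "rmul \<alpha> (rmul \<alpha> h) x = (vpow 2 - 1) * rmul \<alpha> h x + vpow 2 * h x"
  using len_cases_simple(1)[OF assms] assms simple_root
  by (simp add: rmul_apply[of \<alpha> "rmul \<alpha> h"]) (auto simp: rmul_apply algebra_simps)

lemma lmul_lmul_inv:
  assumes h: "hecke_supp h" and a: "\<alpha> \<in> \<Delta>"
  shows "lmul \<alpha> (lmul_inv \<alpha> h) = h" "lmul_inv \<alpha> (lmul \<alpha> h) = h"
proof -
  have e: "lmul_inv \<alpha> h = (\<lambda>x. vpow (- 2) * lmul \<alpha> h x + (vpow (- 2) - 1) * h x)"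
    by (simp add: fun_eq_iff lmul_inv_apply)
  have s: "lmul \<alpha> (lmul_inv \<alpha> h) x = h x" "lmul_inv \<alpha> (lmul \<alpha> h) x = h x" if "x \<in> W" for x
    unfolding e lmul_comb lmul_lmul[OF that a] lmul_inv_apply by (rule quadratic_inverse[OF vpow_2_inverse])+
  have "lmul \<alpha> (lmul_inv \<alpha> h) x = h x \<and> lmul_inv \<alpha> (lmul \<alpha> h) x = h x" for x
    using s[of x] h a hecke_supp_lmul[OF a hecke_supp_lmul_inv[OF a h]] hecke_supp_lmul_inv[OF a hecke_supp_lmul[OF a h]]
    by (cases "x \<in> W") (auto simp: hecke_supp_def)
  then show "lmul \<alpha> (lmul_inv \<alpha> h) = h" "lmul_inv \<alpha> (lmul \<alpha> h) = h" by blast+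
qed

lemma rmul_rmul_inv:
  assumes h: "hecke_supp h" and a: "\<alpha> \<in> \<Delta>"
  shows "rmul \<alpha> (rmul_inv \<alpha> h) = h"
proof
  fix x
  have e: "rmul_inv \<alpha> h = (\<lambda>x. vpow (- 2) * rmul \<alpha> h x + (vpow (- 2) - 1) * h x)"
    by (simp add: fun_eq_iff rmul_inv_apply)
  have s: "rmul \<alpha> (rmul_inv \<alpha> h) x = h x" if "x \<in> W"
    unfolding e rmul_comb rmul_rmul[OF that a] by (rule quadratic_inverse[OF vpow_2_inverse])
  show "rmul \<alpha> (rmul_inv \<alpha> h) x = h x"
    using s h hecke_supp_rmul[OF a hecke_supp_rmul_inv[OF a h]] by (cases "x \<in> W") (auto simp: hecke_supp_def)
qed

lemma lmul_T:
  assumes w: "w \<in> W" "\<alpha> \<in> \<Delta>" "\<l> w < \<l> (\<sigma> \<alpha> \<circ> w)"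
  shows "lmul \<alpha> (hecke_T w) = hecke_T (\<sigma> \<alpha> \<circ> w)"
proof
  fix x
  have e: "\<sigma> \<alpha> \<circ> x = w \<longleftrightarrow> x = \<sigma> \<alpha> \<circ> w" using w simple_root by auto
  show "lmul \<alpha> (hecke_T w) x = hecke_T (\<sigma> \<alpha> \<circ> w) x"
    using w simple_root unfolding lmul_apply hecke_T_def e by (auto simp: not_less)
qed

lemma rmul_T:
  assumes w: "w \<in> W" "\<alpha> \<in> \<Delta>" "\<l> w < \<l> (w \<circ> \<sigma> \<alpha>)"
  shows "rmul \<alpha> (hecke_T w) = hecke_T (w \<circ> \<sigma> \<alpha>)"
proof
  fix x
  have e: "x \<circ> \<sigma> \<alpha> = w \<longleftrightarrow> x = w \<circ> \<sigma> \<alpha>" using w simple_root by auto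
  show "rmul \<alpha> (hecke_T w) x = hecke_T (w \<circ> \<sigma> \<alpha>) x"
    using w simple_root unfolding rmul_apply hecke_T_def e by (auto simp: not_less)
qed

abbreviation lmul_word where "lmul_word as h \<equiv> foldr lmul as h"
abbreviation lmul_inv_word where "lmul_inv_word as h \<equiv> foldr lmul_inv as h"

lemma hecke_supp_lmul_word: "set as \<subseteq> \<Delta> \<Longrightarrow> hecke_supp h \<Longrightarrow> hecke_supp (lmul_word as h)"
  and hecke_supp_lmul_inv_word: "set as \<subseteq> \<Delta> \<Longrightarrow> hecke_supp h \<Longrightarrow> hecke_supp (lmul_inv_word as h)"
  by (induction as) (simp_all add: hecke_supp_lmul hecke_supp_lmul_inv)

lemma lmul_word_rmul_commute:
  "set as \<subseteq> \<Delta> \<Longrightarrow> \<beta> \<in> \<Delta> \<Longrightarrow> hecke_supp h \<Longrightarrow> lmul_word as (rmul \<beta> h) = rmul \<beta> (lmul_word as h)"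
  by (induction as) (simp_all add: lmul_rmul_commute hecke_supp_lmul_word)

lemma lmul_inv_word_rmul_inv_commute:
  "set as \<subseteq> \<Delta> \<Longrightarrow> \<beta> \<in> \<Delta> \<Longrightarrow> hecke_supp h \<Longrightarrow> lmul_inv_word as (rmul_inv \<beta> h) = rmul_inv \<beta> (lmul_inv_word as h)"
  by (induction as) (simp_all add: lmul_inv_rmul_inv_commute hecke_supp_lmul_inv_word)

lemma lmul_word_sum:
  "lmul_word as (\<lambda>x. \<Sum>w\<in>A. c w * g w x) = (\<lambda>x. \<Sum>w\<in>A. c w * lmul_word as (g w) x)"
proof (induction as)
  case (Cons a as)
  have "lmul_word (a # as) (\<lambda>x. \<Sum>w\<in>A. c w * g w x) = lmul a (\<lambda>x. \<Sum>w\<in>A. c w * lmul_word as (g w) x)"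
    using Cons.IH by simp
  then show ?case by (simp add: fun_eq_iff lmul_sum)
qed simp

lemma lmul_word_T:
  "set as \<subseteq> \<Delta> \<Longrightarrow> length as = \<l> (refl_word R as) \<Longrightarrow> lmul_word as (hecke_T id) = hecke_T (refl_word R as)"
proof (induction as)
  case (Cons a as)
  let ?w = "refl_word R as"
  have w: "?w \<in> W" using Cons.prems by (auto simp: weyl_word)
  have a: "a \<in> \<Delta>" using Cons.prems by simp
  have "\<l> ?w \<le> length as" using len_word_le[of as] Cons.prems by simp
  moreover have "\<l> (\<sigma> a \<circ> ?w) = Suc (length as)"
    using Cons.prems(2) by (metis length_Cons refl_word_Cons)
  moreover have "\<l> (\<sigma> a \<circ> ?w) \<le> \<l> ?w + 1" using len_simple_comp[OF w a] by (simp split: if_splits)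
  ultimately have l: "length as = \<l> ?w" "\<l> ?w < \<l> (\<sigma> a \<circ> ?w)" by linarith+
  have IH: "lmul_word as (hecke_T id) = hecke_T ?w"
    by (rule Cons.IH) (use Cons.prems l in simp_all)
  have "lmul_word (a # as) (hecke_T id) = lmul a (lmul_word as (hecke_T id))" by simp
  also have "\<dots> = hecke_T (\<sigma> a \<circ> ?w)" unfolding IH by (rule lmul_T[OF w a l(2)])
  finally show ?case unfolding refl_word_Cons .
qed simp

text \<open>Every T_w arises from T_1 by right multiplications, which commute with left ones, so an
  operator composed of left multiplications is known from its value at T_1. This plays the role of
  Matsumoto's theorem.\<close>

lemma lmul_word_determined:
  assumes as: "set as \<subseteq> \<Delta>" and bs: "set bs \<subseteq> \<Delta>"
    and eq: "lmul_word as (hecke_T id) = lmul_word bs (hecke_T id)" and h: "hecke_supp h"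
  shows "lmul_word as h = lmul_word bs h"
proof -
  have T: "lmul_word as (hecke_T w) = lmul_word bs (hecke_T w)" if "w \<in> W" for w
    using that
  proof (induction "\<l> w" arbitrary: w rule: less_induct)
    case less
    show ?case
    proof (cases "w = id")
      case False
      then obtain \<alpha> where a: "\<alpha> \<in> \<Delta>" "\<l> (w \<circ> \<sigma> \<alpha>) < \<l> w"
        using right_descent_exists less.prems by blast
      let ?u = "w \<circ> \<sigma> \<alpha>"
      have u: "?u \<in> W" using a less.prems by simp
      have Tw: "hecke_T w = rmul \<alpha> (hecke_T ?u)"
        using rmul_T[OF u a(1)] a simple_root by simp
      show ?thesis
        using less.hyps[OF a(2) u] lmul_word_rmul_commute[OF as a(1) hecke_supp_T[OF u]]
          lmul_word_rmul_commute[OF bs a(1) hecke_supp_T[OF u]] by (simp add: Tw)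
    qed (use eq in simp)
  qed
  have "h x = (\<Sum>w\<in>W. h w * hecke_T w x)" for x
    using h by (auto simp: hecke_T_def hecke_supp_def if_distrib cong: if_cong)
  then have hs: "h = (\<lambda>x. \<Sum>w\<in>W. h w * hecke_T w x)" by (rule ext)
  show ?thesis
    apply (subst (1 2) hs)
    unfolding lmul_word_sum using T by simp
qed

lemma lmul_word_rev_lmul_inv_word:
  "set as \<subseteq> \<Delta> \<Longrightarrow> hecke_supp h \<Longrightarrow> lmul_word (rev as) (lmul_inv_word as h) = h"
  by (induction as) (simp_all add: lmul_lmul_inv hecke_supp_lmul_inv_word)

lemma lmul_inv_word_lmul_word_rev:
  "set as \<subseteq> \<Delta> \<Longrightarrow> hecke_supp h \<Longrightarrow> lmul_inv_word as (lmul_word (rev as) h) = h"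
  by (induction as arbitrary: h) (simp_all add: lmul_lmul_inv hecke_supp_lmul)

section \<open>The bar involution on the standard basis\<close>

abbreviation bar_T where "bar_T \<equiv> hecke_bar_T R"

lemma reduced_word_props:
  assumes "w \<in> W"
  shows "set (reduced_word R w) \<subseteq> \<Delta>" "refl_word R (reduced_word R w) = w"
    "length (reduced_word R w) = \<l> w"
proof -
  have "\<exists>as. set as \<subseteq> \<Delta> \<and> refl_word R as = w \<and> length as = \<l> w"
    using reduced_expression[OF assms] by metis
  from someI_ex[OF this] show "set (reduced_word R w) \<subseteq> \<Delta>"
    "refl_word R (reduced_word R w) = w" "length (reduced_word R w) = \<l> w"
    unfolding reduced_word_def by blast+
qed

text \<open>Makes the SOME in \<open>reduced_word\<close> harmless. Reversing two reduced words of w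
  gives two products equal to T at the inverse of w, hence equal operators, and then their inverses
  agree too.\<close>

lemma hecke_bar_T_word:
  assumes as: "set as \<subseteq> \<Delta>" and len: "length as = \<l> (refl_word R as)"
  shows "bar_T (refl_word R as) = lmul_inv_word as (hecke_T id)"
proof -
  let ?w = "refl_word R as" let ?bs = "reduced_word R ?w"
  have w: "?w \<in> W" using as by (auto simp: weyl_word)
  note b = reduced_word_props[OF w]
  have sub: "set as \<subseteq> \<Phi>" "set ?bs \<subseteq> \<Phi>" using as b simple_root by auto
  have inv: "refl_word R (rev as) = inv ?w" "refl_word R (rev ?bs) = inv ?w"
    using inv_refl_word[OF sub(1)] inv_refl_word[OF sub(2)] b by simp_all
  have "lmul_word (rev as) (hecke_T id) = hecke_T (inv ?w)"
    using lmul_word_T[of "rev as"] as inv len_inv[OF w] len by simp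
  moreover have "lmul_word (rev ?bs) (hecke_T id) = hecke_T (inv ?w)"
    using lmul_word_T[of "rev ?bs"] b inv len_inv[OF w] by simp
  ultimately have eq: "lmul_word (rev as) (hecke_T id) = lmul_word (rev ?bs) (hecke_T id)" by simp
  have s: "hecke_supp (lmul_inv_word ?bs (hecke_T id))" using b hecke_supp_lmul_inv_word hecke_supp_T by simp
  have "lmul_inv_word as (hecke_T id) = lmul_inv_word as (lmul_word (rev ?bs) (lmul_inv_word ?bs (hecke_T id)))"
    using lmul_word_rev_lmul_inv_word[of ?bs "hecke_T id"] b hecke_supp_T by simp
  also have "\<dots> = lmul_inv_word as (lmul_word (rev as) (lmul_inv_word ?bs (hecke_T id)))"
    using lmul_word_determined[of "rev as" "rev ?bs", OF _ _ eq s] as b by simp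
  also have "\<dots> = lmul_inv_word ?bs (hecke_T id)" using lmul_inv_word_lmul_word_rev[OF as s] .
  finally show ?thesis by (simp add: hecke_bar_T_def)
qed

lemma hecke_bar_T_id [simp]: "bar_T id = hecke_T id"
  using hecke_bar_T_word[of "[]"] by simp

lemma hecke_supp_bar_T: "w \<in> W \<Longrightarrow> hecke_supp (bar_T w)"
  unfolding hecke_bar_T_def using reduced_word_props hecke_supp_lmul_inv_word hecke_supp_T by simp

text \<open>Appending a letter to a reduced word inserts its inverse next to T_1. There the left and
  the right multiplication agree, and the right one commutes past all earlier letters.\<close>

lemma hecke_bar_T_comp_simple:
  assumes w: "w \<in> W" "\<alpha> \<in> \<Delta>" "\<l> w < \<l> (w \<circ> \<sigma> \<alpha>)"
  shows "bar_T (w \<circ> \<sigma> \<alpha>) = rmul_inv \<alpha> (bar_T w)"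
proof -
  obtain as where as: "set as \<subseteq> \<Delta>" "refl_word R as = w" "length as = \<l> w"
    using reduced_expression[OF w(1)] .
  have e: "refl_word R (as @ [\<alpha>]) = w \<circ> \<sigma> \<alpha>" using as by (simp add: refl_word_append)
  have l: "length (as @ [\<alpha>]) = \<l> (w \<circ> \<sigma> \<alpha>)" using w as len_comp_simple_le[OF w(1,2)] by simp
  have "lmul \<alpha> (hecke_T id) = rmul \<alpha> (hecke_T id)"
    using lmul_T[of id \<alpha>] rmul_T[of id \<alpha>] len_simple_less_iff(2)[of id \<alpha>] len_simple_comp_less_iff(2)[of id \<alpha>]
      w(2) pos_simple by simp
  then have "lmul_inv \<alpha> (hecke_T id) = rmul_inv \<alpha> (hecke_T id)" by (simp add: fun_eq_iff lmul_inv_apply rmul_inv_apply)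
  then have "bar_T (w \<circ> \<sigma> \<alpha>) = lmul_inv_word as (rmul_inv \<alpha> (hecke_T id))"
    using hecke_bar_T_word[of "as @ [\<alpha>]"] as e l w(2) by simp
  also have "\<dots> = rmul_inv \<alpha> (lmul_inv_word as (hecke_T id))"
    using lmul_inv_word_rmul_inv_commute as w(2) hecke_supp_T by simp
  also have "lmul_inv_word as (hecke_T id) = bar_T w" using hecke_bar_T_word[of as] as by simp
  finally show ?thesis .
qed

text \<open>Each letter of a reduced word contributes one factor v^(-2) on the diagonal and raises
  the lengths in the support by at most one.\<close>

lemma hecke_bar_T_triangular:
  assumes "w \<in> W"
  shows "bar_T w w = vpow (- 2 * int (\<l> w))" "bar_T w x \<noteq> 0 \<Longrightarrow> x = w \<or> \<l> x < \<l> w"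
proof -
  have "bar_T w w = vpow (- 2 * int (\<l> w)) \<and> (\<forall>x. bar_T w x \<noteq> 0 \<longrightarrow> x = w \<or> \<l> x < \<l> w)"
    using assms
  proof (induction "\<l> w" arbitrary: w rule: less_induct)
    case less
    show ?case
    proof (cases "w = id")
      case True then show ?thesis by (simp add: hecke_T_def)
    next
      case False
      then obtain \<alpha> where a: "\<alpha> \<in> \<Delta>" "\<l> (w \<circ> \<sigma> \<alpha>) < \<l> w"
        using right_descent_exists less.prems by blast
      define u where "u = w \<circ> \<sigma> \<alpha>"
      have u: "u \<in> W" "u \<circ> \<sigma> \<alpha> = w" using a less.prems simple_root by (simp_all add: u_def)
      have lw: "\<l> w = \<l> u + 1" using a u len_comp_simple_le[OF u(1) a(1)] by (simp add: u_def)
      have Dw: "bar_T w = rmul_inv \<alpha> (bar_T u)" using hecke_bar_T_comp_simple[OF u(1) a(1)] u lw by simp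
      have IH: "bar_T u u = vpow (- 2 * int (\<l> u))" "\<And>x. bar_T u x \<noteq> 0 \<Longrightarrow> x = u \<or> \<l> x < \<l> u"
        using less.hyps[of u] u lw by auto
      have "bar_T u w = 0" using IH(2)[of w] lw by (metis less_add_one less_irrefl less_trans)
      then have "bar_T w w = vpow (- 2) * bar_T u u"
        using a unfolding Dw rmul_inv_apply rmul_apply by (simp add: u_def)
      then have 1: "bar_T w w = vpow (- 2 * int (\<l> w))"
        by (simp add: IH(1) lw vpow_mult algebra_simps)
      have 2: "x = w \<or> \<l> x < \<l> w" if nz: "bar_T w x \<noteq> 0" for x
      proof -
        have x: "x \<in> W" using hecke_supp_bar_T[OF less.prems] nz by (auto simp: hecke_supp_def)
        have "bar_T u x \<noteq> 0 \<or> bar_T u (x \<circ> \<sigma> \<alpha>) \<noteq> 0"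
          using nz unfolding Dw rmul_inv_apply rmul_apply by (auto split: if_splits)
        then consider "x = u \<or> \<l> x < \<l> u" | "x \<circ> \<sigma> \<alpha> = u" | "\<l> (x \<circ> \<sigma> \<alpha>) < \<l> u" using IH(2) by blast
        then show ?thesis
        proof cases
          case 2
          then have "x = u \<circ> \<sigma> \<alpha>" using a(1) simple_root by auto
          then show ?thesis using u by simp
        next
          case 3
          have "\<l> x \<le> \<l> (x \<circ> \<sigma> \<alpha>) + 1"
            using len_comp_simple_le[of "x \<circ> \<sigma> \<alpha>" \<alpha>] x a simple_root by simp
          then show ?thesis using 3 lw by linarith
        qed (use lw in auto)
      qed
      show ?thesis using 1 2 by blast
    qed
  qed
  then show "bar_T w w = vpow (- 2 * int (\<l> w))" "bar_T w x \<noteq> 0 \<Longrightarrow> x = w \<or> \<l> x < \<l> w" by blast+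
qed

text \<open>Right multiplication by 1 + T_s, which is v times the Kazhdan-Lusztig element
  C'_s.\<close>

definition hecke_kappa :: "int ^ 'n \<Rightarrow> 'n hecke \<Rightarrow> 'n hecke" where
  "hecke_kappa \<alpha> h = (\<lambda>x. h x + rmul \<alpha> h x)"

lemma hecke_kappa_apply:
  "hecke_kappa \<alpha> h x = (if \<l> (x \<circ> \<sigma> \<alpha>) < \<l> x
     then h (x \<circ> \<sigma> \<alpha>) + vpow 2 * h x else h x + vpow 2 * h (x \<circ> \<sigma> \<alpha>))"
  by (simp add: hecke_kappa_def rmul_apply algebra_simps)

lemma sum_weyl_split:
  assumes a: "\<alpha> \<in> \<Delta>"
  shows "(\<Sum>w\<in>W. F w) = (\<Sum>w | w \<in> W \<and> \<l> w < \<l> (w \<circ> \<sigma> \<alpha>). F w + F (w \<circ> \<sigma> \<alpha>))"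
proof -
  let ?A = "{w \<in> W. \<l> w < \<l> (w \<circ> \<sigma> \<alpha>)}" and ?B = "{w \<in> W. \<l> (w \<circ> \<sigma> \<alpha>) < \<l> w}"
  have ra: "\<alpha> \<in> \<Phi>" using a simple_root by blast
  have "(\<Sum>w\<in>W. F w) = (\<Sum>w\<in>?A \<union> ?B. F w)"
    using len_cases_simple(1)[OF _ a] by (intro sum.cong) auto
  also have "\<dots> = (\<Sum>w\<in>?A. F w) + (\<Sum>w\<in>?B. F w)" by (rule sum.union_disjoint) auto
  also have "(\<Sum>w\<in>?B. F w) = (\<Sum>w\<in>?A. F (w \<circ> \<sigma> \<alpha>))"
    by (rule sum.reindex_bij_witness[of _ "\<lambda>w. w \<circ> \<sigma> \<alpha>" "\<lambda>w. w \<circ> \<sigma> \<alpha>"]) (use ra a in simp_all)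
  finally show ?thesis unfolding sum.distrib .
qed

text \<open>The bar image of 1 + T_s is q^(-1) (1 + T_s). The sums are grouped into pairs w < ws,
  since \<open>hecke_bar_T_comp_simple\<close> relates \<open>bar_T\<close> on exactly such
  pairs.\<close>

lemma hecke_bar_kappa:
  assumes a: "\<alpha> \<in> \<Delta>"
  shows "hecke_bar R (hecke_kappa \<alpha> h) x = vpow (- 2) * hecke_kappa \<alpha> (hecke_bar R h) x"
proof -
  let ?A = "{w \<in> W. \<l> w < \<l> (w \<circ> \<sigma> \<alpha>)}"
  have ra: "\<alpha> \<in> \<Phi>" using a simple_root by blast
  have k: "vpow (- 2) * hecke_kappa \<alpha> (bar_T w) x = bar_T w x + bar_T (w \<circ> \<sigma> \<alpha>) x"
    "vpow (- 2) * hecke_kappa \<alpha> (bar_T (w \<circ> \<sigma> \<alpha>)) x = vpow (- 2) * (bar_T w x + bar_T (w \<circ> \<sigma> \<alpha>) x)"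
    if w: "w \<in> ?A" for w
  proof -
    have e: "bar_T (w \<circ> \<sigma> \<alpha>) = rmul_inv \<alpha> (bar_T w)" using hecke_bar_T_comp_simple[OF _ a] w by blast
    show "vpow (- 2) * hecke_kappa \<alpha> (bar_T w) x = bar_T w x + bar_T (w \<circ> \<sigma> \<alpha>) x"
      unfolding e hecke_kappa_def rmul_inv_apply by (simp add: algebra_simps)
    have "rmul \<alpha> (bar_T (w \<circ> \<sigma> \<alpha>)) = bar_T w" unfolding e using rmul_rmul_inv hecke_supp_bar_T a w by blast
    then show "vpow (- 2) * hecke_kappa \<alpha> (bar_T (w \<circ> \<sigma> \<alpha>)) x = vpow (- 2) * (bar_T w x + bar_T (w \<circ> \<sigma> \<alpha>) x)"
      by (simp add: hecke_kappa_def algebra_simps)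
  qed
  have hs: "hecke_bar R h = (\<lambda>x. \<Sum>w\<in>W. laurent_bar (h w) * bar_T w x)"
    by (simp add: hecke_bar_def)
  have "vpow (- 2) * hecke_kappa \<alpha> (hecke_bar R h) x =
      (\<Sum>w\<in>W. laurent_bar (h w) * (vpow (- 2) * hecke_kappa \<alpha> (bar_T w) x))"
    unfolding hecke_kappa_def hs rmul_sum
    by (simp add: sum.distrib[symmetric] sum_distrib_left algebra_simps)
  also have "\<dots> = (\<Sum>w\<in>?A. laurent_bar (h w) * (vpow (- 2) * hecke_kappa \<alpha> (bar_T w) x) +
      laurent_bar (h (w \<circ> \<sigma> \<alpha>)) * (vpow (- 2) * hecke_kappa \<alpha> (bar_T (w \<circ> \<sigma> \<alpha>)) x))"
    by (rule sum_weyl_split[OF a])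
  also have "\<dots> = (\<Sum>w\<in>?A. (laurent_bar (h w) + vpow (- 2) * laurent_bar (h (w \<circ> \<sigma> \<alpha>))) *
      (bar_T w x + bar_T (w \<circ> \<sigma> \<alpha>) x))"
    by (intro sum.cong refl) (simp only: k, simp add: algebra_simps)
  also have "\<dots> = (\<Sum>w\<in>?A. laurent_bar (hecke_kappa \<alpha> h w) * bar_T w x +
      laurent_bar (hecke_kappa \<alpha> h (w \<circ> \<sigma> \<alpha>)) * bar_T (w \<circ> \<sigma> \<alpha>) x)"
  proof (intro sum.cong refl)
    fix w assume w: "w \<in> ?A"
    then have "hecke_kappa \<alpha> h w = h w + vpow 2 * h (w \<circ> \<sigma> \<alpha>)"
      "hecke_kappa \<alpha> h (w \<circ> \<sigma> \<alpha>) = h w + vpow 2 * h (w \<circ> \<sigma> \<alpha>)"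
      using ra by (simp_all add: hecke_kappa_apply)
    then show "(laurent_bar (h w) + vpow (- 2) * laurent_bar (h (w \<circ> \<sigma> \<alpha>))) * (bar_T w x + bar_T (w \<circ> \<sigma> \<alpha>) x) =
      laurent_bar (hecke_kappa \<alpha> h w) * bar_T w x + laurent_bar (hecke_kappa \<alpha> h (w \<circ> \<sigma> \<alpha>)) * bar_T (w \<circ> \<sigma> \<alpha>) x"
      by (simp add: laurent_bar_add laurent_bar_vpow_mult algebra_simps)
  qed
  also have "\<dots> = hecke_bar R (hecke_kappa \<alpha> h) x"
    unfolding hecke_bar_def by (rule sum_weyl_split[OF a, symmetric])
  finally show ?thesis by simp
qed

section \<open>Kazhdan-Lusztig polynomials\<close>

lemma kl_element_apply: "kl_element R w P y = vpow (- int (\<l> w)) * eval_q (P y)"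
  by (simp add: kl_element_def eval_q_def)

text \<open>At a longest y where the families differ, triangularity leaves a single term in the bar
  invariance: \<open>d y\<close> is v^(-2 l(y)) times its own bar image. Its exponents are thus
  symmetric about -l(y), while the degree bounds place all of them below -l(y).\<close>

lemma kl_family_unique:
  assumes P: "is_kl_family R w P" and Q: "is_kl_family R w Q"
  shows "P = Q"
proof (rule ccontr)
  assume ne: "P \<noteq> Q"
  define Y where "Y = {y. P y \<noteq> Q y}"
  have Y: "bruhat_le R y w" "y \<noteq> w" if "y \<in> Y" for y
  proof -
    have ne: "P y \<noteq> Q y" using that by (simp add: Y_def)
    show "y \<noteq> w" using ne P Q by (auto simp: is_kl_family_def)
    show "bruhat_le R y w"
    proof (rule ccontr)
      assume "\<not> bruhat_le R y w"
      then have "P y = 0" "Q y = 0" using P Q by (simp_all add: is_kl_family_def)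
      with ne show False by simp
    qed
  qed
  have YW: "Y \<subseteq> W" using Y bruhat_weyl by blast
  then have fY: "finite Y" using finite_subset finite_weyl by blast
  have Yne: "Y \<noteq> {}" using ne by (auto simp: Y_def)
  have "Max (\<l> ` Y) \<in> \<l> ` Y" using fY Yne by (intro Max_in) auto
  then obtain y where y: "y \<in> Y" "\<l> y = Max (\<l> ` Y)" by force
  have mx: "\<l> z \<le> \<l> y" if "z \<in> Y" for z using that fY y(2) by simp
  define d where "d = (\<lambda>z. kl_element R w P z - kl_element R w Q z)"
  define p where "p = P y - Q y"
  have dz: "d z = 0" if "z \<notin> Y" for z using that by (simp add: d_def kl_element_apply Y_def)
  have "d y = hecke_bar R (kl_element R w P) y - hecke_bar R (kl_element R w Q) y"
    using P Q by (simp add: d_def is_kl_family_def)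
  also have "\<dots> = (\<Sum>z\<in>W. laurent_bar (d z) * bar_T z y)"
    by (simp add: hecke_bar_def d_def laurent_bar_diff left_diff_distrib sum_subtractf)
  also have "\<dots> = (\<Sum>z\<in>W. if z = y then laurent_bar (d y) * bar_T y y else 0)"
  proof (intro sum.cong refl)
    fix z assume z: "z \<in> W"
    show "laurent_bar (d z) * bar_T z y = (if z = y then laurent_bar (d y) * bar_T y y else 0)"
    proof (cases "z = y \<or> z \<notin> Y")
      case True then show ?thesis using dz by auto
    next
      case False
      then have "bar_T z y = 0" using hecke_bar_T_triangular(2)[OF z, of y] mx[of z] by force
      with False show ?thesis by simp
    qed
  qed
  also have "\<dots> = vpow (- 2 * int (\<l> y)) * laurent_bar (d y)"
    using y YW hecke_bar_T_triangular(1)[of y] by (auto simp: mult.commute)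
  finally have dy: "d y = vpow (- 2 * int (\<l> y)) * laurent_bar (d y)" .
  have dp: "d y = vpow (- int (\<l> w)) * eval_q p"
    by (simp add: d_def kl_element_apply p_def eval_q_diff algebra_simps)
  have "p \<noteq> 0" using y by (simp add: p_def Y_def)
  have "2 * degree (P y) + 1 + \<l> y \<le> \<l> w" "2 * degree (Q y) + 1 + \<l> y \<le> \<l> w"
    using P Q Y[OF y(1)] by (auto simp: is_kl_family_def)
  moreover have "degree p \<le> max (degree (P y)) (degree (Q y))"
    unfolding p_def by (rule degree_diff_le_max)
  ultimately have deg: "2 * degree p + 1 + \<l> y \<le> \<l> w" by linarith
  \<comment> \<open>The top exponent of \<open>d y\<close>. Reflected in -l(y) it corresponds to the
    coefficient of p at l(w) - deg p - l(y), which is larger than deg p.\<close>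
  let ?j = "2 * int (degree p) - int (\<l> w)"
  have "Poly_Mapping.lookup (d y) ?j = coeff p (degree p)"
    by (simp add: dp lookup_vpow_mult lookup_eval_q nat_mult_distrib)
  then have "coeff p (degree p) = Poly_Mapping.lookup (vpow (- 2 * int (\<l> y)) * laurent_bar (d y)) ?j"
    using dy by simp
  also have "\<dots> = Poly_Mapping.lookup (eval_q p) (2 * int (\<l> w) - 2 * int (degree p) - 2 * int (\<l> y))"
  proof -
    have "- (?j - - 2 * int (\<l> y)) - - int (\<l> w) =
        2 * int (\<l> w) - 2 * int (degree p) - 2 * int (\<l> y)" by simp
    then show ?thesis by (simp only: dp lookup_vpow_mult lookup_laurent_bar)
  qed
  also have "\<dots> = coeff p (nat (2 * int (\<l> w) - 2 * int (degree p) - 2 * int (\<l> y)) div 2)"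
    using deg by (simp add: lookup_eval_q)
  also have "nat (2 * int (\<l> w) - 2 * int (degree p) - 2 * int (\<l> y)) div 2 = \<l> w - degree p - \<l> y"
    using deg by linarith
  also have "coeff p (\<l> w - degree p - \<l> y) = 0" using deg by (intro coeff_eq_0) linarith
  finally show False using \<open>p \<noteq> 0\<close> by simp
qed

lemma kl_poly_family:
  assumes "is_kl_family R w P"
  shows "(\<lambda>y. kl_poly R y w) = P"
proof -
  have "(THE P. is_kl_family R w P) = P" using assms kl_family_unique by blast
  then show ?thesis by (simp add: kl_poly_def)
qed

lemma kl_family_coeff_zero:
  assumes "is_kl_family R w P" "y \<noteq> w" "\<l> w < 2 * n + 1 + \<l> y"
  shows "coeff (P y) n = 0"
proof (cases "bruhat_le R y w")
  case True
  then have "2 * degree (P y) + 1 + \<l> y \<le> \<l> w" using assms by (auto simp: is_kl_family_def)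
  then show ?thesis using assms(3) by (intro coeff_eq_0) linarith
next
  case False
  then show ?thesis using assms by (auto simp: is_kl_family_def)
qed

lemma hecke_bar_comb:
  assumes "\<And>y. h y = vpow k * g y - (\<Sum>z\<in>A. of_int (m z) * f z y)"
  shows "hecke_bar R h y = vpow (- k) * hecke_bar R g y - (\<Sum>z\<in>A. of_int (m z) * hecke_bar R (f z) y)"
proof -
  have "hecke_bar R h y = (\<Sum>w\<in>W. vpow (- k) * (laurent_bar (g w) * bar_T w y)
      - (\<Sum>z\<in>A. of_int (m z) * (laurent_bar (f z w) * bar_T w y)))"
    unfolding hecke_bar_def assms laurent_bar_diff laurent_bar_vpow_mult laurent_bar_sum
      laurent_bar_of_int_mult
    by (simp add: left_diff_distrib sum_distrib_right mult.assoc)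
  also have "\<dots> = vpow (- k) * (\<Sum>w\<in>W. laurent_bar (g w) * bar_T w y)
      - (\<Sum>w\<in>W. \<Sum>z\<in>A. of_int (m z) * (laurent_bar (f z w) * bar_T w y))"
    by (simp only: sum_subtractf sum_distrib_left)
  also have "(\<Sum>w\<in>W. \<Sum>z\<in>A. of_int (m z) * (laurent_bar (f z w) * bar_T w y)) =
      (\<Sum>z\<in>A. \<Sum>w\<in>W. of_int (m z) * (laurent_bar (f z w) * bar_T w y))" by (rule sum.swap)
  finally show ?thesis unfolding hecke_bar_def by (simp only: sum_distrib_left)
qed

text \<open>
  The classical construction \<open>C'\<^sub>w = C'\<^sub>x C'\<^sub>s - \<Sum> \<mu>(z, x) C'\<^sub>z\<close>, \<open>w = x s > x\<close>, carried out on the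
  coefficient polynomials.
\<close>

lemma kl_family_step:
  assumes w: "w \<in> W" and a: "\<alpha> \<in> \<Delta>" and less: "\<l> (w \<circ> \<sigma> \<alpha>) < \<l> w"
    and K: "\<And>z. z \<in> W \<Longrightarrow> \<l> z < \<l> w \<Longrightarrow> is_kl_family R z (K z)"
    and inv: "\<And>z y. z \<in> W \<Longrightarrow> \<l> z < \<l> w \<Longrightarrow> \<l> (z \<circ> \<sigma> \<alpha>) < \<l> z \<Longrightarrow> K z (y \<circ> \<sigma> \<alpha>) = K z y"
  shows "\<exists>P. is_kl_family R w P \<and> (\<forall>y. P (y \<circ> \<sigma> \<alpha>) = P y)"
proof -
  have ra: "\<alpha> \<in> \<Phi>" using a simple_root by blast
  define x where "x = w \<circ> \<sigma> \<alpha>"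
  have x: "x \<in> W" "x \<circ> \<sigma> \<alpha> = w" using w a ra by (simp_all add: x_def)
  have xlt: "\<l> x < \<l> w" using less by (simp add: x_def)
  have lw: "\<l> w = \<l> x + 1" using len_comp_simple_le[OF x(1) a] x(2) xlt by simp
  have Kx: "is_kl_family R x (K x)" using K[OF x(1) xlt] .
  have bxw: "bruhat_le R x w" using bruhat_simple_up[OF x(1) a] x(2) xlt by simp
  \<comment> \<open>Coefficients of C'_x C'_s after removing v^(-l(w)): both members of a pair {y,
    ys} receive K x (lower) + q K x (upper), so the symmetry under s is built in.\<close>
  define Q where "Q = (\<lambda>y. if \<l> (y \<circ> \<sigma> \<alpha>) < \<l> y then K x (y \<circ> \<sigma> \<alpha>) + monom 1 1 * K x y
     else K x y + monom 1 1 * K x (y \<circ> \<sigma> \<alpha>))"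
  \<comment> \<open>Only z with zs < z are subtracted, which preserves the symmetry. The parity
    makes (l(x) - l(z) - 1)/2 an exact half; for z not below x the coefficient \<mu>
    vanishes.\<close>
  define Z where "Z = {z \<in> W. \<l> z < \<l> x \<and> \<l> (z \<circ> \<sigma> \<alpha>) < \<l> z \<and> odd (\<l> x - \<l> z)}"
  \<comment> \<open>The Kazhdan-Lusztig \<mu>(z, x): the coefficient at the largest degree that the
    bound permits.\<close>
  define \<mu> where "\<mu> = (\<lambda>z. coeff (K x z) ((\<l> x - \<l> z - 1) div 2))"
  \<comment> \<open>The factor q^k turns the normalization v^(-l(w)) into v^(-l(z)); the division is
    exact because l(w) - l(z) is even.\<close>
  define k where "k = (\<lambda>z. (\<l> w - \<l> z) div 2)"
  define P where "P = (\<lambda>y. Q y - (\<Sum>z\<in>Z. smult (\<mu> z) (monom 1 (k z) * K z y)))"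
  have Z: "z \<in> W" "\<l> z < \<l> w" "is_kl_family R z (K z)" "K z (y \<circ> \<sigma> \<alpha>) = K z y" "2 * k z = \<l> w - \<l> z"
    if "z \<in> Z" for z y
  proof -
    show z: "z \<in> W" "\<l> z < \<l> w" using that lw by (auto simp: Z_def)
    show "is_kl_family R z (K z)" "K z (y \<circ> \<sigma> \<alpha>) = K z y" using that z K inv by (auto simp: Z_def)
    have "even (\<l> w - \<l> z)" using that lw by (auto simp: Z_def)
    then show "2 * k z = \<l> w - \<l> z" by (simp add: k_def)
  qed
  have finZ: "finite Z" by (simp add: Z_def)
  have supp: "bruhat_le R y z" if "is_kl_family R z F" "F y \<noteq> 0" for y z F
    using that by (auto simp: is_kl_family_def)
  have Kout: "K x y = 0" if "y \<notin> W" for y using that supp[OF Kx] bruhat_weyl(1) by blast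
  have Qinv: "Q (y \<circ> \<sigma> \<alpha>) = Q y" for y
  proof (cases "y \<in> W")
    case True
    have "(y \<circ> \<sigma> \<alpha>) \<circ> \<sigma> \<alpha> = y" using ra by simp
    then show ?thesis using len_cases_simple(1)[OF True a] unfolding Q_def by auto
  next
    case False
    moreover have "y \<circ> \<sigma> \<alpha> \<notin> W" "y \<circ> \<sigma> \<alpha> \<circ> \<sigma> \<alpha> = y" using False a ra by simp_all
    ultimately show ?thesis unfolding Q_def by (simp add: Kout)
  qed
  have Pinv: "P (y \<circ> \<sigma> \<alpha>) = P y" for y unfolding P_def Qinv using Z(4) by simp
  have Kself: "K x x = 1" using Kx by (simp add: is_kl_family_def)
  have Kw: "K x w = 0" using supp[OF Kx, of w] bruhat_len[of w x] xlt by force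
  have Zw: "K z w = 0" if "z \<in> Z" for z
    using supp[OF Z(3)[OF that], of w] bruhat_len[of w z] Z(2)[OF that] by force
  have Pw: "P w = 1" using less by (simp add: P_def Q_def x_def[symmetric] Kself Kw Zw)
  have Psupp: "P y = 0" if y: "\<not> bruhat_le R y w" for y
  proof -
    have "K x y = 0" using supp[OF Kx] y bruhat_trans[OF _ bxw] by blast
    moreover have "K x (y \<circ> \<sigma> \<alpha>) = 0"
    proof (rule ccontr)
      assume "K x (y \<circ> \<sigma> \<alpha>) \<noteq> 0"
      then have "bruhat_le R (y \<circ> \<sigma> \<alpha> \<circ> \<sigma> \<alpha>) (x \<circ> \<sigma> \<alpha>)"
        using bruhat_lift_up[OF supp[OF Kx] a] x(2) xlt by simp
      then show False using y x ra by simp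
    qed
    ultimately have "Q y = 0" by (simp add: Q_def)
    moreover have "smult (\<mu> z) (monom 1 (k z) * K z y) = 0" if z: "z \<in> Z" for z
    proof (cases "\<mu> z = 0")
      case False
      then have "K x z \<noteq> 0" unfolding \<mu>_def by (metis coeff_0)
      then have "bruhat_le R z x" by (rule supp[OF Kx])
      then have "\<not> bruhat_le R y z" using y bxw bruhat_trans by blast
      then show ?thesis using supp[OF Z(3)[OF z]] by auto
    qed simp
    ultimately show ?thesis unfolding P_def by (subst sum.neutral) auto
  qed
  \<comment> \<open>The degree bound is phrased through vanishing coefficients, which are additive
    over the sum defining P.\<close>
  have coeff0: "coeff (P y) n = 0" if y: "\<l> y < \<l> w" "y \<in> W" and n: "\<l> w < 2 * n + 1 + \<l> y" for y n
  proof -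
    have trm: "coeff (smult (\<mu> z) (monom 1 (k z) * K z y)) n = (if z = y then (if n = k y then \<mu> y else 0) else 0)"
      if z: "z \<in> Z" for z
    proof (cases "z = y")
      case True
      have "K y y = 1" using Z(3)[OF z] True by (simp add: is_kl_family_def)
      then show ?thesis using True by (simp add: coeff_monom_mult)
    next
      case False
      have "coeff (K z y) (n - k z) = 0" if "k z \<le> n"
        using kl_family_coeff_zero[OF Z(3)[OF z], of y "n - k z"] False Z(2,5)[OF z] n that by simp
      then show ?thesis using False by (simp add: coeff_monom_mult)
    qed
    have "coeff (\<Sum>z\<in>Z. smult (\<mu> z) (monom 1 (k z) * K z y)) n =
        (\<Sum>z\<in>Z. if z = y then (if n = k y then \<mu> y else 0) else 0)"
      unfolding coeff_sum by (intro sum.cong refl trm)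
    also have "\<dots> = (if y \<in> Z \<and> n = k y then \<mu> y else 0)" using finZ by simp
    finally have S: "coeff (P y) n = coeff (Q y) n - (if y \<in> Z \<and> n = k y then \<mu> y else 0)"
      by (simp add: P_def)
    have yw: "y \<noteq> w" using y by auto
    then have ysx: "y \<circ> \<sigma> \<alpha> \<noteq> x" using x ra by (metis comp_reflection_reflection)
    note K0 = kl_family_coeff_zero[OF Kx]
    show ?thesis
    proof (cases "\<l> (y \<circ> \<sigma> \<alpha>) < \<l> y")
      case True
      have ly: "\<l> y = \<l> (y \<circ> \<sigma> \<alpha>) + 1"
        using True len_comp_simple[OF y(2) a] by (simp split: if_splits)
      have yx: "y \<noteq> x" using True x(2) xlt by auto
      have c1: "coeff (K x (y \<circ> \<sigma> \<alpha>)) n = 0" using K0[OF ysx] n lw ly by simp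
      have Qn: "coeff (Q y) n = (if n = 0 then 0 else coeff (K x y) (n - 1))"
        using True c1 by (simp add: Q_def coeff_monom_mult)
      show ?thesis
      \<comment> \<open>The only way for Q to violate the bound: q K x y reaches degree n exactly
        when K x y attains its maximal degree. That coefficient is \<mu> y, and the term z = y of
        the correction cancels it.\<close>
      proof (cases "\<l> x + 1 = 2 * n + \<l> y")
        case eq: True
        then have n0: "n \<ge> 1" using y lw by linarith
        have d: "\<l> x - \<l> y = 2 * (n - 1) + 1" "\<l> y < \<l> x" using eq n0 by linarith+
        then have "odd (\<l> x - \<l> y)" by (simp only: odd_two_times_div_two_succ even_plus_one_iff even_mult_iff) simp
        then have "y \<in> Z" using y True d unfolding Z_def by blast
        moreover have "n = k y" using eq lw by (simp add: k_def)
        moreover have "(\<l> x - \<l> y - 1) div 2 = n - 1" unfolding d(1) by simp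
        then have "\<mu> y = coeff (K x y) (n - 1)" by (simp only: \<mu>_def)
        ultimately show ?thesis using S Qn n0 by simp
      next
        case False
        have "coeff (Q y) n = 0"
        proof (cases "n = 0")
          case False
          then have "\<l> x < 2 * (n - 1) + 1 + \<l> y" using n lw \<open>\<l> x + 1 \<noteq> 2 * n + \<l> y\<close> by linarith
          then show ?thesis using Qn K0[OF yx] by simp
        qed (use Qn in simp)
        moreover have "\<not> (y \<in> Z \<and> n = k y)" using Z(5)[of y] Z(2)[of y] False lw by auto
        ultimately show ?thesis using S by auto
      qed
    next
      case False
      then have ly: "\<l> (y \<circ> \<sigma> \<alpha>) = \<l> y + 1"
        using len_comp_simple[OF y(2) a] by (simp split: if_splits)
      have "coeff (K x y) n = 0"
      proof (cases "y = x")
        case True then show ?thesis using n lw Kself by auto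
      next
        case False then show ?thesis using K0[OF False] n lw by simp
      qed
      moreover have "coeff (K x (y \<circ> \<sigma> \<alpha>)) (n - 1) = 0" if "n \<ge> 1" using K0[OF ysx] n lw ly that by simp
      ultimately have "coeff (Q y) n = 0" using False by (simp add: Q_def coeff_monom_mult)
      moreover have "y \<notin> Z" using False by (simp add: Z_def)
      ultimately show ?thesis using S by simp
    qed
  qed
  have Pdeg: "2 * degree (P y) + 1 + \<l> y \<le> \<l> w" if y: "bruhat_le R y w" "y \<noteq> w" for y
  proof -
    have ly: "\<l> y < \<l> w" "y \<in> W" using y bruhat_len bruhat_weyl by blast+
    show ?thesis
    proof (cases "P y = 0")
      case True then show ?thesis using ly by simp
    next
      case False
      then have "coeff (P y) (degree (P y)) \<noteq> 0" by simp
      then show ?thesis using coeff0[OF ly, of "degree (P y)"] by linarith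
    qed
  qed
  have Pel: "kl_element R w P y =
      vpow (- 1) * hecke_kappa \<alpha> (kl_element R x (K x)) y - (\<Sum>z\<in>Z. of_int (\<mu> z) * kl_element R z (K z) y)" for y
  proof -
    have "vpow (- int (\<l> w)) * eval_q (smult (\<mu> z) (monom 1 (k z) * K z y)) =
        of_int (\<mu> z) * kl_element R z (K z) y" if z: "z \<in> Z" for z
    proof -
      have e: "- int (\<l> w) + 2 * int (k z) = - int (\<l> z)" using Z(2,5)[OF z] by linarith
      have "vpow (- int (\<l> w)) * eval_q (smult (\<mu> z) (monom 1 (k z) * K z y)) =
          of_int (\<mu> z) * (vpow (- int (\<l> w)) * (vpow (2 * int (k z)) * eval_q (K z y)))"
        by (simp only: eval_q_smult eval_q_monom_mult mult.left_commute)
      also have "\<dots> = of_int (\<mu> z) * kl_element R z (K z) y"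
        by (simp only: vpow_mult_assoc e kl_element_apply)
      finally show ?thesis .
    qed
    then have 1: "vpow (- int (\<l> w)) * eval_q (\<Sum>z\<in>Z. smult (\<mu> z) (monom 1 (k z) * K z y)) =
        (\<Sum>z\<in>Z. of_int (\<mu> z) * kl_element R z (K z) y)"
      by (simp add: eval_q_sum sum_distrib_left)
    have e: "- int (\<l> w) = - 1 + - int (\<l> x)" using lw by simp
    have m1: "eval_q (monom 1 1 * p) = vpow 2 * eval_q p" for p
      using eval_q_monom_mult[of 1 p] by simp
    have 2: "vpow (- int (\<l> w)) * eval_q (Q y) = vpow (- 1) * hecke_kappa \<alpha> (kl_element R x (K x)) y"
      unfolding e vpow_mult[symmetric] hecke_kappa_apply kl_element_apply Q_def
      by (simp add: eval_q_add m1 mult.left_commute[of "vpow 2"] distrib_left mult.assoc del: One_nat_def)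
    show ?thesis
      unfolding kl_element_apply[of w] P_def eval_q_diff right_diff_distrib 1 2 ..
  qed
  have "hecke_bar R (kl_element R w P) y = kl_element R w P y" for y
  proof -
    have "hecke_bar R (kl_element R w P) y = vpow (- (- 1)) * hecke_bar R (hecke_kappa \<alpha> (kl_element R x (K x))) y
       - (\<Sum>z\<in>Z. of_int (\<mu> z) * hecke_bar R (kl_element R z (K z)) y)"
      by (rule hecke_bar_comb[OF Pel])
    also have "(\<Sum>z\<in>Z. of_int (\<mu> z) * hecke_bar R (kl_element R z (K z)) y) =
        (\<Sum>z\<in>Z. of_int (\<mu> z) * kl_element R z (K z) y)"
      using Z(3) by (intro sum.cong refl) (simp add: is_kl_family_def)
    also have "vpow (- (- 1)) * hecke_bar R (hecke_kappa \<alpha> (kl_element R x (K x))) y =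
        vpow (- 1) * hecke_kappa \<alpha> (hecke_bar R (kl_element R x (K x))) y"
      unfolding hecke_bar_kappa[OF a] vpow_mult_assoc by simp
    also have "hecke_bar R (kl_element R x (K x)) = kl_element R x (K x)"
      using Kx by (simp add: is_kl_family_def)
    also note Pel[of y, symmetric]
    finally show ?thesis .
  qed
  then have "is_kl_family R w P"
    unfolding is_kl_family_def using Pw Psupp Pdeg by blast
  with Pinv show ?thesis by blast
qed

lemma kl_family_id: "is_kl_family R id (\<lambda>y. if y = id then 1 else 0)"
proof -
  let ?P = "\<lambda>y :: 'n weyl_elt. if y = id then 1 else 0 :: int poly"
  have e: "kl_element R id ?P = hecke_T id"
    by (auto simp: kl_element_apply hecke_T_def fun_eq_iff)
  have "hecke_bar R (hecke_T id) x = hecke_T id x" for x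
  proof -
    have "hecke_bar R (hecke_T id) x = (\<Sum>w\<in>W. if w = id then bar_T id x else 0)"
      unfolding hecke_bar_def by (intro sum.cong refl) (auto simp: hecke_T_def)
    then show ?thesis by simp
  qed
  then have "hecke_bar R (kl_element R id ?P) = kl_element R id ?P" unfolding e by blast
  moreover have "y = id" if "bruhat_le R y id" for y using bruhat_len[OF that] by simp
  ultimately show ?thesis
    unfolding is_kl_family_def using bruhat_refl[OF weyl_id] by auto
qed

text \<open>For each descent of w, \<open>kl_family_step\<close> builds a family symmetric under it.
  By uniqueness these are all the same family, so the polynomials of w have every symmetry.\<close>

lemma kl_poly_props:
  assumes "w \<in> W"
  shows "is_kl_family R w (\<lambda>y. kl_poly R y w)"
    "\<alpha> \<in> descents R w \<Longrightarrow> kl_poly R (y \<circ> \<sigma> \<alpha>) w = kl_poly R y w"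
proof -
  have "is_kl_family R w (\<lambda>y. kl_poly R y w) \<and>
      (\<forall>\<alpha>\<in>\<Delta>. \<forall>y. \<l> (w \<circ> \<sigma> \<alpha>) < \<l> w \<longrightarrow> kl_poly R (y \<circ> \<sigma> \<alpha>) w = kl_poly R y w)"
    using assms
  proof (induction "\<l> w" arbitrary: w rule: less_induct)
    case less
    have ex: "\<exists>P. is_kl_family R w P \<and> (\<forall>y. P (y \<circ> \<sigma> \<alpha>) = P y)" if "\<alpha> \<in> \<Delta>" "\<l> (w \<circ> \<sigma> \<alpha>) < \<l> w" for \<alpha>
    proof (rule kl_family_step[OF less.prems that, where K = "\<lambda>z y. kl_poly R y z"])
      fix z assume z: "z \<in> W" "\<l> z < \<l> w"
      show "is_kl_family R z (\<lambda>y. kl_poly R y z)" using less.hyps[OF z(2,1)] by blast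
      show "kl_poly R (y \<circ> \<sigma> \<alpha>) z = kl_poly R y z" if "\<l> (z \<circ> \<sigma> \<alpha>) < \<l> z" for y
        using less.hyps[OF z(2,1)] \<open>\<alpha> \<in> \<Delta>\<close> that by blast
    qed
    have "\<exists>P. is_kl_family R w P"
    proof (cases "w = id")
      case True then show ?thesis using kl_family_id by blast
    next
      case False
      then show ?thesis using ex right_descent_exists[OF less.prems] by metis
    qed
    then obtain P where P: "is_kl_family R w P" by blast
    note eq = kl_poly_family[OF P]
    show ?case
    proof (intro conjI ballI allI impI)
      show "is_kl_family R w (\<lambda>y. kl_poly R y w)" using P eq by simp
    next
      fix \<alpha> y assume "\<alpha> \<in> \<Delta>" "\<l> (w \<circ> \<sigma> \<alpha>) < \<l> w"
      from ex[OF this] obtain P' where P': "is_kl_family R w P'" "\<And>y. P' (y \<circ> \<sigma> \<alpha>) = P' y" by blast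
      show "kl_poly R (y \<circ> \<sigma> \<alpha>) w = kl_poly R y w"
        using P'(2)[of y] fun_cong[OF kl_poly_family[OF P'(1)]] by metis
    qed
  qed
  then show "is_kl_family R w (\<lambda>y. kl_poly R y w)"
    "\<alpha> \<in> descents R w \<Longrightarrow> kl_poly R (y \<circ> \<sigma> \<alpha>) w = kl_poly R y w"
    by (auto simp: descents_def)
qed

lemma kl_basis_eq:
  assumes "w \<in> W"
  shows "kl_basis R w y = poly (kl_poly R y w) 1"
  using kl_poly_props(1)[OF assms] by (auto simp: kl_basis_def is_kl_family_def)

lemma kl_basis_self: "w \<in> W \<Longrightarrow> kl_basis R w w = 1"
  using kl_poly_props(1)[of w] by (simp add: kl_basis_eq is_kl_family_def)

lemma kl_basis_nonzero: "kl_basis R w y \<noteq> 0 \<Longrightarrow> y = w \<or> \<l> y < \<l> w"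
  using bruhat_len by (auto simp: kl_basis_def split: if_splits)

lemma kl_basis_right_invariant:
  "w \<in> W \<Longrightarrow> \<alpha> \<in> descents R w \<Longrightarrow> kl_basis R w (y \<circ> \<sigma> \<alpha>) = kl_basis R w y"
  by (simp add: kl_basis_eq kl_poly_props(2))

section \<open>Left cells and descents\<close>

lemma weyl_ring_mult_right_invariant:
  assumes \<alpha>: "\<alpha> \<in> \<Delta>" and b: "\<And>y. b (y \<circ> \<sigma> \<alpha>) = b y"
  shows "weyl_ring_mult R a b (x \<circ> \<sigma> \<alpha>) = weyl_ring_mult R a b x"
proof -
  have ra: "\<alpha> \<in> \<Phi>" using \<alpha> simple_root by blast
  have "(\<Sum>z\<in>W. if y \<circ> z = x \<circ> \<sigma> \<alpha> then a y * b z else 0) = (\<Sum>z\<in>W. if y \<circ> z = x then a y * b z else 0)" for y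
  proof (rule sum.reindex_bij_witness[of _ "\<lambda>z. z \<circ> \<sigma> \<alpha>" "\<lambda>z. z \<circ> \<sigma> \<alpha>"])
    fix z assume z: "z \<in> W"
    have "y \<circ> (z \<circ> \<sigma> \<alpha>) = x \<longleftrightarrow> y \<circ> z = x \<circ> \<sigma> \<alpha>"
      using comp_reflection_reflection[OF ra] by (metis comp_assoc)
    then show "(if y \<circ> (z \<circ> \<sigma> \<alpha>) = x then a y * b (z \<circ> \<sigma> \<alpha>) else 0) =
        (if y \<circ> z = x \<circ> \<sigma> \<alpha> then a y * b z else 0)" by (simp only: b)
  qed (use ra \<alpha> in simp_all)
  then show ?thesis by (simp add: weyl_ring_mult_def)
qed

text \<open>Take y of maximal length among the indices with nonzero coefficient and without the
  descent \<alpha>. Comparing values at y and at y s_\<alpha>, the invariant terms cancel, and by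
  length the others contribute only c y, at y. The argument applies to any expansion, as the
  existential in \<open>occurs_in\<close> demands.\<close>

lemma kl_expansion_right_invariant:
  assumes \<alpha>: "\<alpha> \<in> \<Delta>" and a: "\<And>u. a u = (\<Sum>z\<in>W. c z * kl_basis R z u)"
    and inv: "\<And>u. a (u \<circ> \<sigma> \<alpha>) = a u" and x: "x \<in> W" "c x \<noteq> 0"
  shows "\<alpha> \<in> descents R x"
proof (rule ccontr)
  assume xa: "\<alpha> \<notin> descents R x"
  have ra: "\<alpha> \<in> \<Phi>" using \<alpha> simple_root by blast
  define Y where "Y = {z \<in> W. c z \<noteq> 0 \<and> \<alpha> \<notin> descents R z}"
  have fY: "finite Y" "Y \<noteq> {}" using xa x by (auto simp: Y_def)
  have "Max (\<l> ` Y) \<in> \<l> ` Y" using fY by (intro Max_in) auto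
  then obtain y where y: "y \<in> Y" "\<l> y = Max (\<l> ` Y)" by force
  have mx: "\<l> z \<le> \<l> y" if "z \<in> Y" for z using that fY y(2) by simp
  have yW: "y \<in> W" "c y \<noteq> 0" "\<alpha> \<notin> descents R y" using y by (auto simp: Y_def)
  have up: "\<l> y < \<l> (y \<circ> \<sigma> \<alpha>)"
    using yW \<alpha> len_cases_simple(1)[OF yW(1) \<alpha>] by (auto simp: descents_def)
  have t: "c z * kl_basis R z (y \<circ> \<sigma> \<alpha>) = c z * kl_basis R z y - (if z = y then c y else 0)" if z: "z \<in> W" for z
  proof (cases "z \<in> Y")
    case False
    then have "z \<noteq> y" "c z = 0 \<or> \<alpha> \<in> descents R z" using y z by (auto simp: Y_def)
    then show ?thesis using kl_basis_right_invariant[OF z] by auto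
  next
    case True
    have lz: "\<l> z \<le> \<l> y" using mx[OF True] .
    have 1: "kl_basis R z (y \<circ> \<sigma> \<alpha>) = 0"
      using kl_basis_nonzero[of z "y \<circ> \<sigma> \<alpha>"] lz up by (metis less_le_trans less_irrefl less_trans)
    have 2: "kl_basis R z y = (if z = y then 1 else 0)"
      using kl_basis_nonzero[of z y] lz kl_basis_self[OF yW(1)] by auto
    show ?thesis unfolding 1 2 by simp
  qed
  have "a (y \<circ> \<sigma> \<alpha>) = (\<Sum>z\<in>W. c z * kl_basis R z y - (if z = y then c y else 0))"
    unfolding a by (intro sum.cong refl t)
  also have "\<dots> = a y - c y" using yW by (simp add: sum_subtractf a)
  finally show False using inv[of y] yW by simp
qed

text \<open>Left multiplication preserves right invariance, so every term of C'_s C'_y inherits the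
  right descents of y. Applied in both directions this makes descent sets constant on left
  cells.\<close>

lemma descents_left_le:
  assumes "left_le R x y"
  shows "descents R y \<subseteq> descents R x"
  using assms unfolding left_le_def
proof (induction rule: converse_rtranclp_induct)
  case (step u v)
  then obtain \<beta> c where u: "u \<in> W" "v \<in> W" "c u \<noteq> 0"
    and c: "\<And>t. weyl_ring_mult R (kl_basis R (\<sigma> \<beta>)) (kl_basis R v) t = (\<Sum>z\<in>W. c z * kl_basis R z t)"
    by (auto simp: occurs_in_def)
  have "descents R v \<subseteq> descents R u"
  proof
    fix \<alpha> assume a: "\<alpha> \<in> descents R v"
    then have ad: "\<alpha> \<in> \<Delta>" using descents_simples by blast
    show "\<alpha> \<in> descents R u"
    proof (rule kl_expansion_right_invariant[where a = "weyl_ring_mult R (kl_basis R (\<sigma> \<beta>)) (kl_basis R v)"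
          and c = c and \<alpha> = \<alpha> and x = u, OF ad c _ u(1,3)])
      show "weyl_ring_mult R (kl_basis R (\<sigma> \<beta>)) (kl_basis R v) (t \<circ> \<sigma> \<alpha>) =
          weyl_ring_mult R (kl_basis R (\<sigma> \<beta>)) (kl_basis R v) t" for t
        by (rule weyl_ring_mult_right_invariant[where b = "kl_basis R v", OF ad])
          (rule kl_basis_right_invariant[OF u(2) a])
    qed
  qed
  with step.IH show ?case by blast
qed simp

lemma duflo_props:
  assumes "w \<in> W"
  shows "duflo R w \<in> W" "descents R (duflo R w) = descents R w"
proof -
  have "finite (left_cell R w)" by (simp add: left_cell_def)
  moreover have "left_cell R w \<noteq> {}"
    using assms by (auto simp: left_cell_def left_le_def)
  ultimately have "duflo R w \<in> left_cell R w"
    unfolding duflo_def by (rule arg_min_if_finite(1))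
  then show "duflo R w \<in> W" "descents R (duflo R w) = descents R w"
    using descents_left_le by (auto simp: left_cell_def)
qed

section \<open>Weights\<close>

text \<open>A W-invariant form that is integer-valued by construction. Invariance holds because
  coreflections permute the coroots, definiteness because the coroots generate the cocharacter
  lattice.\<close>

definition ip :: "int ^ 'n \<Rightarrow> int ^ 'n \<Rightarrow> int" where
  "ip x y = (\<Sum>\<kappa>\<in>coroot R ` \<Phi>. pairing x \<kappa> * pairing y \<kappa>)"

lemma ip_commute: "ip x y = ip y x"
  by (simp add: ip_def mult.commute)

lemma ip_add_right: "ip x (y + z) = ip x y + ip x z"
  by (simp add: ip_def pairing_simps algebra_simps sum.distrib)

lemma ip_diff_right: "ip x (y - z) = ip x y - ip x z"
  by (simp add: ip_def pairing_simps algebra_simps sum_subtractf)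

lemma ip_smult_right: "ip x (c *s y) = c * ip x y"
  by (simp add: ip_def pairing_simps algebra_simps sum_distrib_left)

lemma ip_uminus_right: "ip x (- y) = - ip x y"
  by (simp add: ip_def pairing_simps sum_negf)

lemma ip_add_left: "ip (x + y) z = ip x z + ip y z"
  and ip_diff_left: "ip (x - y) z = ip x z - ip y z"
  and ip_smult_left: "ip (c *s x) z = c * ip x z"
  by (simp_all add: ip_commute[of _ z] ip_add_right ip_diff_right ip_smult_right)

lemma ip_sum_right: "ip x (\<Sum>i\<in>A. f i) = (\<Sum>i\<in>A. ip x (f i))"
  by (induction A rule: infinite_finite_induct) (simp_all add: ip_add_right, simp_all add: ip_def pairing_zero_left)

lemma ip_reflection:
  assumes "\<alpha> \<in> \<Phi>"
  shows "ip (\<sigma> \<alpha> x) (\<sigma> \<alpha> y) = ip x y"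
  unfolding ip_def pairing_reflection
  by (rule sum.reindex_bij_witness[of _ "coreflection R \<alpha>" "coreflection R \<alpha>"])
    (use assms coreflection_coroot in \<open>auto simp: coreflection_coreflection\<close>)

lemma ip_weyl:
  assumes "w \<in> W"
  shows "ip (w x) (w y) = ip x y"
proof -
  have "ip (refl_word R as x) (refl_word R as y) = ip x y" if "set as \<subseteq> \<Delta>" for as
    using that by (induction as) (simp_all add: ip_reflection simple_root)
  then show ?thesis using assms by (auto simp: weyl_word)
qed

lemma ip_root:
  assumes "\<alpha> \<in> \<Phi>"
  shows "2 * ip x \<alpha> = pairing x (coroot R \<alpha>) * ip \<alpha> \<alpha>"
  using ip_reflection[OF assms, of x \<alpha>] assms
  by (simp add: reflection_self ip_uminus_right reflection_def[of R \<alpha> x] ip_diff_left ip_smult_left)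

lemma ip_nonneg: "ip x x \<ge> 0"
  unfolding ip_def by (intro sum_nonneg) simp

lemma ip_root_pos:
  assumes "\<alpha> \<in> \<Phi>"
  shows "ip \<alpha> \<alpha> > 0"
proof -
  have "0 < pairing \<alpha> (coroot R \<alpha>) * pairing \<alpha> (coroot R \<alpha>)" using assms by (simp add: pairing_coroot)
  also have "\<dots> \<le> ip \<alpha> \<alpha>" unfolding ip_def
    by (rule member_le_sum[where f = "\<lambda>\<kappa>. pairing \<alpha> \<kappa> * pairing \<alpha> \<kappa>"]) (use assms in auto)
  finally show ?thesis .
qed

lemma pairing_coroots_zero:
  assumes "\<And>\<beta>. \<beta> \<in> \<Phi> \<Longrightarrow> pairing x (coroot R \<beta>) = 0"
  shows "x = 0"
proof (rule pairing_eq_zeroI)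
  fix \<kappa> :: "int ^ 'n"
  obtain c where "\<kappa> = (\<Sum>\<alpha>\<in>\<Phi>. c \<alpha> *s coroot R \<alpha>)"
    using simply_connected unfolding is_simply_connected_def by blast
  then show "pairing x \<kappa> = 0" using assms by (simp add: pairing_sum_right pairing_simps)
qed

lemma ip_definite: "ip x x = 0 \<Longrightarrow> x = 0"
  unfolding ip_def by (rule pairing_coroots_zero) (subst (asm) sum_nonneg_eq_0_iff; auto)

text \<open>Simple connectedness speaks of all coroots. Each root is W-conjugate to a simple one,
  and by \<open>coroot_reflection\<close> every reflection in a word alters a coroot by an integral
  multiple of a simple coroot.\<close>

lemma simple_coroots_span: "\<exists>c. \<kappa> = (\<Sum>\<alpha>\<in>\<Delta>. c \<alpha> *s coroot R \<alpha>)"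
proof -
  define S where "S = {\<Sum>\<alpha>\<in>\<Delta>. c \<alpha> *s coroot R \<alpha> | c. True}"
  have SI: "(\<Sum>\<alpha>\<in>\<Delta>. c \<alpha> *s coroot R \<alpha>) \<in> S" for c by (auto simp: S_def)
  have add: "x + y \<in> S" if xs: "x \<in> S" and ys: "y \<in> S" for x y
  proof -
    obtain c where "x = (\<Sum>\<alpha>\<in>\<Delta>. c \<alpha> *s coroot R \<alpha>)" using xs unfolding S_def by blast
    moreover obtain d where "y = (\<Sum>\<alpha>\<in>\<Delta>. d \<alpha> *s coroot R \<alpha>)" using ys unfolding S_def by blast
    ultimately have "x + y = (\<Sum>\<alpha>\<in>\<Delta>. (c \<alpha> + d \<alpha>) *s coroot R \<alpha>)"
      by (simp only: vector_sadd_rdistrib sum.distrib)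
    then show ?thesis by (simp only: SI)
  qed
  have smult: "m *s x \<in> S" if xs: "x \<in> S" for x m
  proof -
    obtain c where "x = (\<Sum>\<alpha>\<in>\<Delta>. c \<alpha> *s coroot R \<alpha>)" using xs unfolding S_def by blast
    then have "m *s x = (\<Sum>\<alpha>\<in>\<Delta>. (m * c \<alpha>) *s coroot R \<alpha>)"
      by (simp add: vec_eq_iff sum_distrib_left mult.assoc)
    then show ?thesis by (simp only: SI)
  qed
  have simple: "coroot R \<alpha> \<in> S" if "\<alpha> \<in> \<Delta>" for \<alpha>
  proof -
    have "(\<Sum>x\<in>\<Delta>. (if x = \<alpha> then 1 else 0) *s coroot R x) = coroot R \<alpha>"
      using that by (simp add: if_distrib[of "\<lambda>c. c *s _"] cong: if_cong)
    then show ?thesis using SI[of "\<lambda>x. if x = \<alpha> then 1 else 0"] by simp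
  qed
  have word: "coroot R (refl_word R as \<alpha>) \<in> S" if "set as \<subseteq> \<Delta>" "\<alpha> \<in> \<Delta>" for as \<alpha>
    using that(1)
  proof (induction as)
    case (Cons a as)
    let ?b = "refl_word R as \<alpha>"
    have b: "?b \<in> \<Phi>" "a \<in> \<Phi>" using Cons.prems that simple_root by (auto intro!: refl_word_root)
    have "coroot R (refl_word R (a # as) \<alpha>) = coroot R ?b + (- pairing a (coroot R ?b)) *s coroot R a"
      using coroot_reflection[OF b(2,1)] by (simp add: coreflection_def vec_eq_iff)
    then show ?case using add[OF Cons.IH smult[OF simple]] Cons.prems by simp
  qed (use simple that in simp)
  have root: "coroot R \<beta> \<in> S" if "\<beta> \<in> \<Phi>" for \<beta>
    using pos_conj_simple[OF that] word by (metis weyl_word)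
  obtain c where "\<kappa> = (\<Sum>\<alpha>\<in>\<Phi>. c \<alpha> *s coroot R \<alpha>)"
    using simply_connected unfolding is_simply_connected_def by blast
  moreover have "(\<Sum>\<alpha>\<in>A. c \<alpha> *s coroot R \<alpha>) \<in> S" if "finite A" "A \<subseteq> \<Phi>" for A
    using that
  proof (induction A rule: finite_induct)
    case empty
    show ?case using SI[of "\<lambda>_. 0"] by simp
  qed (use add smult root in simp)
  ultimately have "\<kappa> \<in> S" by simp
  then show ?thesis unfolding S_def by blast
qed

lemma simple_coroots_independent:
  assumes c: "(\<Sum>\<alpha>\<in>\<Delta>. c \<alpha> *s coroot R \<alpha>) = 0" and a: "\<alpha> \<in> \<Delta>"
  shows "c \<alpha> = 0"
proof -
  \<comment> \<open>Through \<open>ip\<close> the coroot of \<alpha> corresponds to 2 \<alpha> /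
    (\<alpha>, \<alpha>). Multiplying by the product N of all norms clears denominators, with
    \<open>m \<alpha>\<close> equal to N / (\<alpha>, \<alpha>); the vanishing combination then
    becomes a vector y of norm 0.\<close>
  define m where "m = (\<lambda>\<alpha>. \<Prod>\<beta>\<in>\<Delta> - {\<alpha>}. ip \<beta> \<beta>)"
  define N where "N = (\<Prod>\<beta>\<in>\<Delta>. ip \<beta> \<beta>)"
  have m: "m \<beta> * ip \<beta> \<beta> = N" if "\<beta> \<in> \<Delta>" for \<beta>
    unfolding m_def N_def using that by (simp add: prod.remove[of \<Delta> \<beta>] mult.commute)
  have mpos: "m \<beta> > 0" for \<beta> unfolding m_def using ip_root_pos simple_root by (intro prod_pos) auto
  define y where "y = (\<Sum>\<alpha>\<in>\<Delta>. (c \<alpha> * m \<alpha>) *s \<alpha>)"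
  have "2 * ip y y = (\<Sum>\<alpha>\<in>\<Delta>. (c \<alpha> * m \<alpha>) * (2 * ip y \<alpha>))"
    by (subst (2) y_def) (simp add: ip_sum_right ip_smult_right sum_distrib_left algebra_simps)
  also have "\<dots> = (\<Sum>\<alpha>\<in>\<Delta>. c \<alpha> * pairing y (coroot R \<alpha>) * N)"
    by (intro sum.cong refl) (simp add: ip_root simple_root flip: m)
  also have "\<dots> = pairing y (\<Sum>\<alpha>\<in>\<Delta>. c \<alpha> *s coroot R \<alpha>) * N"
    by (simp add: pairing_sum_right pairing_simps sum_distrib_right)
  also have "\<dots> = 0" using c by (simp add: pairing_zero_right)
  finally have "y = 0" using ip_definite by simp
  then have "c \<alpha> * m \<alpha> = 0" using simples_independent[of "\<lambda>\<alpha>. c \<alpha> * m \<alpha>"] a by (simp add: y_def)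
  then show ?thesis using mpos[of \<alpha>] by simp
qed

lemma pairing_simple_coroots_zero:
  assumes "\<And>\<alpha>. \<alpha> \<in> \<Delta> \<Longrightarrow> pairing x (coroot R \<alpha>) = 0"
  shows "x = 0"
proof (rule pairing_eq_zeroI)
  fix \<kappa> :: "int ^ 'n"
  obtain c where "\<kappa> = (\<Sum>\<alpha>\<in>\<Delta>. c \<alpha> *s coroot R \<alpha>)" using simple_coroots_span by blast
  then show "pairing x \<kappa> = 0" using assms by (simp add: pairing_sum_right pairing_simps)
qed

text \<open>Simple coroots form a basis of the cocharacter lattice, so the dual basis consists of
  integral weights and the THE in \<open>fund_weight\<close> has a unique solution.\<close>

lemma pairing_fund_weight:
  assumes a: "\<alpha> \<in> \<Delta>" and b: "\<beta> \<in> \<Delta>"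
  shows "pairing (fund_weight R \<alpha>) (coroot R \<beta>) = (if \<beta> = \<alpha> then 1 else 0)"
proof -
  let ?P = "\<lambda>\<mu>. \<forall>\<beta>\<in>\<Delta>. pairing \<mu> (coroot R \<beta>) = (if \<beta> = \<alpha> then 1 else 0)"
  have "\<exists>c. \<forall>i. axis i 1 = (\<Sum>\<alpha>\<in>\<Delta>. c i \<alpha> *s coroot R \<alpha>)"
    by (intro choice allI simple_coroots_span)
  then obtain c where c: "\<And>i. axis i 1 = (\<Sum>\<alpha>\<in>\<Delta>. c i \<alpha> *s coroot R \<alpha>)" by blast
  \<comment> \<open>A coordinate of the weight is its pairing with a standard basis cocharacter,
    which must be the coefficient of the coroot of \<alpha> in that cocharacter.\<close>
  define \<mu> where "\<mu> = (\<chi> i. c i \<alpha>)"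
  have "pairing \<mu> (coroot R \<beta>) = (if \<beta> = \<alpha> then 1 else 0)" if b: "\<beta> \<in> \<Delta>" for \<beta>
  proof -
    let ?\<kappa> = "coroot R \<beta>"
    define e where "e = (\<lambda>\<gamma>. (\<Sum>i\<in>UNIV. ?\<kappa> $ i * c i \<gamma>) - (if \<gamma> = \<beta> then 1 else 0))"
    have "?\<kappa> = (\<Sum>i\<in>UNIV. ?\<kappa> $ i *s axis i 1)"
      by (simp add: vec_eq_iff axis_def if_distrib cong: if_cong)
    also have "\<dots> = (\<Sum>i\<in>UNIV. \<Sum>\<gamma>\<in>\<Delta>. (?\<kappa> $ i * c i \<gamma>) *s coroot R \<gamma>)"
      by (intro sum.cong refl, subst c) (simp add: vec_eq_iff sum_distrib_left mult.assoc)
    also have "\<dots> = (\<Sum>\<gamma>\<in>\<Delta>. (\<Sum>i\<in>UNIV. ?\<kappa> $ i * c i \<gamma>) *s coroot R \<gamma>)"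
      by (subst sum.swap) (simp add: vec_eq_iff sum_distrib_right)
    finally have k: "?\<kappa> = (\<Sum>\<gamma>\<in>\<Delta>. (\<Sum>i\<in>UNIV. ?\<kappa> $ i * c i \<gamma>) *s coroot R \<gamma>)" .
    have k': "(\<Sum>\<gamma>\<in>\<Delta>. (if \<gamma> = \<beta> then 1 else 0) *s coroot R \<gamma>) = ?\<kappa>"
      using b by (simp add: if_distrib[of "\<lambda>c. c *s _"] cong: if_cong)
    have "(\<Sum>\<gamma>\<in>\<Delta>. e \<gamma> *s coroot R \<gamma>) =
        (\<Sum>\<gamma>\<in>\<Delta>. (\<Sum>i\<in>UNIV. ?\<kappa> $ i * c i \<gamma>) *s coroot R \<gamma>) - (\<Sum>\<gamma>\<in>\<Delta>. (if \<gamma> = \<beta> then 1 else 0) *s coroot R \<gamma>)"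
      unfolding e_def sum_subtractf[symmetric]
      by (intro sum.cong refl) (simp add: vec_eq_iff left_diff_distrib)
    also have "\<dots> = 0" using k k' by simp
    finally have "e \<alpha> = 0" using simple_coroots_independent a by blast
    then show ?thesis by (auto simp: e_def pairing_def \<mu>_def mult.commute)
  qed
  then have ex: "?P \<mu>" by blast
  have "\<nu> = \<mu>" if "?P \<nu>" for \<nu>
  proof -
    have "\<nu> - \<mu> = 0" by (rule pairing_simple_coroots_zero) (use ex that in \<open>simp add: pairing_simps\<close>)
    then show ?thesis by simp
  qed
  with ex have "?P (fund_weight R \<alpha>)" unfolding fund_weight_def by (rule theI)
  then show ?thesis using b by blast
qed

lemma pairing_fund_sum:
  assumes "I \<subseteq> \<Delta>" "\<beta> \<in> \<Delta>"
  shows "pairing (fund_sum R I) (coroot R \<beta>) = (if \<beta> \<in> I then 1 else 0)"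
proof -
  have "pairing (fund_sum R I) (coroot R \<beta>) = (\<Sum>\<alpha>\<in>I. if \<beta> = \<alpha> then 1 else 0)"
    unfolding fund_sum_def pairing_sum_left using assms
    by (intro sum.cong refl pairing_fund_weight) auto
  then show ?thesis using finite_subset[OF assms(1)] by simp
qed

lemma pairing_rho: "\<beta> \<in> \<Delta> \<Longrightarrow> pairing (rho R) (coroot R \<beta>) = 1"
  by (simp add: rho_def pairing_fund_sum)

section \<open>Dominant representatives and extremal properties of \<rho>\<close>

lemma parabolic_fixes:
  assumes "J \<subseteq> \<Delta>" "w \<in> parabolic R J" "\<And>\<alpha>. \<alpha> \<in> J \<Longrightarrow> pairing x (coroot R \<alpha>) = 0"
  shows "w x = x"
proof -
  have "refl_word R as x = x" if "set as \<subseteq> J" for as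
    using that by (induction as) (simp_all add: reflection_def assms(3))
  then show ?thesis using assms(2) by (auto simp: parabolic_def)
qed

lemma ip_rho_simple_pos: "\<alpha> \<in> \<Delta> \<Longrightarrow> ip (rho R) \<alpha> > 0"
  using ip_root[of \<alpha> "rho R"] ip_root_pos[of \<alpha>] by (simp add: pairing_rho simple_root)

lemma ip_rho_pos:
  assumes "pos \<beta>"
  shows "ip (rho R) \<beta> > 0"
proof -
  obtain c where c: "\<forall>\<alpha>\<in>\<Delta>. c \<alpha> \<ge> 0" "\<beta> = (\<Sum>\<alpha>\<in>\<Delta>. c \<alpha> *s \<alpha>)" "\<beta> \<in> \<Phi>"
    using assms unfolding pos_def by blast
  have e: "ip (rho R) \<beta> = (\<Sum>\<alpha>\<in>\<Delta>. c \<alpha> * ip (rho R) \<alpha>)"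
    unfolding c(2) by (simp add: ip_sum_right ip_smult_right)
  have nn: "c \<alpha> * ip (rho R) \<alpha> \<ge> 0" if "\<alpha> \<in> \<Delta>" for \<alpha>
    using c(1) ip_rho_simple_pos[OF that] that by simp
  have "ip (rho R) \<beta> \<noteq> 0"
  proof
    assume "ip (rho R) \<beta> = 0"
    then have "\<forall>\<alpha>\<in>\<Delta>. c \<alpha> * ip (rho R) \<alpha> = 0"
      unfolding e using nn by (subst (asm) sum_nonneg_eq_0_iff) auto
    then have "\<forall>\<alpha>\<in>\<Delta>. c \<alpha> = 0" using ip_rho_simple_pos by fastforce
    then have "\<beta> = 0" unfolding c(2) by simp
    with c(3) root_nonzero show False by blast
  qed
  moreover have "ip (rho R) \<beta> \<ge> 0" unfolding e using nn by (rule sum_nonneg)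
  ultimately show ?thesis by simp
qed

text \<open>Choose z maximizing (\<rho>, z x) over the finite group: a negative pairing with a
  simple coroot in J would let that reflection increase the value.\<close>

lemma parabolic_dominant_conj:
  assumes J: "J \<subseteq> \<Delta>"
  obtains z where "z \<in> parabolic R J" "\<And>\<alpha>. \<alpha> \<in> J \<Longrightarrow> pairing (z x) (coroot R \<alpha>) \<ge> 0"
proof -
  let ?f = "\<lambda>z. ip (rho R) (z x)"
  have fin: "finite (parabolic R J)"
    using parabolic_weyl[OF J] finite_subset[OF _ finite_weyl] by blast
  have "Max (?f ` parabolic R J) \<in> ?f ` parabolic R J"
    using fin parabolic_id by (intro Max_in finite_imageI) blast+
  then obtain z where z: "z \<in> parabolic R J" "?f z = Max (?f ` parabolic R J)" by force
  have "pairing (z x) (coroot R \<alpha>) \<ge> 0" if a: "\<alpha> \<in> J" for \<alpha>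
  proof -
    have "\<sigma> \<alpha> \<circ> z \<in> parabolic R J" using z(1) a parabolic_reflection parabolic_comp by blast
    then have "?f (\<sigma> \<alpha> \<circ> z) \<le> ?f z" unfolding z(2) using fin by (intro Max_ge) blast+
    then have "pairing (z x) (coroot R \<alpha>) * ip (rho R) \<alpha> \<ge> 0"
      by (simp add: reflection_def ip_diff_right ip_smult_right)
    moreover have "ip (rho R) \<alpha> > 0" using a J ip_rho_simple_pos by blast
    ultimately show ?thesis by (simp add: zero_le_mult_iff)
  qed
  with z(1) show ?thesis using that by blast
qed

text \<open>Writing w = u s_\<alpha> with u shorter, w x is u x minus a nonnegative multiple of the
  positive root u \<alpha>. Equality forces that multiple to vanish at every stage.\<close>

lemma ip_rho_orbit:
  assumes d: "dominant R x" and "w \<in> W"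
  shows "ip (rho R) (w x) \<le> ip (rho R) x" "ip (rho R) (w x) = ip (rho R) x \<Longrightarrow> w x = x"
proof -
  have "ip (rho R) (w x) \<le> ip (rho R) x \<and> (ip (rho R) (w x) = ip (rho R) x \<longrightarrow> w x = x)"
    using assms(2)
  proof (induction "\<l> w" arbitrary: w rule: less_induct)
    case less
    show ?case
    proof (cases "w = id")
      case False
      then obtain \<alpha> where a: "\<alpha> \<in> \<Delta>" "\<l> (w \<circ> \<sigma> \<alpha>) < \<l> w" "\<not> pos (w \<alpha>)"
        using right_descent_exists less.prems by blast
      define u where "u = w \<circ> \<sigma> \<alpha>"
      have ra: "\<alpha> \<in> \<Phi>" using a simple_root by blast
      have u: "u \<in> W" "\<l> u < \<l> w" using a less.prems by (simp_all add: u_def)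
      have up: "pos (u \<alpha>)"
        using a less.prems ra by (simp add: u_def reflection_self pos_weyl_uminus)
      define k where "k = pairing x (coroot R \<alpha>)"
      have k: "k \<ge> 0" using d a by (simp add: k_def dominant_def)
      have "w x = u (\<sigma> \<alpha> x)" using ra by (simp add: u_def)
      also have "\<dots> = u x - k *s u \<alpha>" by (simp add: reflection_def weyl_diff[OF u(1)] weyl_smult[OF u(1)] k_def)
      finally have wx: "w x = u x - k *s u \<alpha>" .
      then have e: "ip (rho R) (w x) = ip (rho R) (u x) - k * ip (rho R) (u \<alpha>)"
        by (simp add: ip_diff_right ip_smult_right)
      have p: "ip (rho R) (u \<alpha>) > 0" using ip_rho_pos[OF up] .
      have kp: "k * ip (rho R) (u \<alpha>) \<ge> 0" using k p by simp
      have IH: "ip (rho R) (u x) \<le> ip (rho R) x" "ip (rho R) (u x) = ip (rho R) x \<Longrightarrow> u x = x"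
        using less.hyps[OF u(2,1)] by blast+
      have "w x = x" if "ip (rho R) (w x) = ip (rho R) x"
      proof -
        have "k * ip (rho R) (u \<alpha>) = 0" using that e IH(1) kp by linarith
        then have "k = 0" using p by simp
        then show ?thesis using wx IH(2) e that by simp
      qed
      then show ?thesis using e IH(1) kp by linarith
    qed simp
  qed
  then show "ip (rho R) (w x) \<le> ip (rho R) x" "ip (rho R) (w x) = ip (rho R) x \<Longrightarrow> w x = x" by blast+
qed

text \<open>Such a w preserves the products (\<rho>, \<alpha>) > 0, hence keeps all simple roots
  positive.\<close>

lemma rho_stabilizer:
  assumes "w \<in> W" "w (rho R) = rho R"
  shows "w = id"
proof (rule weyl_eq_id[OF assms(1)])
  fix \<alpha> assume a: "\<alpha> \<in> \<Delta>"
  have "ip (rho R) (w \<alpha>) = ip (rho R) \<alpha>" using ip_weyl[OF assms(1), of "rho R" \<alpha>] assms(2) by simp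
  then have "ip (rho R) (w \<alpha>) > 0" using ip_rho_simple_pos[OF a] by simp
  moreover have r: "w \<alpha> \<in> \<Phi>" using a assms(1) simple_root weyl_root by blast
  ultimately show "pos (w \<alpha>)" using ip_rho_pos[of "- w \<alpha>"] pos_uminus[OF r] by (auto simp: ip_uminus_right)
qed

end

section \<open>The group ring of the weight lattice\<close>

lemma torus_expand:
  fixes f :: "'n::finite torus_ring"
  assumes "finite A" "Poly_Mapping.keys f \<subseteq> A"
  shows "f = (\<Sum>\<mu>\<in>A. Poly_Mapping.single \<mu> (Poly_Mapping.lookup f \<mu>))"
proof (rule poly_mapping_eqI)
  fix \<nu>
  have "(\<Sum>\<mu>\<in>A. if \<mu> = \<nu> then Poly_Mapping.lookup f \<mu> else 0) = Poly_Mapping.lookup f \<nu>"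
    using assms by (auto simp: in_keys_iff)
  then show "Poly_Mapping.lookup f \<nu> =
      Poly_Mapping.lookup (\<Sum>\<mu>\<in>A. Poly_Mapping.single \<mu> (Poly_Mapping.lookup f \<mu>)) \<nu>"
    by (simp add: lookup_sum lookup_single when_def)
qed

lemma single_eq_of_int_expw: "Poly_Mapping.single \<mu> c = of_int c * expw \<mu>"
proof (rule poly_mapping_eqI)
  fix \<nu>
  show "Poly_Mapping.lookup (Poly_Mapping.single \<mu> c) \<nu> = Poly_Mapping.lookup (of_int c * expw \<mu>) \<nu>"
    by (simp add: lookup_of_int_mult expw_def lookup_single when_def)
qed

lemma expw_mult: "expw \<mu> * expw \<nu> = expw (\<mu> + \<nu>)"
  by (simp add: expw_def mult_single)

lemma push_superset:
  assumes "finite A" "Poly_Mapping.keys f \<subseteq> A"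
  shows "push \<phi> f = (\<Sum>\<mu>\<in>A. Poly_Mapping.single (\<phi> \<mu>) (Poly_Mapping.lookup f \<mu>))"
  unfolding push_def by (rule sum.mono_neutral_left) (use assms in \<open>auto simp: in_keys_iff\<close>)

lemma push_add: "push \<phi> (f + g) = push \<phi> f + push \<phi> g"
proof -
  let ?A = "Poly_Mapping.keys f \<union> Poly_Mapping.keys g"
  have "push \<phi> (f + g) = (\<Sum>\<mu>\<in>?A. Poly_Mapping.single (\<phi> \<mu>) (Poly_Mapping.lookup (f + g) \<mu>))"
    by (rule push_superset) (use keys_add[of f g] in auto)
  also have "\<dots> = push \<phi> f + push \<phi> g"
    by (subst (1 2) push_superset[of ?A]) (auto simp: lookup_add single_add sum.distrib)
  finally show ?thesis .
qed

lemma push_zero [simp]: "push \<phi> 0 = 0"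
  by (simp add: push_def)

lemma push_sum: "push \<phi> (\<Sum>i\<in>A. f i) = (\<Sum>i\<in>A. push \<phi> (f i))"
  by (induction A rule: infinite_finite_induct) (simp_all add: push_add)

lemma push_single: "push \<phi> (Poly_Mapping.single \<mu> c) = Poly_Mapping.single (\<phi> \<mu>) c"
  by (simp add: push_def)

lemma push_expw: "push \<phi> (expw \<mu>) = expw (\<phi> \<mu>)"
  by (simp add: expw_def push_single)

lemma torus_mult_expand:
  fixes f g :: "'n::finite torus_ring"
  shows "f * g = (\<Sum>\<mu>\<in>Poly_Mapping.keys f. \<Sum>\<nu>\<in>Poly_Mapping.keys g.
    Poly_Mapping.single (\<mu> + \<nu>) (Poly_Mapping.lookup f \<mu> * Poly_Mapping.lookup g \<nu>))"
proof -
  have "f = (\<Sum>\<mu>\<in>Poly_Mapping.keys f. Poly_Mapping.single \<mu> (Poly_Mapping.lookup f \<mu>))"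
    "g = (\<Sum>\<mu>\<in>Poly_Mapping.keys g. Poly_Mapping.single \<mu> (Poly_Mapping.lookup g \<mu>))"
    by (rule torus_expand; simp)+
  from arg_cong2[where f = "(*)", OF this] show ?thesis by (simp only: sum_product mult_single)
qed

lemma push_mult:
  assumes "\<And>x y. \<phi> (x + y) = \<phi> x + \<phi> y"
  shows "push \<phi> (f * g) = push \<phi> f * push \<phi> g"
proof -
  have "push \<phi> (f * g) = (\<Sum>\<mu>\<in>Poly_Mapping.keys f. \<Sum>\<nu>\<in>Poly_Mapping.keys g.
      Poly_Mapping.single (\<phi> \<mu>) (Poly_Mapping.lookup f \<mu>) * Poly_Mapping.single (\<phi> \<nu>) (Poly_Mapping.lookup g \<nu>))"
    by (subst torus_mult_expand) (simp add: push_sum push_single assms mult_single)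
  then show ?thesis by (simp add: push_def sum_product)
qed

lemma push_of_int_mult: "push \<phi> (of_int c * f) = of_int c * push \<phi> f"
proof -
  have "Poly_Mapping.keys (of_int c * f) \<subseteq> Poly_Mapping.keys f"
    by (auto simp: in_keys_iff lookup_of_int_mult)
  then have "push \<phi> (of_int c * f) = (\<Sum>\<mu>\<in>Poly_Mapping.keys f.
      Poly_Mapping.single (\<phi> \<mu>) (Poly_Mapping.lookup (of_int c * f) \<mu>))"
    by (intro push_superset) simp_all
  also have "\<dots> = of_int c * push \<phi> f"
    unfolding push_def sum_distrib_left
    by (intro sum.cong refl) (simp add: lookup_of_int_mult single_eq_of_int_expw mult.assoc)
  finally show ?thesis .
qed

text \<open>Stands in for a monomial order: on a finite set of exponents it yields an additive
  injective map to the integers.\<close>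

lemma separating_functional:
  fixes F :: "(int ^ 'n::finite) set"
  assumes "finite F" "0 \<notin> F"
  shows "\<exists>\<phi> :: int ^ 'n \<Rightarrow> int. (\<forall>x y. \<phi> (x + y) = \<phi> x + \<phi> y) \<and> (\<forall>x\<in>F. \<phi> x \<noteq> 0)"
  using assms
proof (induction F rule: finite_induct)
  case empty
  show ?case by (rule exI[of _ "\<lambda>_. 0"]) simp
next
  case (insert x F)
  then obtain \<phi> :: "int ^ 'n \<Rightarrow> int" where \<phi>: "\<And>x y. \<phi> (x + y) = \<phi> x + \<phi> y" "\<And>x. x \<in> F \<Longrightarrow> \<phi> x \<noteq> 0" by auto
  show ?case
  proof (cases "\<phi> x = 0")
    case False
    then show ?thesis using \<phi> by (intro exI[of _ \<phi>]) auto
  next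
    case True
    obtain i where i: "x $ i \<noteq> 0" using insert.prems by (auto simp: vec_eq_iff)
    \<comment> \<open>M exceeds |y_i| for all y in F, so M \<phi>(y) cannot be cancelled by y_i; at
      x, where \<phi> vanishes, the coordinate x_i is nonzero.\<close>
    define M where "M = 1 + (\<Sum>y\<in>F. \<bar>y $ i\<bar>)"
    have nz: "M * \<phi> y + y $ i \<noteq> 0" if y: "y \<in> F" for y
    proof
      assume "M * \<phi> y + y $ i = 0"
      then have "y $ i = - (M * \<phi> y)" by linarith
      moreover have "M \<ge> 0" unfolding M_def by (simp add: sum_nonneg)
      ultimately have e: "\<bar>y $ i\<bar> = M * \<bar>\<phi> y\<bar>" by (simp add: abs_mult)
      have "\<bar>y $ i\<bar> < M" using member_le_sum[of y F "\<lambda>y. \<bar>y $ i\<bar>"] y insert.hyps by (simp add: M_def)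
      moreover have "M * 1 \<le> M * \<bar>\<phi> y\<bar>" using \<phi>(2)[OF y] \<open>M \<ge> 0\<close> by (intro mult_left_mono) auto
      ultimately show False using e by linarith
    qed
    show ?thesis
      by (rule exI[of _ "\<lambda>y. M * \<phi> y + y $ i"]) (use \<phi> nz True i in \<open>auto simp: algebra_simps\<close>)
  qed
qed

text \<open>With a functional separating the exponents, the maximal exponents a of f and b of g
  produce a + b in no other way, so the product has a nonzero coefficient there.\<close>

lemma torus_no_zero_divisors:
  fixes f g :: "'n::finite torus_ring"
  assumes "f \<noteq> 0" "g \<noteq> 0"
  shows "f * g \<noteq> 0"
proof -
  let ?K = "Poly_Mapping.keys f" and ?L = "Poly_Mapping.keys g"
  let ?F = "(\<lambda>(x, y). x - y) ` (?K \<times> ?K \<union> ?L \<times> ?L) - {0}"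
  obtain \<phi> :: "int ^ 'n \<Rightarrow> int" where \<phi>: "\<And>x y. \<phi> (x + y) = \<phi> x + \<phi> y" "\<And>x. x \<in> ?F \<Longrightarrow> \<phi> x \<noteq> 0"
    using separating_functional[of ?F] by (metis (no_types, lifting) DiffD2 finite_Diff finite_SigmaI finite_UnI finite_imageI finite_keys singletonI)
  have inj: "x = y" if "\<phi> x = \<phi> y" "x \<in> ?K \<and> y \<in> ?K \<or> x \<in> ?L \<and> y \<in> ?L" for x y
  proof -
    have "\<phi> (x - y) = 0" using \<phi>(1)[of "x - y" y] that(1) by simp
    then have "x - y \<notin> ?F" using \<phi>(2) by blast
    moreover have "x - y \<in> (\<lambda>(x, y). x - y) ` (?K \<times> ?K \<union> ?L \<times> ?L)" using that(2) by force
    ultimately show ?thesis by simp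
  qed
  have ne: "?K \<noteq> {}" "?L \<noteq> {}" using assms by simp_all
  have "Max (\<phi> ` ?K) \<in> \<phi> ` ?K" "Max (\<phi> ` ?L) \<in> \<phi> ` ?L" using ne by (intro Max_in; simp)+
  then obtain a b where a: "a \<in> ?K" "\<phi> a = Max (\<phi> ` ?K)" and b: "b \<in> ?L" "\<phi> b = Max (\<phi> ` ?L)"
    by force
  have mx: "\<phi> x \<le> \<phi> a" if "x \<in> ?K" for x using that a(2) by simp
  have my: "\<phi> y \<le> \<phi> b" if "y \<in> ?L" for y using that b(2) by simp
  have "Poly_Mapping.lookup (f * g) (a + b) = (\<Sum>x\<in>?K. \<Sum>y\<in>?L.
      if x = a then (if y = b then Poly_Mapping.lookup f a * Poly_Mapping.lookup g b else 0) else 0)"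
  proof (subst torus_mult_expand, unfold lookup_sum, intro sum.cong refl)
    fix x y assume xy: "x \<in> ?K" "y \<in> ?L"
    have "x = a \<and> y = b" if "x + y = a + b"
    proof -
      have "\<phi> x + \<phi> y = \<phi> a + \<phi> b" using that \<phi>(1) by metis
      then have "\<phi> x = \<phi> a" "\<phi> y = \<phi> b" using mx[OF xy(1)] my[OF xy(2)] by linarith+
      then show ?thesis using inj xy a b by blast
    qed
    then show "Poly_Mapping.lookup (Poly_Mapping.single (x + y) (Poly_Mapping.lookup f x * Poly_Mapping.lookup g y)) (a + b) =
        (if x = a then (if y = b then Poly_Mapping.lookup f a * Poly_Mapping.lookup g b else 0) else 0)"
      by (auto simp: lookup_single when_def)
  qed
  also have "\<dots> = Poly_Mapping.lookup f a * Poly_Mapping.lookup g b"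
  proof -
    have "(\<Sum>y\<in>?L. if x = a then (if y = b then v else 0) else 0) = (if x = a then v else (0::int))" for x v
      using b(1) by simp
    then show ?thesis using a(1) by simp
  qed
  also have "\<dots> \<noteq> 0" using a(1) b(1) by (simp add: in_keys_iff)
  finally show ?thesis by auto
qed

lemma exact_div_mult:
  fixes g h :: "'n::finite torus_ring"
  assumes "g \<noteq> 0"
  shows "exact_div (g * h) g = h"
  unfolding exact_div_def
proof (rule the_equality)
  fix h' assume "g * h' = g * h"
  then have "g * (h' - h) = 0" by (simp add: right_diff_distrib)
  then show "h' = h" using torus_no_zero_divisors[OF assms, of "h' - h"] by auto
qed simp

section \<open>Antisymmetrization and the Weyl denominator\<close>

context simply_connected_datum
begin

abbreviation sg where "sg \<equiv> sgn_W R"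
abbreviation anti where "anti \<equiv> antisym R"
abbreviation \<delta> where "\<delta> \<equiv> weyl_denom R"

lemma antisym_zero: "anti 0 = 0"
  by (simp add: antisym_def)

lemma antisym_add: "anti (f + g) = anti f + anti g"
  by (simp add: antisym_def push_add distrib_left sum.distrib)

lemma antisym_sum: "anti (\<Sum>i\<in>A. f i) = (\<Sum>i\<in>A. anti (f i))"
  by (induction A rule: infinite_finite_induct) (simp_all add: antisym_add antisym_zero)

lemma antisym_of_int_mult: "anti (of_int c * f) = of_int c * anti f"
  by (simp add: antisym_def push_of_int_mult sum_distrib_left mult.left_commute)

lemma antisym_single: "anti (Poly_Mapping.single \<mu> c) = of_int c * anti (expw \<mu>)"
  unfolding single_eq_of_int_expw by (rule antisym_of_int_mult)

lemma antisym_expw: "anti (expw \<mu>) = (\<Sum>y\<in>W. of_int (sg y) * expw (y \<mu>))"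
  by (simp add: antisym_def push_expw)

lemma antisym_weyl:
  assumes y: "y \<in> W"
  shows "anti (expw (y \<mu>)) = of_int (sg y) * anti (expw \<mu>)"
proof -
  have "anti (expw (y \<mu>)) = (\<Sum>z\<in>W. of_int (sg z) * expw (z (y \<mu>)))" by (rule antisym_expw)
  also have "\<dots> = (\<Sum>z\<in>W. of_int (sg y) * (of_int (sg z) * expw (z \<mu>)))"
  proof (rule sum.reindex_bij_witness[of _ "\<lambda>z. z \<circ> inv y" "\<lambda>z. z \<circ> y"])
    fix z assume z: "z \<in> W"
    have "sg (z \<circ> y) = sg z * sg y" using z y by (rule sgn_comp)
    then have "sg y * sg (z \<circ> y) = sg z" using sgn_square[of y] by (simp add: mult.left_commute)
    then show "of_int (sg y) * (of_int (sg (z \<circ> y)) * expw ((z \<circ> y) \<mu>)) = of_int (sg z) * expw (z (y \<mu>))"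
      by (simp add: mult.assoc[symmetric] flip: of_int_mult)
  qed (use y in \<open>simp_all add: comp_assoc weyl_comp weyl_inv\<close>)
  finally show ?thesis by (simp add: antisym_expw sum_distrib_left)
qed

lemma sgn_simple: "\<alpha> \<in> \<Delta> \<Longrightarrow> sg (\<sigma> \<alpha>) = - 1"
  using sgn_comp_simple[of id \<alpha>] by simp

lemma antisym_singular:
  assumes a: "\<alpha> \<in> \<Delta>" and "pairing \<mu> (coroot R \<alpha>) = 0"
  shows "anti (expw \<mu>) = 0"
proof -
  have "\<sigma> \<alpha> \<mu> = \<mu>" using assms by (simp add: reflection_def)
  then have e: "anti (expw \<mu>) = - anti (expw \<mu>)"
    using antisym_weyl[OF weyl_simple[OF a], of \<mu>] a by (simp add: sgn_simple)
  show ?thesis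
  proof (rule poly_mapping_eqI)
    fix k
    have "Poly_Mapping.lookup (anti (expw \<mu>)) k = - Poly_Mapping.lookup (anti (expw \<mu>)) k"
      using arg_cong[OF e, of "\<lambda>f. Poly_Mapping.lookup f k"] by simp
    then show "Poly_Mapping.lookup (anti (expw \<mu>)) k = Poly_Mapping.lookup 0 k" by simp
  qed
qed

lemma antisym_mult_invariant:
  assumes "\<And>y. y \<in> W \<Longrightarrow> push y m = m"
  shows "anti (f * m) = anti f * m"
proof -
  have "of_int (sg y) * push y (f * m) = of_int (sg y) * push y f * m" if "y \<in> W" for y
    using assms[OF that] push_mult[of y f m] weyl_add[OF that] by (simp add: mult.assoc)
  then show ?thesis by (simp add: antisym_def sum_distrib_right)
qed

text \<open>The stabilizer of \<rho> is trivial, so exp(\<rho>) occurs in \<delta> with coefficient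
  1.\<close>

lemma weyl_denom_nonzero: "\<delta> \<noteq> 0"
proof -
  have "Poly_Mapping.lookup \<delta> (rho R) = (\<Sum>y\<in>W. if y = id then 1 else 0)"
    unfolding weyl_denom_def antisym_expw lookup_sum
  proof (intro sum.cong refl)
    fix y assume y: "y \<in> W"
    have "y (rho R) = rho R \<longleftrightarrow> y = id" using rho_stabilizer[OF y] by auto
    then show "Poly_Mapping.lookup (of_int (sg y) * expw (y (rho R))) (rho R) = (if y = id then 1 else 0)"
      by (auto simp: lookup_of_int_mult expw_def lookup_single when_def)
  qed
  then show ?thesis by auto
qed

text \<open>Summed over the orbit as a set, so that exp(x) has coefficient 1 even when x has a
  nontrivial stabilizer.\<close>

definition orbit_sum :: "int ^ 'n \<Rightarrow> 'n torus_ring" where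
  "orbit_sum x = (\<Sum>\<mu>\<in>(\<lambda>w. w x) ` W. expw \<mu>)"

lemma push_orbit_sum:
  assumes y: "y \<in> W"
  shows "push y (orbit_sum x) = orbit_sum x"
proof -
  have "push y (orbit_sum x) = (\<Sum>\<mu>\<in>(\<lambda>w. w x) ` W. expw (y \<mu>))"
    by (simp add: orbit_sum_def push_sum push_expw)
  also have "\<dots> = orbit_sum x"
    unfolding orbit_sum_def
  proof (rule sum.reindex_bij_witness[of _ "inv y" y])
    fix \<mu> assume "\<mu> \<in> (\<lambda>w. w x) ` W"
    then obtain w where w: "w \<in> W" "\<mu> = w x" by blast
    have "y \<mu> = (y \<circ> w) x" "inv y \<mu> = (inv y \<circ> w) x" using w by simp_all
    then show "y \<mu> \<in> (\<lambda>w. w x) ` W" "inv y \<mu> \<in> (\<lambda>w. w x) ` W"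
      using w y weyl_comp weyl_inv by blast+
  qed (use y in \<open>simp_all add: weyl_inv_apply\<close>)
  finally show ?thesis .
qed

text \<open>
  For \<open>x\<close> dominant \<open>\<delta>\<close> times the orbit sum of \<open>x\<close> is the sum of the antisymmetrizations of \<open>\<rho> + \<mu>\<close> over the
  orbit, and the norm of \<open>\<rho> + \<mu>\<close> is maximal exactly for \<open>\<mu> = x\<close>.
\<close>

lemma weyl_denom_dvd_antisym_expw: "\<exists>h. anti (expw \<nu>) = \<delta> * h"
\<comment> \<open>The form is integral and nonnegative, so the norm is a natural-number
  measure.\<close>
proof (induction "nat (ip \<nu> \<nu>)" arbitrary: \<nu> rule: less_induct)
  case less
  obtain z where z: "z \<in> W" "\<And>\<alpha>. \<alpha> \<in> \<Delta> \<Longrightarrow> pairing (z \<nu>) (coroot R \<alpha>) \<ge> 0"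
    using parabolic_dominant_conj[of \<Delta> \<nu>] unfolding weyl_def by blast
  have "anti (expw (z \<nu>)) = of_int (sg z) * anti (expw \<nu>)" using antisym_weyl[OF z(1)] .
  then have nu: "anti (expw \<nu>) = of_int (sg z) * anti (expw (z \<nu>))"
    by (simp add: mult.assoc[symmetric] flip: of_int_mult)
  show ?case
  proof (cases "\<exists>\<alpha>\<in>\<Delta>. pairing (z \<nu>) (coroot R \<alpha>) = 0")
    case True
    then have "anti (expw \<nu>) = 0" using nu antisym_singular by auto
    then show ?thesis by (intro exI[of _ 0]) simp
  next
    case False
    \<comment> \<open>Pairings of the dominant regular weight with simple coroots are at least 1,
      and those of \<rho> equal 1, so the difference is still dominant.\<close>
    define x where "x = z \<nu> - rho R"
    have "pairing x (coroot R \<alpha>) \<ge> 0" if "\<alpha> \<in> \<Delta>" for \<alpha>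
      using z(2)[OF that] False that by (force simp: x_def pairing_simps pairing_rho)
    then have dom: "dominant R x" by (simp add: dominant_def)
    let ?O = "(\<lambda>w. w x) ` W"
    have x: "x \<in> ?O" using weyl_id by (metis id_apply image_eqI)
    have ex: "\<exists>h. anti (expw (rho R + \<mu>)) = \<delta> * h" if m: "\<mu> \<in> ?O - {x}" for \<mu>
    proof (rule less.hyps)
      obtain w where w: "w \<in> W" "\<mu> = w x" using m by blast
      have "ip (rho R) \<mu> < ip (rho R) x"
        using ip_rho_orbit[OF dom w(1)] w m by force
      moreover have "ip \<mu> \<mu> = ip x x" using w ip_weyl by simp
      moreover have "ip \<nu> \<nu> = ip (rho R + x) (rho R + x)" using ip_weyl[OF z(1)] by (simp add: x_def)
      ultimately have "ip (rho R + \<mu>) (rho R + \<mu>) < ip \<nu> \<nu>"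
        by (simp add: ip_add_left ip_add_right ip_commute[of \<mu> "rho R"] ip_commute[of x "rho R"])
      then show "nat (ip (rho R + \<mu>) (rho R + \<mu>)) < nat (ip \<nu> \<nu>)"
        using ip_nonneg[of "rho R + \<mu>"] by linarith
    qed
    then obtain h where h: "\<And>\<mu>. \<mu> \<in> ?O - {x} \<Longrightarrow> anti (expw (rho R + \<mu>)) = \<delta> * h \<mu>" by metis
    have "\<delta> * orbit_sum x = anti (expw (rho R) * orbit_sum x)"
      unfolding weyl_denom_def by (rule antisym_mult_invariant[OF push_orbit_sum, symmetric])
    also have "\<dots> = (\<Sum>\<mu>\<in>?O. anti (expw (rho R + \<mu>)))"
      by (simp add: orbit_sum_def sum_distrib_left expw_mult antisym_sum)
    also have "\<dots> = anti (expw (z \<nu>)) + (\<Sum>\<mu>\<in>?O - {x}. anti (expw (rho R + \<mu>)))"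
      using x by (subst sum.remove[of _ x]) (simp_all add: x_def)
    also have "(\<Sum>\<mu>\<in>?O - {x}. anti (expw (rho R + \<mu>))) = \<delta> * (\<Sum>\<mu>\<in>?O - {x}. h \<mu>)"
      unfolding sum_distrib_left by (intro sum.cong refl h)
    \<comment> \<open>Every orbit term other than x has smaller norm and is divisible by induction;
      solving for the remaining term gives the quotient.\<close>
    finally have "anti (expw (z \<nu>)) = \<delta> * (orbit_sum x - (\<Sum>\<mu>\<in>?O - {x}. h \<mu>))"
      by (simp add: algebra_simps)
    then show ?thesis
      by (intro exI[of _ "of_int (sg z) * (orbit_sum x - (\<Sum>\<mu>\<in>?O - {x}. h \<mu>))"])
        (simp only: nu mult.left_commute)
  qed
qed

text \<open>Divisibility holds at every weight, so the quotient in \<open>weyl_char\<close> is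
  genuine also for non-dominant \<mu>.\<close>

lemma antisym_weyl_char: "anti (expw (\<mu> + rho R)) = \<delta> * weyl_char R \<mu>"
proof -
  obtain h where "anti (expw (\<mu> + rho R)) = \<delta> * h" using weyl_denom_dvd_antisym_expw by blast
  then show ?thesis by (simp add: weyl_char_def exact_div_mult[OF weyl_denom_nonzero])
qed

section \<open>The basis elements\<close>

text \<open>A is a union of cosets of the parabolic subgroup, on each of which c is constant; the
  induction removes one coset at a time.\<close>

lemma card_dvd_sum_cosets:
  assumes J: "J \<subseteq> \<Delta>" and A: "A \<subseteq> W" and closed: "\<And>y h. y \<in> A \<Longrightarrow> h \<in> parabolic R J \<Longrightarrow> y \<circ> h \<in> A"
    and c: "\<And>y h. h \<in> parabolic R J \<Longrightarrow> c (y \<circ> h) = c y"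
  shows "int (card (parabolic R J)) dvd (\<Sum>y\<in>A. c y)"
  using A closed
proof (induction "card A" arbitrary: A rule: less_induct)
  case less
  let ?H = "parabolic R J"
  have fA: "finite A" using less.prems(1) finite_subset finite_weyl by blast
  show ?case
  proof (cases "A = {}")
    case False
    then obtain a where a: "a \<in> A" by blast
    define C where "C = (\<lambda>h. a \<circ> h) ` ?H"
    have CA: "C \<subseteq> A" using a less.prems(2) by (auto simp: C_def)
    have "inj_on (\<lambda>h. a \<circ> h) ?H"
    proof (rule inj_onI)
      fix h h' assume "a \<circ> h = a \<circ> h'"
      then have "(inv a \<circ> a) \<circ> h = (inv a \<circ> a) \<circ> h'" by (metis comp_assoc)
      then show "h = h'" using a less.prems(1) by auto
    qed
    then have "(\<Sum>y\<in>C. c y) = (\<Sum>h\<in>?H. c (a \<circ> h))" unfolding C_def by (simp add: sum.reindex)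
    also have "\<dots> = (\<Sum>h\<in>?H. c a)" by (intro sum.cong refl c)
    finally have sC: "(\<Sum>y\<in>C. c y) = int (card ?H) * c a" by simp
    have "a \<in> C" unfolding C_def using parabolic_id by (metis comp_id image_eqI)
    then have "A - C \<subset> A" using a by blast
    then have "card (A - C) < card A" using fA by (rule psubset_card_mono[rotated])
    then have "int (card ?H) dvd (\<Sum>y\<in>A - C. c y)"
    proof (rule less.hyps)
      show "A - C \<subseteq> W" using less.prems(1) by blast
      show "y \<circ> h \<in> A - C" if y: "y \<in> A - C" and h: "h \<in> ?H" for y h
      proof -
        have "y \<circ> h \<notin> C"
        proof
          assume "y \<circ> h \<in> C"
          then obtain h' where h': "h' \<in> ?H" "y \<circ> h = a \<circ> h'" by (auto simp: C_def)
          have hW: "h \<in> W" using parabolic_weyl[OF J h] .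
          have "y \<circ> (h \<circ> inv h) = a \<circ> (h' \<circ> inv h)" using h'(2) by (metis comp_assoc)
          then have "y = a \<circ> (h' \<circ> inv h)" using hW by simp
          moreover have "h' \<circ> inv h \<in> ?H" using h'(1) parabolic_inv[OF J h] parabolic_comp by blast
          ultimately show False using y by (auto simp: C_def)
        qed
        then show ?thesis using less.prems(2)[of y h] y h by blast
      qed
    qed
    moreover have "(\<Sum>y\<in>A. c y) = (\<Sum>y\<in>A - C. c y) + (\<Sum>y\<in>C. c y)"
      using CA fA by (rule sum.subset_diff)
    ultimately show ?thesis using sC by simp
  qed simp
qed

lemma kl_basis_parabolic_invariant:
  assumes u: "u \<in> W" and h: "h \<in> parabolic R (descents R u)"
  shows "kl_basis R u (y \<circ> h) = kl_basis R u y"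
proof -
  have "kl_basis R u (y \<circ> refl_word R as) = kl_basis R u y" if "set as \<subseteq> descents R u" for as
    using that
  proof (induction as rule: rev_induct)
    case (snoc a as)
    have "y \<circ> refl_word R (as @ [a]) = (y \<circ> refl_word R as) \<circ> \<sigma> a" 
      by (simp add: refl_word_append comp_assoc)
    then show ?case
      using snoc kl_basis_right_invariant[OF u, of a "y \<circ> refl_word R as"]
      by (metis (no_types, lifting) Un_insert_right append.right_neutral insert_subset list.simps(15) set_append)
  qed simp
  then show ?thesis using h by (auto simp: parabolic_def)
qed

text \<open>The THE in \<open>exact_div\<close> says something about the exponents only if the
  division succeeds. It does: the parabolic subgroup of the descents fixes the weight and leaves the
  coefficients \<open>kl_basis R u\<close> invariant, so each coefficient of the orbit combination
  is a sum over full cosets.\<close>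

lemma keys_fbasis:
  assumes u: "u \<in> W"
  shows "Poly_Mapping.keys (fbasis R u) \<subseteq> (\<lambda>y. y (fund_sum R (\<Delta> - descents R u))) ` W"
proof -
  let ?J = "descents R u" and ?p = "fund_sum R (\<Delta> - descents R u)"
  let ?n = "card (parabolic R ?J)"
  let ?c = "kl_basis R u"
  define F where "F = weyl_ring_act R ?c (expw ?p)"
  have J: "?J \<subseteq> \<Delta>" by (rule descents_simples)
  have fix_p: "h ?p = ?p" if "h \<in> parabolic R ?J" for h
    by (rule parabolic_fixes[OF J that]) (use J in \<open>auto simp: pairing_fund_sum\<close>)
  have lF: "Poly_Mapping.lookup F \<mu> = (\<Sum>y | y \<in> W \<and> y ?p = \<mu>. ?c y)" for \<mu>
  proof -
    have "Poly_Mapping.lookup F \<mu> = (\<Sum>y\<in>W. if y ?p = \<mu> then ?c y else 0)"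
      unfolding F_def weyl_ring_act_def push_expw lookup_sum lookup_of_int_mult
      by (intro sum.cong refl) (simp add: expw_def lookup_single when_def)
    then show ?thesis by (simp add: sum.inter_filter)
  qed
  have dv: "int ?n dvd Poly_Mapping.lookup F \<mu>" for \<mu>
    unfolding lF
  proof (rule card_dvd_sum_cosets[OF J])
    fix y h assume "y \<in> {y \<in> W. y ?p = \<mu>}" and h: "h \<in> parabolic R ?J"
    then show "y \<circ> h \<in> {y \<in> W. y ?p = \<mu>}"
      using weyl_comp parabolic_weyl[OF J h] fix_p[OF h] by simp
  qed (use kl_basis_parabolic_invariant[OF u] in auto)
  have "finite (parabolic R ?J)" using parabolic_weyl[OF J] finite_subset[OF _ finite_weyl] by blast
  then have n: "?n \<noteq> 0" using parabolic_id by (metis card_0_eq empty_iff)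
  define h where "h = Poly_Mapping.map (\<lambda>x. x div int ?n) F"
  have lh: "Poly_Mapping.lookup h \<mu> = Poly_Mapping.lookup F \<mu> div int ?n" for \<mu>
    by (simp add: h_def map.rep_eq when_def)
  have "F = of_int (int ?n) * h"
    by (rule poly_mapping_eqI) (use dv in \<open>simp only: lookup_of_int_mult lh dvd_mult_div_cancel\<close>)
  then have Fh: "F = of_nat ?n * h" by simp
  have "Poly_Mapping.lookup (of_nat ?n :: 'n torus_ring) 0 \<noteq> 0" using n by (simp add: lookup_of_nat)
  then have "(of_nat ?n :: 'n torus_ring) \<noteq> 0" by (metis lookup_zero)
  then have "fbasis R u = h"
    unfolding fbasis_def F_def[symmetric] Fh by (rule exact_div_mult)
  moreover have "\<mu> \<in> (\<lambda>y. y ?p) ` W" if "\<mu> \<in> Poly_Mapping.keys h" for \<mu>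
  proof (rule ccontr)
    assume "\<mu> \<notin> (\<lambda>y. y ?p) ` W"
    then have "{y \<in> W. y ?p = \<mu>} = {}" by blast
    then have "Poly_Mapping.lookup F \<mu> = 0" by (simp only: lF sum.empty)
    then show False using that lh by (simp add: in_keys_iff)
  qed
  ultimately show ?thesis by blast
qed

section \<open>The matrix coefficients\<close>

text \<open>The transformation used, y times the inverse of z, depends only on y and \<nu>, hence
  \<kappa> and e serve all m simultaneously. The value e = 0 records a term that vanishes; otherwise
  \<kappa> is strictly dominant outside I, leaving room to subtract \<rho>.\<close>

lemma antisym_normalize:
  assumes I: "I \<subseteq> \<Delta>" and y: "y \<in> W"
  shows "\<exists>\<kappa> e. (\<forall>m. anti (expw (m *s y (fund_sum R I) + \<nu>)) = of_int e * anti (expw (m *s fund_sum R I + \<kappa>)))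
      \<and> (e = 0 \<or> (\<forall>\<alpha>\<in>\<Delta> - I. pairing \<kappa> (coroot R \<alpha>) \<ge> 1))"
proof -
  let ?p = "fund_sum R I"
  obtain z where z: "z \<in> parabolic R (\<Delta> - I)"
    "\<And>\<alpha>. \<alpha> \<in> \<Delta> - I \<Longrightarrow> pairing (z (inv y \<nu>)) (coroot R \<alpha>) \<ge> 0"
    using parabolic_dominant_conj[of "\<Delta> - I" "inv y \<nu>"] by blast
  define \<kappa> where "\<kappa> = z (inv y \<nu>)"
  have iz: "inv z \<in> parabolic R (\<Delta> - I)" using parabolic_inv[OF _ z(1)] by simp
  have zW: "z \<in> W" "inv z \<in> W" using parabolic_weyl z(1) iz by blast+
  have fixp: "inv z ?p = ?p"
    by (rule parabolic_fixes[OF _ iz]) (use I in \<open>auto simp: pairing_fund_sum\<close>)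
  have yz: "y \<circ> inv z \<in> W" using y zW weyl_comp by blast
  have "(y \<circ> inv z) (m *s ?p + \<kappa>) = m *s y ?p + \<nu>" for m
  proof -
    have "inv z (m *s ?p + \<kappa>) = m *s ?p + inv y \<nu>"
      using zW by (simp add: weyl_add weyl_smult fixp \<kappa>_def weyl_inv_apply)
    then show ?thesis using y by (simp add: weyl_add weyl_smult weyl_inv_apply)
  qed
  then have e: "anti (expw (m *s y ?p + \<nu>)) = of_int (sg (y \<circ> inv z)) * anti (expw (m *s ?p + \<kappa>))" for m
    using antisym_weyl[OF yz, of "m *s ?p + \<kappa>"] by simp
  show ?thesis
  proof (cases "\<exists>\<alpha>\<in>\<Delta> - I. pairing \<kappa> (coroot R \<alpha>) = 0")
    case True
    then obtain \<alpha> where a: "\<alpha> \<in> \<Delta> - I" "pairing \<kappa> (coroot R \<alpha>) = 0" by blast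
    \<comment> \<open>Outside I the weight \<open>?p\<close> pairs to 0 with simple coroots, so a
      wall containing \<kappa> contains every m \<open>?p\<close> + \<kappa>.\<close>
    then have "anti (expw (m *s ?p + \<kappa>)) = 0" for m
      using I by (intro antisym_singular[of \<alpha>]) (auto simp: pairing_simps pairing_fund_sum)
    then have "\<forall>m. anti (expw (m *s y ?p + \<nu>)) = of_int 0 * anti (expw (m *s ?p + \<kappa>))" using e by simp
    then show ?thesis by blast
  next
    case False
    then have "\<forall>\<alpha>\<in>\<Delta> - I. pairing \<kappa> (coroot R \<alpha>) \<ge> 1" using z(2) by (force simp: \<kappa>_def)
    with e show ?thesis by blast
  qed
qed

text \<open>The pairs (\<kappa>, e) are chosen for all pairs of exponents before q is introduced.
  The factor g is arbitrary; for the matrix coefficients it will be a dual basis element.\<close>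

lemma form_frob_pull:
  assumes I: "I \<subseteq> \<Delta>" and f: "Poly_Mapping.keys f \<subseteq> (\<lambda>y. y (fund_sum R I)) ` W"
  shows "\<exists>(\<Lambda> :: (int ^ 'n) set) r. finite \<Lambda> \<and>
      (\<forall>q. form R (frob_pull q f) g = (\<Sum>\<mu>\<in>\<Lambda>. of_int (r \<mu>) * weyl_char R ((int q - 1) *s fund_sum R I + \<mu>))) \<and>
      (\<forall>\<mu>\<in>\<Lambda>. \<forall>\<alpha>\<in>\<Delta> - I. pairing \<mu> (coroot R \<alpha>) \<ge> 0)"
proof -
  let ?p = "fund_sum R I"
  let ?K = "Poly_Mapping.keys f" and ?L = "Poly_Mapping.keys g"
  let ?f = "Poly_Mapping.lookup f" and ?g = "Poly_Mapping.lookup g"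
  let ?Q = "\<lambda>p t. (\<forall>m. anti (expw (m *s fst p + snd p)) = of_int (snd t) * anti (expw (m *s ?p + fst t)))
      \<and> (snd t = 0 \<or> (\<forall>\<alpha>\<in>\<Delta> - I. pairing (fst t) (coroot R \<alpha>) \<ge> 1))"
  have "\<exists>t. ?Q p t" if p: "fst p \<in> ?K" for p
  proof -
    obtain y where y: "y \<in> W" "fst p = y ?p" using p f by blast
    obtain \<kappa> e where "?Q p (\<kappa>, e)"
      using antisym_normalize[OF I y(1), of "snd p"] unfolding y(2) fst_conv snd_conv by blast
    then show ?thesis by blast
  qed
  then have "\<forall>p. \<exists>t. fst p \<in> ?K \<longrightarrow> ?Q p t" by blast
  from choice[OF this] obtain t where t: "\<And>p. fst p \<in> ?K \<Longrightarrow> ?Q p (t p)" by blast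
  define \<kappa> where "\<kappa> = (\<lambda>\<mu> \<nu>. fst (t (\<mu>, \<nu>)))"
  define e where "e = (\<lambda>\<mu> \<nu>. snd (t (\<mu>, \<nu>)))"
  have ke: "anti (expw (m *s \<mu> + \<nu>)) = of_int (e \<mu> \<nu>) * anti (expw (m *s ?p + \<kappa> \<mu> \<nu>))"
    if "\<mu> \<in> ?K" for \<mu> \<nu> m
    using t[of "(\<mu>, \<nu>)"] that by (simp add: \<kappa>_def e_def)
  have k: "pairing (\<kappa> \<mu> \<nu>) (coroot R \<alpha>) \<ge> 1" if "\<mu> \<in> ?K" "e \<mu> \<nu> \<noteq> 0" "\<alpha> \<in> \<Delta> - I" for \<mu> \<nu> \<alpha>
    using t[of "(\<mu>, \<nu>)"] that by (auto simp: \<kappa>_def e_def)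
  \<comment> \<open>Vanishing terms are dropped, since for them nothing is known about
    \<kappa>.\<close>
  define P where "P = {p \<in> ?K \<times> ?L. e (fst p) (snd p) \<noteq> 0}"
  \<comment> \<open>Solves q p + \<kappa> = (q - 1) p + \<lambda> + \<rho> for \<lambda>, with p the
    fundamental sum over I.\<close>
  define l where "l = (\<lambda>p. \<kappa> (fst p) (snd p) + ?p - rho R)"
  define a where "a = (\<lambda>p. ?f (fst p) * ?g (snd p) * e (fst p) (snd p))"
  \<comment> \<open>Several pairs of exponents may lead to the same weight; their coefficients are
    collected.\<close>
  define r where "r = (\<lambda>x. \<Sum>p | p \<in> P \<and> l p = x. a p)"
  have finP: "finite P" by (simp add: P_def)
  have main: "form R (frob_pull q f) g = (\<Sum>x\<in>l ` P. of_int (r x) * weyl_char R ((int q - 1) *s ?p + x))" for q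
  proof -
    let ?V = "\<lambda>x. weyl_char R ((int q - 1) *s ?p + x)"
    have fp: "frob_pull q f = (\<Sum>\<mu>\<in>?K. Poly_Mapping.single (int q *s \<mu>) (?f \<mu>))"
      by (simp add: frob_pull_def push_def)
    have gg: "g = (\<Sum>\<nu>\<in>?L. Poly_Mapping.single \<nu> (?g \<nu>))" by (rule torus_expand) simp_all
    have "frob_pull q f * g = (\<Sum>\<mu>\<in>?K. \<Sum>\<nu>\<in>?L. Poly_Mapping.single (int q *s \<mu> + \<nu>) (?f \<mu> * ?g \<nu>))"
      unfolding fp by (subst gg) (simp add: sum_product mult_single)
    then have "anti (frob_pull q f * g) =
        (\<Sum>\<mu>\<in>?K. \<Sum>\<nu>\<in>?L. of_int (?f \<mu> * ?g \<nu>) * anti (expw (int q *s \<mu> + \<nu>)))"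
      by (simp only: antisym_sum antisym_single)
    also have "\<dots> = (\<Sum>\<mu>\<in>?K. \<Sum>\<nu>\<in>?L. of_int (a (\<mu>, \<nu>)) * (\<delta> * ?V (l (\<mu>, \<nu>))))"
    proof (intro sum.cong refl)
      fix \<mu> \<nu> assume m: "\<mu> \<in> ?K"
      have "int q *s ?p + \<kappa> \<mu> \<nu> = (int q - 1) *s ?p + l (\<mu>, \<nu>) + rho R"
        by (simp add: l_def vec_eq_iff algebra_simps)
      then have "anti (expw (int q *s \<mu> + \<nu>)) = of_int (e \<mu> \<nu>) * (\<delta> * ?V (l (\<mu>, \<nu>)))"
        using ke[OF m, of "int q" \<nu>] by (simp only: antisym_weyl_char)
      then show "of_int (?f \<mu> * ?g \<nu>) * anti (expw (int q *s \<mu> + \<nu>)) =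
          of_int (a (\<mu>, \<nu>)) * (\<delta> * ?V (l (\<mu>, \<nu>)))"
        by (simp add: a_def mult.assoc)
    qed
    also have "\<dots> = (\<Sum>p\<in>?K \<times> ?L. of_int (a p) * (\<delta> * ?V (l p)))"
      by (simp add: sum.cartesian_product case_prod_unfold)
    also have "\<dots> = (\<Sum>p\<in>P. of_int (a p) * (\<delta> * ?V (l p)))"
      by (rule sum.mono_neutral_right) (auto simp: P_def a_def)
    also have "\<dots> = (\<Sum>x\<in>l ` P. \<Sum>p | p \<in> P \<and> l p = x. of_int (a p) * (\<delta> * ?V (l p)))"
      by (rule sum.image_gen[OF finP])
    also have "\<dots> = (\<Sum>x\<in>l ` P. of_int (r x) * (\<delta> * ?V x))"
      by (intro sum.cong refl) (simp add: r_def sum_distrib_right)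
    also have "\<dots> = \<delta> * (\<Sum>x\<in>l ` P. of_int (r x) * ?V x)"
      by (simp add: sum_distrib_left mult.left_commute)
    finally show ?thesis
      unfolding form_def by (simp only: exact_div_mult[OF weyl_denom_nonzero])
  qed
  have "pairing x (coroot R \<alpha>) \<ge> 0" if x: "x \<in> l ` P" and al: "\<alpha> \<in> \<Delta> - I" for x \<alpha>
  proof -
    obtain p where p: "p \<in> P" "x = l p" using x by blast
    have "pairing (\<kappa> (fst p) (snd p)) (coroot R \<alpha>) \<ge> 1" using p al by (intro k) (auto simp: P_def)
    then show ?thesis using al I by (simp add: p(2) l_def pairing_simps pairing_fund_sum pairing_rho)
  qed
  then show ?thesis using finP main by (intro exI[of _ "l ` P"] exI[of _ r]) blast
qed

text \<open>For \<alpha> in I the fundamental sum contributes q - 1, which outgrows the finitely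
  many pairings of \<Lambda>; for the other \<alpha> it contributes 0 and \<open>dom\<close>
  decides.\<close>

lemma eventually_dominant:
  assumes I: "I \<subseteq> \<Delta>" and fin: "finite \<Lambda>"
    and dom: "\<And>\<mu> \<alpha>. \<mu> \<in> \<Lambda> \<Longrightarrow> \<alpha> \<in> \<Delta> - I \<Longrightarrow> pairing \<mu> (coroot R \<alpha>) \<ge> 0"
  shows "\<exists>q0. \<forall>q::nat. q \<ge> q0 \<longrightarrow> (\<forall>\<mu>\<in>\<Lambda>. dominant R ((int q - 1) *s fund_sum R I + \<mu>))"
proof -
  define N where "N = (\<Sum>\<mu>\<in>\<Lambda>. \<Sum>\<alpha>\<in>\<Delta>. \<bar>pairing \<mu> (coroot R \<alpha>)\<bar>)"
  have N: "\<bar>pairing \<mu> (coroot R \<alpha>)\<bar> \<le> N" if "\<mu> \<in> \<Lambda>" "\<alpha> \<in> \<Delta>" for \<mu> \<alpha>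
  proof -
    have "\<bar>pairing \<mu> (coroot R \<alpha>)\<bar> \<le> (\<Sum>\<alpha>\<in>\<Delta>. \<bar>pairing \<mu> (coroot R \<alpha>)\<bar>)"
      by (rule member_le_sum[of \<alpha> \<Delta> "\<lambda>\<alpha>. \<bar>pairing \<mu> (coroot R \<alpha>)\<bar>"]) (use that in auto)
    also have "\<dots> \<le> N" unfolding N_def
      by (rule member_le_sum[of \<mu> \<Lambda> "\<lambda>\<mu>. \<Sum>\<alpha>\<in>\<Delta>. \<bar>pairing \<mu> (coroot R \<alpha>)\<bar>"])
        (use that fin in \<open>auto intro: sum_nonneg\<close>)
    finally show ?thesis .
  qed
  \<comment> \<open>The threshold ensures q - 1 \<ge> N, and N bounds every pairing in absolute
    value.\<close>
  have "dominant R ((int q - 1) *s fund_sum R I + \<mu>)" if q: "q \<ge> nat (1 + N)" and m: "\<mu> \<in> \<Lambda>" for q \<mu>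
    unfolding dominant_def
  proof
    fix \<alpha> assume a: "\<alpha> \<in> \<Delta>"
    have "int q - 1 \<ge> N" using q by linarith
    then show "pairing ((int q - 1) *s fund_sum R I + \<mu>) (coroot R \<alpha>) \<ge> 0"
      using N[OF m a] dom[OF m, of \<alpha>] a by (auto simp: pairing_simps pairing_fund_sum[OF I a])
  qed
  then show ?thesis by blast
qed

end

text \<open>As \<open>weyl_char\<close> is Weyl's formula at an arbitrary weight, the last conjunct
  records that for large q the summands are characters of actual Weyl modules. Finiteness of
  \<Lambda> gives the sum its intended meaning.\<close>

theorem lemma4p2:
  fixes R :: "'n::finite based_root_datum"
    and w :: "'n weyl_elt"
  assumes "almost_simple_simply_connected R"
    and "w \<in> cell_J R"
  shows "\<exists>(\<Lambda> :: (int ^ 'n) set) (r :: int ^ 'n \<Rightarrow> int).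
           finite \<Lambda> \<and>
           (\<forall>p k q. good_prime R p \<and> k \<ge> 1 \<and> q = p ^ k \<longrightarrow>
              M_coeff R q w =
                (\<Sum>\<mu>\<in>\<Lambda>. of_int (r \<mu>) *
                   weyl_char R ((int q - 1) *s fund_sum R (descents R w) + \<mu>))) \<and>
           (\<exists>q0. \<forall>q::nat. q \<ge> q0 \<longrightarrow>
              (\<forall>\<mu>\<in>\<Lambda>. dominant R ((int q - 1) *s fund_sum R (descents R w) + \<mu>)))"
proof -
  interpret simply_connected_datum R
    using assms(1) by unfold_locales (auto simp: almost_simple_simply_connected_def)
  let ?I = "descents R w" and ?u = "longest R \<circ> duflo R w"
  have w: "w \<in> W" using assms(2) by (simp add: cell_J_def)
  have u: "?u \<in> W" using longest_props(1) duflo_props(1)[OF w] by (rule weyl_comp)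
  have "descents R ?u = \<Delta> - ?I"
    using descents_longest_comp[OF duflo_props(1)[OF w]] duflo_props(2)[OF w] by simp
  \<comment> \<open>The complement taken in \<open>fbasis\<close> undoes the one caused by the
    longest element, so the exponents lie in the orbit of the fundamental sum over the descents of w
    itself.\<close>
  then have D: "\<Delta> - descents R ?u = ?I" using descents_simples[of w] by blast
  let ?V = "\<lambda>q \<mu>. weyl_char R ((int q - 1) *s fund_sum R ?I + \<mu>)"
  from form_frob_pull[OF descents_simples keys_fbasis[OF u, unfolded D], of "fdual R (longest R \<circ> w)"]
  obtain \<Lambda> :: "(int ^ 'n) set" and r where fin: "finite \<Lambda>"
    and M: "\<forall>q. form R (frob_pull q (fbasis R ?u)) (fdual R (longest R \<circ> w)) = (\<Sum>\<mu>\<in>\<Lambda>. of_int (r \<mu>) * ?V q \<mu>)"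
    and dom: "\<forall>\<mu>\<in>\<Lambda>. \<forall>\<alpha>\<in>\<Delta> - ?I. pairing \<mu> (coroot R \<alpha>) \<ge> 0"
    by (elim exE conjE) (rule that)
  have "M_coeff R q w = (\<Sum>\<mu>\<in>\<Lambda>. of_int (r \<mu>) * ?V q \<mu>)" for q
    unfolding M_coeff_def using M by (rule spec)
  moreover have "\<exists>q0. \<forall>q::nat. q \<ge> q0 \<longrightarrow> (\<forall>\<mu>\<in>\<Lambda>. dominant R ((int q - 1) *s fund_sum R ?I + \<mu>))"
    by (rule eventually_dominant[OF descents_simples fin]) (use dom in blast)
  ultimately show ?thesis using fin by (intro exI[of _ \<Lambda>] exI[of _ r] conjI allI impI)
qed

end
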